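(* Let $\Gamma$ be a $2$-walk-regular graph which is not a complete multipartite graph, with valency $k\geq 3$ and with an eigenvalue $\theta\neq\pm k$ of multiplicity $3$. Then either $\Gamma$ is a cubic graph with $a_1=a_2=0$, or $\Gamma$ is distance-regular. Moreover, if $\Gamma$ is distance-regular, then $\Gamma$ is the cube, the dodecahedron, or the icosahedron.
   Context: All graphs are finite, simple and connected. A graph is $2$-walk-regular if it has diameter at least $2$ and for every $\ell\geq0$ the number of walks of length $\ell$ between $x$ and $y$ depends only on $\mathrm{dist}(x,y)$ whenever $\mathrm{dist}(x,y)\leq 2$. Such a graph is regular, and for $j\in\{1,2\}$ the number $a_j$ of neighbors of $y$ at distance $j$ from $x$ (for $\mathrm{dist}(x,y)=j$) is a constant. Eigenvalues and multiplicities are those of the adjacency matrix. A graph of diameter $D$ is distance-regular if for all $0\leq j\leq D$ and all $x,y$ with $\mathrm{dist}(x,y)=j$, the numbers of neighbors of $y$ at distance $j-1,j,j+1$ from $x$ depend only on $j$. *)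

theory Defs
  imports "HOL-Analysis.Analysis" "HOL-Library.Disjoint_Sets" "Graph_Theory.Graph_Theory"
begin

text \<open>
  A finite simple graph is a \<^locale>\<open>pair_graph\<close>: finite, loopless, at most one arc per ordered
  pair of vertices, each edge being represented by its two opposite arcs.  The vertex set is all
  of a finite type, so that the adjacency matrix can be indexed by the vertices.
\<close>

definition connected_simple_graph :: "'v::finite pair_pre_digraph \<Rightarrow> bool" where
  "connected_simple_graph G \<longleftrightarrow>
     pair_graph G \<and> pverts G = UNIV \<and> Digraph_Component.connected (with_proj G)"

definition nbrs :: "'a pair_pre_digraph \<Rightarrow> 'a \<Rightarrow> 'a set" where
  "nbrs G x = {y. (x, y) \<in> parcs G}"

definition has_valency :: "'a pair_pre_digraph \<Rightarrow> nat \<Rightarrow> bool" where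
  "has_valency G k \<longleftrightarrow> (\<forall>x\<in>pverts G. card (nbrs G x) = k)"

text \<open>Walks are lists of consecutive arcs; in a graph without parallel arcs they correspond
  one-to-one to sequences of consecutively adjacent vertices.\<close>

definition walks :: "'a pair_pre_digraph \<Rightarrow> nat \<Rightarrow> 'a \<Rightarrow> 'a \<Rightarrow> ('a \<times> 'a) awalk set" where
  "walks G l x y = {p. pre_digraph.awalk (with_proj G) x p y \<and> length p = l}"

text \<open>Only meaningful between vertices joined by a walk, hence used for connected graphs.\<close>

definition graph_dist :: "'a pair_pre_digraph \<Rightarrow> 'a \<Rightarrow> 'a \<Rightarrow> nat" where
  "graph_dist G x y = (LEAST l. walks G l x y \<noteq> {})"

definition graph_diameter :: "'a pair_pre_digraph \<Rightarrow> nat" where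
  "graph_diameter G = Max {graph_dist G x y | x y. x \<in> pverts G \<and> y \<in> pverts G}"

definition two_walk_regular :: "'a pair_pre_digraph \<Rightarrow> bool" where
  "two_walk_regular G \<longleftrightarrow>
     graph_diameter G \<ge> 2 \<and>
     (\<forall>l. \<forall>x\<in>pverts G. \<forall>y\<in>pverts G. \<forall>x'\<in>pverts G. \<forall>y'\<in>pverts G.
        graph_dist G x y \<le> 2 \<and> graph_dist G x' y' = graph_dist G x y \<longrightarrow>
        card (walks G l x' y') = card (walks G l x y))"

definition nbrs_at :: "'a pair_pre_digraph \<Rightarrow> nat \<Rightarrow> 'a \<Rightarrow> 'a \<Rightarrow> 'a set" where
  "nbrs_at G i x y = {z \<in> nbrs G y. graph_dist G x z = i}"

text \<open>\<open>intersection_number_a G j c\<close> says that the intersection number \<open>a\<^sub>j\<close> of \<open>G\<close> exists and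
  equals \<open>c\<close>.  It is vacuous if no two vertices are at distance \<open>j\<close>.\<close>

definition intersection_number_a :: "'a pair_pre_digraph \<Rightarrow> nat \<Rightarrow> nat \<Rightarrow> bool" where
  "intersection_number_a G j c \<longleftrightarrow>
     (\<forall>x\<in>pverts G. \<forall>y\<in>pverts G. graph_dist G x y = j \<longrightarrow> card (nbrs_at G j x y) = c)"

text \<open>The bounds on \<open>i\<close> express \<open>i \<in> {j - 1, j, j + 1}\<close> without truncated subtraction at \<open>j = 0\<close>.\<close>

definition distance_regular :: "'a pair_pre_digraph \<Rightarrow> bool" where
  "distance_regular G \<longleftrightarrow>
     (\<forall>j\<le>graph_diameter G. \<forall>i. j \<le> i + 1 \<and> i \<le> j + 1 \<longrightarrow>
        (\<exists>c. \<forall>x\<in>pverts G. \<forall>y\<in>pverts G.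
           graph_dist G x y = j \<longrightarrow> card (nbrs_at G i x y) = c))"

definition complete_multipartite :: "'a pair_pre_digraph \<Rightarrow> bool" where
  "complete_multipartite G \<longleftrightarrow>
     (\<exists>P. partition_on (pverts G) P \<and>
        (\<forall>x\<in>pverts G. \<forall>y\<in>pverts G.
           (x, y) \<in> parcs G \<longleftrightarrow> \<not> (\<exists>B\<in>P. x \<in> B \<and> y \<in> B)))"

definition adjacency_matrix :: "'v::finite pair_pre_digraph \<Rightarrow> real ^ 'v ^ 'v" where
  "adjacency_matrix G = (\<chi> x y. if (x, y) \<in> parcs G then 1 else 0)"

text \<open>The matrix is real symmetric, so all its eigenvalues are real and their geometric and
  algebraic multiplicities agree.  The value is 0 if \<open>\<theta>\<close> is not an eigenvalue.\<close>

definition eigenvalue_multiplicity :: "'v::finite pair_pre_digraph \<Rightarrow> real \<Rightarrow> nat" where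
  "eigenvalue_multiplicity G \<theta> = dim {v. adjacency_matrix G *v v = \<theta> *\<^sub>R v}"

text \<open>Vertices of the cube are the subsets of a 3-element set, two of them being adjacent iff they
  differ in exactly one element.\<close>

definition cube_graph :: "nat set pair_pre_digraph" where
  "cube_graph =
     \<lparr> pverts = Pow {0, 1, 2},
       parcs = {(S, T). S \<subseteq> {0, 1, 2} \<and> T \<subseteq> {0, 1, 2} \<and> card ((S - T) \<union> (T - S)) = 1} \<rparr>"

text \<open>The dodecahedron as the generalized Petersen graph with parameters \<open>(10, 2)\<close>: the vertices
  \<open>(0, i)\<close> form a 10-cycle and are joined to the vertices \<open>(1, i)\<close> of two inner 5-cycles.\<close>

definition dodecahedron_edges :: "(nat \<times> nat) rel" where
  "dodecahedron_edges =
     {((0, i), (0, (i + 1) mod 10)) | i. i < 10} \<union>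
     {((0, i), (1, i)) | i. i < 10} \<union>
     {((1, i), (1, (i + 2) mod 10)) | i. i < 10}"

definition dodecahedron_graph :: "(nat \<times> nat) pair_pre_digraph" where
  "dodecahedron_graph =
     \<lparr> pverts = {0, 1} \<times> {..<10},
       parcs = dodecahedron_edges \<union> dodecahedron_edges\<inverse> \<rparr>"

text \<open>The icosahedron as a pentagonal antiprism, with pentagons \<open>(1, i)\<close> and \<open>(2, i)\<close>, capped by the
  apices \<open>(0, 0)\<close> and \<open>(3, 0)\<close>.\<close>

definition icosahedron_edges :: "(nat \<times> nat) rel" where
  "icosahedron_edges =
     {((0, 0), (1, i)) | i. i < 5} \<union>
     {((1, i), (1, (i + 1) mod 5)) | i. i < 5} \<union>
     {((1, i), (2, i)) | i. i < 5} \<union>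
     {((1, i), (2, (i + 1) mod 5)) | i. i < 5} \<union>
     {((2, i), (2, (i + 1) mod 5)) | i. i < 5} \<union>
     {((2, i), (3, 0)) | i. i < 5}"

definition icosahedron_graph :: "(nat \<times> nat) pair_pre_digraph" where
  "icosahedron_graph =
     \<lparr> pverts = {(0, 0), (3, 0)} \<union> {1, 2} \<times> {..<5},
       parcs = icosahedron_edges \<union> icosahedron_edges\<inverse> \<rparr>"

end

theory Submission
  imports Defs "HOL-Computational_Algebra.Polynomial"
begin

text \<open>
  The orthogonal projection onto the \<open>\<theta>\<close>-eigenspace is a polynomial in the adjacency matrix, so
  2-walk-regularity makes the vertices unit vectors in \<open>\<real>\<^sup>3\<close> whose inner products at distances 1
  and 2 are constants \<open>\<omega>\<^sub>1\<close> and \<open>\<omega>\<^sub>2\<close>, with \<open>\<omega>\<^sub>2 \<noteq> 1\<close> unless the graph is complete multipartite.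
  The neighbours of a vertex then lie on a circle, and for each of them at most two others are
  adjacent to it and at most two are not. Excluding multipartite graphs leaves \<open>k = a\<^sub>1 + 3\<close> with
  \<open>a\<^sub>1 \<le> 2\<close>.

  For \<open>a\<^sub>1 = 2\<close> the graph is locally a pentagon, which forces the icosahedron. For \<open>a\<^sub>1 = 1\<close> it is
  locally \<open>2 K\<^sub>2\<close> with \<open>\<theta> = - 2\<close>; the geometry gives \<open>n \<ge> 12\<close>, while the eigenspace of \<open>- 2\<close> has
  dimension at least \<open>n / 3\<close>. For \<open>a\<^sub>1 = 0\<close> the graph is cubic, and if \<open>w, w'\<close> are the other neighbours
  of \<open>y\<close> and \<open>z\<close> is another neighbour of \<open>x\<close>, where \<open>x\<close> and \<open>y\<close> are adjacent, then \<open>w\<close> and \<open>w'\<close> have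
  different inner products with \<open>z\<close>. So \<open>c\<^sub>2 = 2\<close>, which gives the cube, or \<open>c\<^sub>2 = 1\<close> and \<open>a\<^sub>2 \<le> 1\<close>.
  If \<open>a\<^sub>2 = 1\<close> every 2-path lies in exactly one pentagon and the graph is the dodecahedron;
  if \<open>a\<^sub>2 = 0\<close> both \<open>w\<close> and \<open>w'\<close> are at distance 3 from \<open>z\<close>, so the graph is not distance-regular.
\<close>

section \<open>Walks and distances\<close>

locale connected_graph =
  fixes G :: "'v::finite pair_pre_digraph"
  assumes csg: "connected_simple_graph G"
begin

abbreviation N :: "'v \<Rightarrow> 'v set" where "N \<equiv> nbrs G"
abbreviation d :: "'v \<Rightarrow> 'v \<Rightarrow> nat" where "d \<equiv> graph_dist G"
abbreviation W :: "nat \<Rightarrow> 'v \<Rightarrow> 'v \<Rightarrow> nat" where "W l x y \<equiv> card (walks G l x y)"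

lemma pverts_UNIV [simp]: "pverts G = UNIV"
  using csg by (simp add: connected_simple_graph_def)

sublocale pair_graph G
  using csg by (simp add: connected_simple_graph_def)

lemma N_sym: "y \<in> N x \<longleftrightarrow> x \<in> N y"
  by (auto simp: nbrs_def intro: arcs_symmetric)

lemma N_irrefl [simp]: "x \<notin> N x"
  using no_loops' by (auto simp: nbrs_def)

lemma N_neq: "y \<in> N x \<Longrightarrow> y \<noteq> x" "y \<in> N x \<Longrightarrow> x \<noteq> y"
  by auto

lemma walks_0: "walks G 0 x y = (if x = y then {[]} else {})"
  by (auto simp: walks_def awalk_Nil_iff)

lemma walks_Suc: "walks G (Suc l) x y = (\<Union>z\<in>N x. (#) (x, z) ` walks G l z y)"
proof (intro equalityI subsetI)
  fix p assume "p \<in> walks G (Suc l) x y"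
  then obtain e q where "p = e # q" "awalk x (e # q) y" "length q = l"
    by (auto simp: walks_def length_Suc_conv)
  then show "p \<in> (\<Union>z\<in>N x. (#) (x, z) ` walks G l z y)"
    by (cases e) (auto simp: walks_def nbrs_def awalk_Cons_iff)
qed (auto simp: walks_def nbrs_def awalk_Cons_iff)

lemma finite_walks [simp]: "finite (walks G l x y)"
  by (induction l arbitrary: x) (auto simp: walks_0 walks_Suc)

lemma W_0: "W 0 x y = (if x = y then 1 else 0)"
  by (simp add: walks_0)

lemma W_Suc: "W (Suc l) x y = (\<Sum>z\<in>N x. W l z y)"
proof -
  have "W (Suc l) x y = (\<Sum>z\<in>N x. card ((#) (x, z) ` walks G l z y))"
    unfolding walks_Suc by (rule card_UN_disjoint) auto
  then show ?thesis by (simp add: card_image)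
qed

lemma W_Suc_right: "W (Suc l) x y = (\<Sum>z\<in>N y. W l x z)"
proof (induction l arbitrary: x)
  case 0
  have "W (Suc 0) x y = (if y \<in> N x then 1 else 0)"
    by (simp add: W_Suc W_0)
  also have "\<dots> = (\<Sum>z\<in>N y. W 0 x z)"
    using N_sym by (simp add: W_0)
  finally show ?case .
next
  case (Suc l)
  have "W (Suc (Suc l)) x y = (\<Sum>z\<in>N x. \<Sum>w\<in>N y. W l z w)"
    using Suc.IH by (simp add: W_Suc)
  also have "\<dots> = (\<Sum>w\<in>N y. W (Suc l) x w)"
    by (subst sum.swap) (simp add: W_Suc)
  finally show ?case .
qed

lemma W_sym: "W l x y = W l y x"
proof (induction l arbitrary: x)
  case (Suc l) then show ?case by (simp only: W_Suc[of l x] W_Suc_right[of l y])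
qed (auto simp: W_0)

lemma walks_iff_W: "walks G l x y \<noteq> {} \<longleftrightarrow> W l x y > 0"
  by (simp add: card_gt_0_iff)

lemma W_Suc_pos: "W (Suc l) x y > 0 \<longleftrightarrow> (\<exists>z\<in>N y. W l x z > 0)"
  by (simp add: W_Suc_right sum_pos2 zero_less_iff_neq_zero sum_eq_0_iff)

lemma d_LEAST: "d x y = (LEAST l. W l x y > 0)"
  by (simp only: graph_dist_def walks_iff_W)

lemma walk_exists: "\<exists>l. W l x y > 0"
proof -
  have "symmetric (with_proj G)" by (rule pair_sym_arcs)
  moreover have "connected (with_proj G)"
    using csg by (simp add: connected_simple_graph_def)
  ultimately have "strongly_connected (with_proj G)"
    by (rule symmetric_connected_imp_strongly_connected)
  then have "x \<rightarrow>\<^sup>*\<^bsub>with_proj G\<^esub> y" by (auto simp: strongly_connected_def)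
  then obtain p where "awalk x p y" by (auto simp: reachable_awalk)
  then have "p \<in> walks G (length p) x y" by (simp add: walks_def)
  then show ?thesis using walks_iff_W by blast
qed

lemma W_d_pos: "W (d x y) x y > 0"
  unfolding d_LEAST using walk_exists by (rule LeastI_ex)

lemma d_le: "W l x y > 0 \<Longrightarrow> d x y \<le> l"
  unfolding d_LEAST by (rule Least_le)

lemma d_sym: "d x y = d y x"
  unfolding d_LEAST by (subst W_sym) simp

lemma d_0_iff: "d x y = 0 \<longleftrightarrow> x = y"
  using W_d_pos[of x y] d_le[of 0 x y] by (auto simp: W_0 split: if_splits)

lemma d_self [simp]: "d x x = 0"
  by (simp add: d_0_iff)

lemma d_step: "z \<in> N y \<Longrightarrow> d x z \<le> Suc (d x y)"
  using W_d_pos[of x y] W_Suc_pos[of "d x y" x z] N_sym by (intro d_le) blast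

lemma d_pred:
  assumes "d x y = Suc l"
  obtains z where "z \<in> N y" "d x z = l"
proof -
  obtain z where z: "z \<in> N y" "W l x z > 0"
    using W_d_pos[of x y] assms W_Suc_pos by auto
  moreover have "d x z \<le> l" using z(2) by (rule d_le)
  moreover have "Suc l \<le> Suc (d x z)" using d_step[of y z x] z(1) N_sym assms by auto
  ultimately show thesis using that[of z] by simp
qed

lemma d_1_iff: "d x y = 1 \<longleftrightarrow> y \<in> N x"
proof
  assume "d x y = 1"
  then obtain z where "z \<in> N y" "d x z = 0" using d_pred[of x y 0] by auto
  then show "y \<in> N x" using N_sym d_0_iff by auto
next
  assume "y \<in> N x"
  then have "d x y \<le> 1" "d x y \<noteq> 0" using d_step[of y x x] by (auto simp: d_0_iff)
  then show "d x y = 1" by linarith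
qed

lemma d_1: "y \<in> N x \<Longrightarrow> d x y = 1"
  using d_1_iff by simp

lemma d_2_iff: "d x y = 2 \<longleftrightarrow> x \<noteq> y \<and> y \<notin> N x \<and> N x \<inter> N y \<noteq> {}"
proof
  assume *: "d x y = 2"
  then obtain z where "z \<in> N y" "d x z = 1"
    using d_pred[of x y 1] by (auto simp: numeral_2_eq_2)
  with * show "x \<noteq> y \<and> y \<notin> N x \<and> N x \<inter> N y \<noteq> {}"
    using d_1_iff[of x z] d_1_iff[of x y] d_0_iff[of x y] by auto
next
  assume *: "x \<noteq> y \<and> y \<notin> N x \<and> N x \<inter> N y \<noteq> {}"
  then obtain z where "z \<in> N x" "z \<in> N y" by auto
  then have "d x y \<le> 2" using d_step[of y z x] d_1_iff[of x z] N_sym by auto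
  moreover have "d x y \<noteq> 0" "d x y \<noteq> 1" using * d_1_iff d_0_iff by auto
  ultimately show "d x y = 2" by simp
qed

text \<open>Connectedness as an induction rule: a property that passes along edges reaches every
  vertex. It takes the place of explicit paths.\<close>

lemma connected_induct [case_names base step]:
  assumes "P x" and "\<And>y z. P y \<Longrightarrow> z \<in> N y \<Longrightarrow> P z"
  shows "P y"
proof -
  have "W l x y > 0 \<Longrightarrow> P y" for l y
    by (induction l arbitrary: y)
      (use assms N_sym in \<open>auto simp: W_0 W_Suc_pos split: if_splits\<close>)
  then show ?thesis using walk_exists by blast
qed

lemma d_le_diameter: "d x y \<le> graph_diameter G"
proof -
  have "{d x y |x y. x \<in> pverts G \<and> y \<in> pverts G} = (\<lambda>(x, y). d x y) ` UNIV"
    by auto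
  then show ?thesis unfolding graph_diameter_def by (intro Max_ge) auto
qed

text \<open>Stepping back along a shortest path from a pair at distance at least 2 passes through
  distance exactly 2.\<close>

lemma ex_d_2:
  assumes "graph_diameter G \<ge> 2"
  obtains x y where "d x y = 2"
proof -
  have eq: "{d x y |x y. x \<in> pverts G \<and> y \<in> pverts G} = (\<lambda>(x, y). d x y) ` UNIV"
    by auto
  have "graph_diameter G \<in> (\<lambda>(x, y). d x y) ` UNIV"
    unfolding graph_diameter_def eq by (rule Max_in) auto
  then obtain x y where "d x y \<ge> 2" using assms by auto
  then show thesis
  proof (induction "d x y" arbitrary: y)
    case (Suc l)
    show ?case
    proof (cases "d x y = 2")
      case False
      obtain z where "z \<in> N y" "d x z = l" using d_pred[of x y l] Suc.hyps by auto
      with Suc False show ?thesis by auto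
    qed (rule that)
  qed simp
qed

text \<open>A level that rises by at most one along each edge bounds the distance from below;
  descending level by level bounds it from above. This serves to read off distances from a labelled
  model.\<close>

lemma d_eq_levelI:
  assumes "\<And>y. L y = 0 \<longleftrightarrow> y = x"
    and "\<And>y z. z \<in> N y \<Longrightarrow> L z \<le> Suc (L y)"
    and "\<And>y. L y > 0 \<Longrightarrow> \<exists>z\<in>N y. Suc (L z) = L y"
  shows "d x y = L y"
proof (rule antisym)
  have "W l x y > 0 \<Longrightarrow> L y \<le> l" for l y
  proof (induction l arbitrary: y)
    case (Suc l)
    then obtain z where "z \<in> N y" "W l x z > 0" using W_Suc_pos by blast
    with Suc.IH[of z] show ?case using assms(2)[of y z] N_sym by force
  qed (auto simp: W_0 assms(1) split: if_splits)
  then show "L y \<le> d x y" using W_d_pos by blast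
  show "d x y \<le> L y"
  proof (induction "L y" arbitrary: y)
    case 0 then show ?case using assms(1) d_0_iff by auto
  next
    case (Suc l)
    then obtain z where "z \<in> N y" "Suc (L z) = L y" using assms(3)[of y] by auto
    with Suc have "d x z \<le> l" by (metis Suc_inject)
    moreover have "d x y \<le> Suc (d x z)" using \<open>z \<in> N y\<close> N_sym by (intro d_step) blast
    ultimately show ?case using Suc by simp
  qed
qed

end

section \<open>The eigenprojection as a polynomial in the adjacency operator\<close>

text \<open>Written through iterates of \<open>T\<close> because those of the adjacency operator,
  applied to \<open>axis y 1\<close>, have walk counts as coordinates.\<close>

definition poly_op :: "('a \<Rightarrow> 'a) \<Rightarrow> real poly \<Rightarrow> 'a \<Rightarrow> 'a::real_vector" where
  "poly_op T p v = (\<Sum>i\<le>degree p. coeff p i *\<^sub>R (T ^^ i) v)"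

lemma poly_op_eq: "degree p \<le> n \<Longrightarrow> poly_op T p v = (\<Sum>i\<le>n. coeff p i *\<^sub>R (T ^^ i) v)"
  unfolding poly_op_def by (rule sum.mono_neutral_left) (auto simp: coeff_eq_0)

lemma poly_op_0 [simp]: "poly_op T 0 v = 0"
  by (simp add: poly_op_def)

lemma poly_op_add: "poly_op T (p + q) v = poly_op T p v + poly_op T q v"
  by (simp add: poly_op_eq[of _ "max (degree p) (degree q)"] degree_add_le scaleR_add_left sum.distrib)

lemma poly_op_smult: "poly_op T (smult c p) v = c *\<^sub>R poly_op T p v"
  by (simp add: poly_op_eq[of _ "degree p"] degree_smult_le scaleR_sum_right)

lemma poly_op_pCons:
  assumes "linear T"
  shows "poly_op T (pCons a p) v = a *\<^sub>R v + T (poly_op T p v)"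
proof -
  have "degree (pCons a p) \<le> Suc (degree p)" by (simp add: degree_pCons_le)
  then have "poly_op T (pCons a p) v = (\<Sum>i\<le>Suc (degree p). coeff (pCons a p) i *\<^sub>R (T ^^ i) v)"
    by (rule poly_op_eq)
  also have "\<dots> = a *\<^sub>R v + (\<Sum>i\<le>degree p. coeff p i *\<^sub>R T ((T ^^ i) v))"
    by (subst sum.atMost_Suc_shift) simp
  finally show ?thesis
    using assms by (simp add: poly_op_def linear_sum linear_scale)
qed

lemma linear_funpow:
  fixes T :: "'a::real_vector \<Rightarrow> 'a"
  assumes "linear T" shows "linear (T ^^ i)"
proof (induction i)
  case 0 show ?case by (rule linearI) auto
next
  case (Suc i) then show ?case unfolding funpow.simps by (rule linear_compose) (rule assms)
qed

lemma linear_poly_op: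
  assumes "linear T" shows "linear (poly_op T p)"
  unfolding poly_op_def
  by (intro linear_compose_sum ballI linear_compose_scale_right) (rule linear_funpow[OF assms])

lemma poly_op_commute:
  assumes "linear T" shows "T (poly_op T p v) = poly_op T p (T v)"
  using assms by (simp add: poly_op_def linear_sum linear_scale funpow_swap1)

lemma poly_op_linear_factor:
  assumes "linear T"
  shows "poly_op T ([:- \<theta>, 1:] * q) v = T (poly_op T q v) - \<theta> *\<^sub>R poly_op T q v"
proof -
  have "[:- \<theta>, 1:] * q = smult (- \<theta>) q + pCons 0 q" by simp
  then show ?thesis using assms by (simp only: poly_op_add poly_op_smult poly_op_pCons) simp
qed

lemma poly_op_eigenvector:
  assumes "linear T" "T v = \<theta> *\<^sub>R v"
  shows "poly_op T p v = poly p \<theta> *\<^sub>R v"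
  by (induction p)
    (auto simp: poly_op_pCons assms linear_scale algebra_simps)

text \<open>The powers of \<open>T\<close> lie in a space of matrices of finite dimension
  \<open>D\<close>, so \<open>D + 1\<close> of them satisfy a linear relation.\<close>

lemma annihilating_polynomial:
  fixes T :: "real ^ 'n \<Rightarrow> real ^ 'n"
  assumes "linear T"
  obtains p where "p \<noteq> 0" "\<And>v. poly_op T p v = 0"
proof -
  define M where "M i = matrix (T ^^ i)" for i
  have M: "M i *v v = (T ^^ i) v" for i v
    unfolding M_def
    using linear_funpow[OF assms, of i] linear_matrix_vector_mul_eq matrix_works by blast
  define D where "D = DIM(real ^ 'n ^ 'n)"
  show thesis
  \<comment> \<open>Linear dependence is a notion for sets and cannot see a repeated power, so a
    repetition is treated separately.\<close>
  proof (cases "inj_on M {..D}")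
    case False
    then obtain i j where ij: "i \<noteq> j" "M i = M j" by (auto simp: inj_on_def)
    define p :: "real poly" where "p = monom 1 i + smult (- 1) (monom 1 j)"
    have mon: "poly_op T (monom 1 k) v = (T ^^ k) v" for k v
      by (simp add: poly_op_eq[of _ k] degree_monom_le if_distrib[of "\<lambda>c. c *\<^sub>R _"] coeff_monom
          cong: if_cong)
    have "coeff p i = 1" using ij by (simp add: p_def coeff_monom)
    moreover have "poly_op T p v = 0" for v
      using ij(2) M[of i v] M[of j v] by (simp only: p_def poly_op_add poly_op_smult mon) simp
    ultimately show thesis using that[of p] by fastforce
  next
    case True
    then have "card (M ` {..D}) > DIM(real ^ 'n ^ 'n)" by (simp add: card_image D_def)
    then have "dependent (M ` {..D})" by (intro dependent_biggerset) auto
    then obtain u where u: "(\<Sum>m\<in>M ` {..D}. u m *\<^sub>R m) = 0" "\<exists>m\<in>M ` {..D}. u m \<noteq> 0"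
      by (auto simp: dependent_finite)
    define p where "p = (\<Sum>i\<le>D. monom (u (M i)) i)"
    have coeff_p: "coeff p i = (if i \<le> D then u (M i) else 0)" for i
      by (simp add: p_def coeff_sum coeff_monom)
    have deg: "degree p \<le> D" by (rule degree_le) (simp add: coeff_p)
    obtain i where "i \<le> D" "u (M i) \<noteq> 0" using u(2) by auto
    then have "coeff p i \<noteq> 0" by (simp add: coeff_p)
    then have "p \<noteq> 0" by auto
    moreover have "poly_op T p v = 0" for v
    proof -
      have sum: "(\<Sum>i\<in>S. f i) *v v = (\<Sum>i\<in>S. f i *v v)" for S and f :: "nat \<Rightarrow> real ^ 'n ^ 'n"
        by (induction S rule: infinite_finite_induct) (simp_all add: matrix_vector_mult_add_rdistrib)
      have "poly_op T p v = (\<Sum>i\<le>D. u (M i) *\<^sub>R M i) *v v"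
        by (simp add: poly_op_eq[OF deg] coeff_p M sum scaleR_matrix_vector_assoc[symmetric])
      also have "(\<Sum>i\<le>D. u (M i) *\<^sub>R M i) = 0"
        using u(1) True by (simp add: sum.reindex)
      finally show ?thesis by simp
    qed
    ultimately show thesis by (rule that)
  qed
qed

text \<open>The projection is \<open>q(T) / q(\<theta>)\<close>, where \<open>(X - \<theta>)\<^sup>m q\<close> with \<open>q(\<theta>) \<noteq> 0\<close> annihilates \<open>T\<close>;
  as \<open>T\<close> is self-adjoint, already \<open>(X - \<theta>) q\<close> annihilates it.\<close>

lemma polynomial_eigenprojection:
  fixes T :: "real ^ 'n \<Rightarrow> real ^ 'n"
  assumes "linear T" and self: "\<And>v w. T v \<bullet> w = v \<bullet> T w"
  obtains p where "\<And>v. T (poly_op T p v) = \<theta> *\<^sub>R poly_op T p v"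
    and "\<And>v. T v = \<theta> *\<^sub>R v \<Longrightarrow> poly_op T p v = v"
proof -
  obtain p where p: "p \<noteq> 0" "\<And>v. poly_op T p v = 0"
    using annihilating_polynomial[OF \<open>linear T\<close>] by blast
  then obtain q where q: "p = [:- \<theta>, 1:] ^ order \<theta> p * q" "\<not> [:- \<theta>, 1:] dvd q"
    using order_decomp by blast
  have *: "poly_op T ([:- \<theta>, 1:] * q) v = 0"
    if "\<And>v. poly_op T ([:- \<theta>, 1:] ^ m * q) v = 0" for m v
    using that
  proof (induction m)
    case 0
    then show ?case using \<open>linear T\<close> by (simp only: poly_op_linear_factor) (simp add: linear_0)
  next
    case (Suc m)
    show ?case
    proof (cases m)
      case 0 with Suc.prems show ?thesis by simp
    next
      case (Suc l)
      have "poly_op T ([:- \<theta>, 1:] ^ m * q) v = 0" for v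
      proof -
        let ?S = "\<lambda>v. T v - \<theta> *\<^sub>R v"
        define w where "w = poly_op T ([:- \<theta>, 1:] ^ l * q) v"
        have m: "poly_op T ([:- \<theta>, 1:] ^ m * q) v = ?S w"
          using \<open>linear T\<close> unfolding Suc w_def power_Suc mult.assoc
          by (rule poly_op_linear_factor)
        have "?S (?S w) = 0"
          using Suc.prems[of v] poly_op_linear_factor[OF \<open>linear T\<close>, of \<theta> "[:- \<theta>, 1:] ^ m * q" v]
          unfolding power_Suc mult.assoc m by simp
        then have "0 = w \<bullet> ?S (?S w)" by simp
        also have "\<dots> = ?S w \<bullet> ?S w"
          by (simp add: inner_diff_left inner_diff_right self[symmetric] linear_diff[OF \<open>linear T\<close>]
              linear_scale[OF \<open>linear T\<close>])
        finally show ?thesis unfolding m by simp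
      qed
      then show ?thesis by (rule Suc.IH)
    qed
  qed
  have ker: "T (poly_op T q v) = \<theta> *\<^sub>R poly_op T q v" for v
    using *[of "order \<theta> p" v] p(2) unfolding q(1)[symmetric] poly_op_linear_factor[OF \<open>linear T\<close>]
    by simp
  have "poly q \<theta> \<noteq> 0" using q(2) by (simp add: poly_eq_0_iff_dvd)
  then have "poly_op T (smult (1 / poly q \<theta>) q) v = v" if "T v = \<theta> *\<^sub>R v" for v
    using poly_op_eigenvector[OF \<open>linear T\<close> that, of q] by (simp add: poly_op_smult)
  then show thesis
    by (intro that[of "smult (1 / poly q \<theta>) q"])
      (simp_all add: poly_op_smult linear_scale[OF \<open>linear T\<close>] ker)
qed

lemma poly_op_self_adjoint:
  fixes T :: "real ^ 'n \<Rightarrow> real ^ 'n"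
  assumes "\<And>v w. T v \<bullet> w = v \<bullet> T w"
  shows "poly_op T p v \<bullet> w = v \<bullet> poly_op T p w"
proof -
  have "(T ^^ i) v \<bullet> w = v \<bullet> (T ^^ i) w" for i
    proof (induction i arbitrary: w)
    case (Suc i)
    have "(T ^^ Suc i) v \<bullet> w = v \<bullet> (T ^^ i) (T w)" by (simp add: assms Suc)
    then show ?case by (simp add: funpow_swap1)
  qed simp
  then show ?thesis by (simp add: poly_op_def inner_sum_left inner_sum_right)
qed

section \<open>The representation in three-dimensional space\<close>

context connected_graph begin

definition "adj_op v = adjacency_matrix G *v v"

lemma linear_adj_op: "linear adj_op"
  unfolding adj_op_def by (rule matrix_vector_mul_linear)

lemma adj_op_nth: "adj_op v $ x = (\<Sum>y\<in>N x. v $ y)"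
proof -
  have "adj_op v $ x = (\<Sum>y\<in>UNIV. if y \<in> N x then v $ y else 0)"
    by (auto simp: adj_op_def matrix_vector_mult_def adjacency_matrix_def nbrs_def intro!: sum.cong)
  then show ?thesis by (simp add: sum.If_cases)
qed

lemma adj_op_self_adjoint: "adj_op v \<bullet> w = v \<bullet> adj_op w"
proof -
  have "transpose (adjacency_matrix G) = adjacency_matrix G"
    by (auto simp: transpose_def adjacency_matrix_def vec_eq_iff intro: arcs_symmetric)
  then have "v v* adjacency_matrix G = adj_op v"
    unfolding adj_op_def by (metis vector_transpose_matrix)
  then show ?thesis by (metis dot_lmul_matrix adj_op_def)
qed

lemma adj_op_funpow_axis: "(adj_op ^^ l) (axis y 1) $ x = real (W l x y)"
proof (induction l arbitrary: x)
  case 0 then show ?case by (auto simp: W_0 axis_def)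
next
  case (Suc l) then show ?case by (simp add: adj_op_nth W_Suc)
qed

lemma adj_op_axis: "adj_op (axis x 1) = (\<Sum>y\<in>N x. axis y 1)"
proof -
  have "adj_op (axis x 1) $ z = (\<Sum>y\<in>N x. axis y (1::real)) $ z" for z
    using N_sym[of x z] by (simp add: adj_op_nth axis_def)
  then show ?thesis by (simp add: vec_eq_iff)
qed

text \<open>\<open>u x\<close> is the projection of the basis vector at \<open>x\<close> onto the
  eigenspace, scaled to unit length and moved isometrically into \<open>real ^ 3\<close>. The
  projection is a polynomial in the adjacency operator: it commutes with it, which gives the sum
  over the neighbours, and its entries, which are the inner products, are combinations of walk
  counts.\<close>

lemma representation:
  assumes mult: "eigenvalue_multiplicity G \<theta> = 3"
    and walk_regular: "\<And>l x y. W l x x = W l y y"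
  obtains u :: "'v \<Rightarrow> real ^ 3"
  where "\<And>x. u x \<bullet> u x = 1" and "\<And>x. (\<Sum>y\<in>N x. u y) = \<theta> *\<^sub>R u x"
    and "\<And>x y x' y'. (\<And>l. W l x y = W l x' y') \<Longrightarrow> u x \<bullet> u y = u x' \<bullet> u y'"
proof -
  define V where "V = {v. adj_op v = \<theta> *\<^sub>R v}"
  have subV: "subspace V"
    unfolding V_def subspace_def using linear_adj_op
    by (auto simp: linear_0 linear_add linear_scale algebra_simps)
  have dimV: "dim V = 3" using mult by (simp add: eigenvalue_multiplicity_def V_def adj_op_def)
  obtain p where p: "\<And>v. adj_op (poly_op adj_op p v) = \<theta> *\<^sub>R poly_op adj_op p v"
    "\<And>v. adj_op v = \<theta> *\<^sub>R v \<Longrightarrow> poly_op adj_op p v = v"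
    using polynomial_eigenprojection[OF linear_adj_op adj_op_self_adjoint, where \<theta> = \<theta>] by blast
  define E where "E = poly_op adj_op p"
  define e where "e x = E (axis x 1)" for x
  have linE: "linear E" unfolding E_def by (rule linear_poly_op[OF linear_adj_op])
  have eV: "e x \<in> V" for x using p(1) by (simp add: V_def e_def E_def)
  have inner_e: "e x \<bullet> e y = (\<Sum>i\<le>degree p. coeff p i * real (W i x y))" for x y
  proof -
    have "e x \<bullet> e y = axis x 1 \<bullet> E (E (axis y 1))"
      unfolding e_def E_def by (rule poly_op_self_adjoint[OF adj_op_self_adjoint])
    also have "E (E (axis y 1)) = E (axis y 1)"
      using p by (simp add: E_def)
    also have "axis x 1 \<bullet> E (axis y 1) = E (axis y 1) $ x"
      by (simp add: inner_axis')
    also have "\<dots> = (\<Sum>i\<le>degree p. coeff p i * real (W i x y))"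
      by (simp add: E_def poly_op_def adj_op_funpow_axis)
    finally show ?thesis .
  qed
  have sum_e: "(\<Sum>y\<in>N x. e y) = \<theta> *\<^sub>R e x" for x
  proof -
    have "(\<Sum>y\<in>N x. e y) = E (adj_op (axis x 1))"
      by (simp add: e_def adj_op_axis linear_sum[OF linE])
    also have "\<dots> = adj_op (e x)"
      unfolding e_def E_def by (rule poly_op_commute[OF linear_adj_op, symmetric])
    finally show ?thesis using eV by (simp add: V_def)
  qed
  \<comment> \<open>If every basis vector projected to 0, the whole eigenspace would be 0, against
    its dimension 3.\<close>
  have "\<exists>x. e x \<noteq> 0"
  proof (rule ccontr)
    assume "\<not> ?thesis"
    have "v = 0" if "v \<in> V" for v
    proof -
      have "v = E v" using that p(2) by (simp add: V_def E_def)
      also have "\<dots> = E (\<Sum>x\<in>UNIV. v $ x *\<^sub>R axis x 1)"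
        using basis_expansion[of v] by (simp add: scalar_mult_eq_scaleR)
      also have "\<dots> = 0"
        using \<open>\<not> _\<close> by (simp add: linear_sum[OF linE] linear_scale[OF linE] e_def)
      finally show ?thesis .
    qed
    then have "V \<subseteq> {0}" by auto
    then show False using dimV by (metis dim_eq_0 zero_neq_numeral)
  qed
  then obtain x0 where x0: "e x0 \<noteq> 0" by auto
  define r where "r = norm (e x0)"
  have r: "r > 0" using x0 by (simp add: r_def)
  \<comment> \<open>Equal numbers of closed walks give all projections the same length, so one
    scaling factor serves every vertex.\<close>
  have e_self: "e x \<bullet> e x = r\<^sup>2" for x
    unfolding r_def power2_norm_eq_inner inner_e using walk_regular by (metis (no_types))
  obtain f :: "real ^ 'v \<Rightarrow> real ^ 3"
    where f: "linear f" "\<And>v. v \<in> V \<Longrightarrow> norm (f v) = norm v"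
    using isometry_subset_subspace[OF subV subspace_UNIV[where 'a = "real ^ 3"]] dimV by auto
  have inner_f: "f v \<bullet> f w = v \<bullet> w" if "v \<in> V" "w \<in> V" for v w
    using f(2)[OF subspace_add[OF subV that]] f(2)[OF that(1)] f(2)[OF that(2)]
    by (simp add: dot_norm linear_add[OF f(1)])
  define u where "u x = (1 / r) *\<^sub>R f (e x)" for x
  have inner_u: "u x \<bullet> u y = (e x \<bullet> e y) / r\<^sup>2" for x y
    by (simp add: u_def inner_f eV power2_eq_square)
  show thesis
  proof
    show "u x \<bullet> u x = 1" for x using r by (simp add: inner_u e_self)
    show "(\<Sum>y\<in>N x. u y) = \<theta> *\<^sub>R u x" for x
    proof -
      have "(\<Sum>y\<in>N x. u y) = (1 / r) *\<^sub>R f (\<Sum>y\<in>N x. e y)"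
        by (simp add: u_def linear_sum[OF f(1)] scaleR_sum_right)
      then show ?thesis by (simp add: sum_e u_def linear_scale[OF f(1)])
    qed
    show "u x \<bullet> u y = u x' \<bullet> u y'" if "\<And>l. W l x y = W l x' y'" for x y x' y'
      using that by (simp add: inner_u inner_e)
  qed
qed

end

section \<open>Vectors in three dimensions\<close>

text \<open>Let n be the cross product of \<open>a\<close> and \<open>b\<close>. Lagrange's identity
  first makes the cross product of \<open>p\<close> and n vanish, and then gives (n . n) p = (n . p)
  n.\<close>

lemma orthogonal_to_two_imp_cross3_multiple:
  fixes a b p :: "real ^ 3"
  assumes "cross3 a b \<noteq> 0" "p \<bullet> a = 0" "p \<bullet> b = 0"
  obtains s where "p = s *\<^sub>R cross3 a b"
proof -
  let ?n = "cross3 a b"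
  have "cross3 p ?n = 0" using assms(2,3) by (simp add: Lagrange)
  then have "(?n \<bullet> ?n) *\<^sub>R p = (?n \<bullet> p) *\<^sub>R ?n"
    using Lagrange[of ?n p ?n] by (simp add: inner_commute)
  then have "(1 / (?n \<bullet> ?n)) *\<^sub>R (?n \<bullet> ?n) *\<^sub>R p = ((?n \<bullet> p) / (?n \<bullet> ?n)) *\<^sub>R ?n"
    by simp
  then have "p = ((?n \<bullet> p) / (?n \<bullet> ?n)) *\<^sub>R ?n" using assms(1) by simp
  then show thesis by (rule that)
qed

lemma cross3_nonzero_unit:
  assumes "a \<bullet> a = 1" "b \<bullet> b = 1" "(a \<bullet> b)\<^sup>2 \<noteq> 1"
  shows "cross3 a b \<noteq> 0"
proof
  assume "cross3 a b = 0"
  then show False using norm_cross[of a b] assms by (simp add: power2_norm_eq_inner)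
qed

lemma cross3_nonzero_orthogonal:
  assumes "a \<noteq> 0" "b \<noteq> 0" "a \<bullet> b = 0"
  shows "cross3 a b \<noteq> 0"
  using assms norm_and_cross_eq_0 by blast

lemma unit_vectors_eqI:
  fixes a b :: "'a::real_inner"
  assumes "a \<bullet> a = 1" "b \<bullet> b = 1" "a \<bullet> b = 1"
  shows "a = b"
  using assms vector_eq[of a b] by simp

text \<open>The constraints cut out a line, which meets the unit sphere in at most two points.\<close>

lemma card_sphere_line_le_2:
  fixes a b :: "real ^ 3"
  assumes "cross3 a b \<noteq> 0"
    and S: "\<And>v. v \<in> S \<Longrightarrow> v \<bullet> v = 1 \<and> v \<bullet> a = \<alpha> \<and> v \<bullet> b = \<beta>"
  shows "card S \<le> 2"
proof (rule ccontr)
  let ?n = "cross3 a b"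
  assume "\<not> card S \<le> 2"
  then obtain T where "T \<subseteq> S" "card T = 3" using obtain_subset_with_card_n[of 3 S] by auto
  then obtain x y z where xyz: "x \<in> S" "y \<in> S" "z \<in> S" "x \<noteq> y" "y \<noteq> z" "x \<noteq> z"
    by (auto simp: card_3_iff)
  have ex: "\<exists>s. w = x + s *\<^sub>R ?n" if "w \<in> S" for w
  proof -
    have "(w - x) \<bullet> a = 0" "(w - x) \<bullet> b = 0"
      using S[OF that] S[OF xyz(1)] by (auto simp: inner_diff_left)
    then obtain s where "w - x = s *\<^sub>R ?n"
      using orthogonal_to_two_imp_cross3_multiple[OF assms(1)] by blast
    then show ?thesis by (auto simp: algebra_simps)
  qed
  \<comment> \<open>The unit length condition is a quadratic equation in \<open>s\<close> with root
    0, so only one further value is left.\<close>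
  have root: "s * (?n \<bullet> ?n) = - 2 * (x \<bullet> ?n)" if "x + s *\<^sub>R ?n \<in> S" "s \<noteq> 0" for s
  proof -
    have "(x + s *\<^sub>R ?n) \<bullet> (x + s *\<^sub>R ?n) = 1" using S that by blast
    then have "s * (s * (?n \<bullet> ?n) + 2 * (x \<bullet> ?n)) = 0"
      using S[OF xyz(1)] by (simp add: inner_add_left inner_add_right inner_commute algebra_simps)
    then show ?thesis using that by simp
  qed
  obtain s t where st: "y = x + s *\<^sub>R ?n" "z = x + t *\<^sub>R ?n" using ex xyz by metis
  with xyz have "s \<noteq> 0" "t \<noteq> 0" "s \<noteq> t" by auto
  with root[of s] root[of t] st xyz have "s * (?n \<bullet> ?n) = t * (?n \<bullet> ?n)" by simp
  with \<open>s \<noteq> t\<close> assms(1) show False by simp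
qed

text \<open>The vectors orthogonal to \<open>a\<close> and \<open>b\<close> form a line, and a line
  holds no two nonzero orthogonal vectors.\<close>

lemma orthogonal_in_line:
  fixes a b p q :: "real ^ 3"
  assumes "cross3 a b \<noteq> 0" "p \<bullet> a = 0" "p \<bullet> b = 0" "q \<bullet> a = 0" "q \<bullet> b = 0" "p \<bullet> q = 0"
  shows "p = 0 \<or> q = 0"
proof -
  obtain s t where "p = s *\<^sub>R cross3 a b" "q = t *\<^sub>R cross3 a b"
    using orthogonal_to_two_imp_cross3_multiple[OF assms(1)] assms(2-5) by metis
  with assms(1,6) show ?thesis by auto
qed

section \<open>Complete multipartite graphs\<close>

context connected_graph begin

text \<open>Non-adjacency is reflexive and symmetric here; once it is transitive, its classes are
  the parts.\<close>

lemma complete_multipartiteI: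
  assumes "\<And>x y z. y \<notin> N x \<Longrightarrow> z \<notin> N y \<Longrightarrow> z \<notin> N x"
  shows "complete_multipartite G"
proof -
  let ?R = "{(x, y). y \<notin> N x}"
  have equiv: "equiv UNIV ?R"
    using assms N_sym by (auto intro!: equivI simp: refl_on_def sym_def trans_def)
  have "partition_on (pverts G) (UNIV // ?R)"
    using partition_on_quotient[OF equiv] by simp
  moreover have "(x, y) \<in> parcs G \<longleftrightarrow> \<not> (\<exists>B\<in>UNIV // ?R. x \<in> B \<and> y \<in> B)" for x y
  proof -
    have "(\<exists>B\<in>UNIV // ?R. x \<in> B \<and> y \<in> B) \<longleftrightarrow> (x, y) \<in> ?R"
    proof
      assume "\<exists>B\<in>UNIV // ?R. x \<in> B \<and> y \<in> B"
      then show "(x, y) \<in> ?R" using quotient_eqI quotient_eq_iff[OF equiv] by fast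
    next
      assume "(x, y) \<in> ?R"
      then have "x \<in> ?R `` {x}" "y \<in> ?R `` {x}" by auto
      moreover have "?R `` {x} \<in> UNIV // ?R" by (rule quotientI) simp
      ultimately show "\<exists>B\<in>UNIV // ?R. x \<in> B \<and> y \<in> B"
        by (intro bexI[of _ "?R `` {x}"] conjI)
    qed
    then show ?thesis by (simp add: nbrs_def)
  qed
  ultimately show ?thesis
    unfolding complete_multipartite_def by (intro exI[of _ "UNIV // ?R"] conjI ballI)
qed

text \<open>Along a path from \<open>x\<close> every vertex is a neighbour or a twin of
  \<open>x\<close>: a step from a neighbour ends in \<open>x\<close>, in \<open>N x\<close> or at
  distance 2, and a step from a twin ends in \<open>N x\<close>. So non-adjacent vertices are
  twins.\<close>

lemma complete_multipartite_if_twins: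
  assumes "\<And>x y. d x y = 2 \<Longrightarrow> N x = N y"
  shows "complete_multipartite G"
proof (rule complete_multipartiteI)
  have twins: "N y = N x" if "y \<notin> N x" for x y
  proof -
    have "y \<in> N x \<or> N y = N x"
    proof (induction y rule: connected_induct[where x = x])
      case (step y z)
      show ?case
      proof (cases "y \<in> N x")
        case True
        show ?thesis
        proof (cases "d x z = 2")
          case False
          then show ?thesis using True step(2) N_sym d_2_iff[of x z] by auto
        qed (use assms in auto)
      qed (use step in auto)
    qed auto
    then show ?thesis using that by simp
  qed
  show "z \<notin> N x" if "y \<notin> N x" "z \<notin> N y" for x y z
    using twins[OF that(1)] that(2) by simp
qed

text \<open>If non-adjacency is transitive in every local graph, then an induced path on four vertices is
  impossible once every edge lies in a triangle; so the diameter is at most 2.\<close>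

lemma complete_multipartite_if_locally:
  assumes tri: "\<And>x y. y \<in> N x \<Longrightarrow> \<exists>z\<in>N x. z \<in> N y"
    and loc: "\<And>p x y z. x \<in> N p \<Longrightarrow> y \<in> N p \<Longrightarrow> z \<in> N p \<Longrightarrow> y \<notin> N x \<Longrightarrow> z \<notin> N y \<Longrightarrow> z \<notin> N x"
  shows "complete_multipartite G"
proof (rule complete_multipartiteI)
  have common: "\<exists>p\<in>N x. p \<in> N y" if "y \<notin> N x" "y \<noteq> x" for x y
  proof -
    have "y = x \<or> y \<in> N x \<or> (\<exists>p\<in>N x. p \<in> N y)"
    proof (induction y rule: connected_induct[where x = x])
      case (step y z)
      then consider "y = x" | "y \<in> N x" | p where "y \<notin> N x" "p \<in> N x" "p \<in> N y" by blast
      then show ?case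
      proof cases
        case 1 then show ?thesis using step by blast
      next
        case 2 then show ?thesis using step N_sym by blast
      next
        case 3
        show ?thesis
        proof (cases "z \<in> N x \<or> z \<in> N p")
          case True
          then show ?thesis using 3 N_sym by blast
        next
          case False
          \<comment> \<open>\<open>t\<close> completes the middle edge of the path \<open>x\<close>,
            \<open>p\<close>, \<open>y\<close>, \<open>z\<close> to a triangle. It is adjacent to
            \<open>z\<close> by the condition around \<open>y\<close> and to \<open>x\<close> by the
            condition around \<open>p\<close>.\<close>
          obtain t where t: "t \<in> N y" "t \<in> N p" using tri[of p y] 3 by blast
          have "t \<in> N z" using loc[of p y z t] t step(2) False 3 by blast
          moreover have "x \<in> N p" "y \<in> N p" "x \<notin> N y" using 3 N_sym by auto
          then have "t \<in> N x" using loc[of y p x t] t by blast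
          ultimately show ?thesis by blast
        qed
      qed
    qed auto
    then show ?thesis using that by blast
  qed
  show "z \<notin> N x" if xy: "y \<notin> N x" and yz: "z \<notin> N y" for x y z
  proof
    assume xz: "z \<in> N x"
    have sym: "v \<in> N w" if "w \<in> N v" for v w using that N_sym by blast
    from xy yz xz have "y \<noteq> x" using sym by auto
    then obtain p where p: "p \<in> N x" "p \<in> N y" using common[OF xy] by blast
    \<comment> \<open>A common neighbour \<open>q\<close> puts all three vertices into one
      neighbourhood, where \<open>y\<close> is non-adjacent to both ends of the edge between
      \<open>x\<close> and \<open>z\<close>; the local condition forbids this.\<close>
    obtain q where q: "q \<in> N x" "q \<in> N y" "q \<in> N z"
    proof (cases "z \<in> N p")
      case True
      then show thesis
        using loc[of x p y z] xy yz xz sym[OF p(1)] sym[OF p(2)] by simp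
    next
      case False
      obtain q where q: "q \<in> N x" "q \<in> N p" using tri[of p x] p(1) by blast
      have "q \<in> N z" using loc[of p x z q] p q xz False by blast
      moreover have "q \<in> N y"
        using loc[of x p y q] sym[OF p(1)] sym[OF p(2)] q xy by blast
      ultimately show thesis using q that by blast
    qed
    show False using loc[of x q y z] xy yz xz sym[OF q(1)] sym[OF q(2)] sym[OF q(3)] by simp
  qed
qed

end

section \<open>The spherical representation\<close>

text \<open>The four vectors belong to two disjoint edges in the neighbourhood of \<open>a\<close>.
  Both \<open>b + b' - (2 * \<omega>) *\<^sub>R a\<close> and \<open>c - c'\<close> are orthogonal
  to \<open>a\<close>, to \<open>b - b'\<close> and to each other, so the first is 0. Pairing it
  with \<open>b\<close> gives \<open>1 + \<omega> = 2 * \<omega> * \<omega>\<close>.\<close>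

lemma opposite_pairs_on_sphere:
  fixes a b b' c c' :: "real ^ 3"
  assumes unit: "a \<bullet> a = 1" "b \<bullet> b = 1" "b' \<bullet> b' = 1" "c \<bullet> c = 1" "c' \<bullet> c' = 1"
    and \<omega>: "a \<bullet> b = \<omega>" "a \<bullet> b' = \<omega>" "a \<bullet> c = \<omega>" "a \<bullet> c' = \<omega>" "b \<bullet> b' = \<omega>" "c \<bullet> c' = \<omega>"
    and \<mu>: "b \<bullet> c = \<mu>" "b \<bullet> c' = \<mu>" "b' \<bullet> c = \<mu>" "b' \<bullet> c' = \<mu>"
    and "\<omega> \<noteq> 1" and sum: "b + b' + c + c' = (4 * \<omega>) *\<^sub>R a"
  shows "b + b' = - a" "\<omega> = - 1 / 2"
proof -
  have ne: "b \<noteq> b'" "c \<noteq> c'" using unit \<omega> \<open>\<omega> \<noteq> 1\<close> by auto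
  define p where "p = b + b' - (2 * \<omega>) *\<^sub>R a"
  have cross: "cross3 a (b - b') \<noteq> 0"
    using unit ne by (intro cross3_nonzero_orthogonal) (auto simp: inner_diff_right \<omega>)
  have "p = 0 \<or> c - c' = 0"
    using orthogonal_in_line[OF cross, of p "c - c'"] unit \<omega> \<mu>
    by (simp add: p_def inner_diff_left inner_diff_right inner_add_left inner_commute algebra_simps)
  then have *: "b + b' = (2 * \<omega>) *\<^sub>R a" using ne by (simp add: p_def)
  then have "b \<bullet> (b + b') = 2 * \<omega> * \<omega>" by (simp add: \<omega> inner_commute)
  then have "(\<omega> - 1) * (2 * \<omega> + 1) = 0" by (simp add: inner_add_right unit \<omega> algebra_simps)
  then show "\<omega> = - 1 / 2" using \<open>\<omega> \<noteq> 1\<close> by simp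
  with * show "b + b' = - a" by simp
qed

text \<open>\<open>\<omega>\<^sub>1\<close> and \<open>\<omega>\<^sub>2\<close> are the cosines of
  the representation at distances 1 and 2; \<open>a\<^sub>1\<close> and \<open>c\<^sub>2\<close> are
  the usual intersection numbers.\<close>

locale represented_graph = connected_graph G
  for G :: "'v::finite pair_pre_digraph" +
  fixes u :: "'v \<Rightarrow> real ^ 3" and k a\<^sub>1 c\<^sub>2 :: nat and \<theta> \<omega>\<^sub>1 \<omega>\<^sub>2 :: real
  assumes unit: "u x \<bullet> u x = 1"
    and sum_u: "(\<Sum>y\<in>N x. u y) = \<theta> *\<^sub>R u x"
    and inner_1: "y \<in> N x \<Longrightarrow> u x \<bullet> u y = \<omega>\<^sub>1"
    and inner_2: "d x y = 2 \<Longrightarrow> u x \<bullet> u y = \<omega>\<^sub>2"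
    and valency: "card (N x) = k" and k_ge_3: "k \<ge> 3"
    and theta: "\<theta> \<noteq> real k" "\<theta> \<noteq> - real k" "eigenvalue_multiplicity G \<theta> = 3"
    and a\<^sub>1: "y \<in> N x \<Longrightarrow> card (N x \<inter> N y) = a\<^sub>1"
    and c\<^sub>2: "d x y = 2 \<Longrightarrow> card (N x \<inter> N y) = c\<^sub>2"
    and not_multipartite: "\<not> complete_multipartite G"
begin

section \<open>Cosines and bounds on the valency\<close>

lemma theta_eq: "\<theta> = k * \<omega>\<^sub>1"
proof -
  fix x
  have "u x \<bullet> (\<Sum>y\<in>N x. u y) = k * \<omega>\<^sub>1"
    by (simp add: inner_sum_right inner_1 valency)
  then show ?thesis by (simp add: sum_u unit)
qed

lemma omega_1: "\<omega>\<^sub>1 \<noteq> 1" "\<omega>\<^sub>1\<^sup>2 \<noteq> 1"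
proof -
  have "\<omega>\<^sub>1 \<noteq> 1 \<and> \<omega>\<^sub>1 \<noteq> - 1" using theta theta_eq by auto
  then show "\<omega>\<^sub>1 \<noteq> 1" "\<omega>\<^sub>1\<^sup>2 \<noteq> 1" by (simp_all add: power2_eq_1_iff)
qed

lemma cross3_adjacent: "y \<in> N x \<Longrightarrow> cross3 (u x) (u y) \<noteq> 0"
  using omega_1 by (intro cross3_nonzero_unit) (simp_all add: unit inner_1)

lemma N_nonempty: "N x \<noteq> {}"
  using valency[of x] k_ge_3 by auto

lemma common_neighbour:
  assumes "y \<in> N x" "a\<^sub>1 \<noteq> 0"
  shows "\<exists>z\<in>N x. z \<in> N y"
proof -
  have "N x \<inter> N y \<noteq> {}" using a\<^sub>1[OF assms(1)] assms(2) by (metis card.empty)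
  then show ?thesis by blast
qed

lemma common_neighbour_unique:
  assumes "a\<^sub>1 = 1" "y \<in> N x" "v \<in> N x" "v \<in> N y" "w \<in> N x" "w \<in> N y"
  shows "v = w"
  using a\<^sub>1[OF assms(2)] assms card_le_Suc0_iff_eq[of "N x \<inter> N y"] by simp

lemma dist_2_in_N: "y \<in> N x \<Longrightarrow> z \<in> N x \<Longrightarrow> z \<notin> N y \<Longrightarrow> y \<noteq> z \<Longrightarrow> d y z = 2"
  using d_2_iff[of y z] N_sym by auto

lemma card_nonadjacent: "y \<in> N x \<Longrightarrow> card (N x - N y - {y}) + a\<^sub>1 + 1 = k"
proof -
  assume y: "y \<in> N x"
  have "N x = (N x - N y - {y}) \<union> (N x \<inter> N y) \<union> {y}" using y by auto
  also have "card \<dots> = card (N x - N y - {y}) + card (N x \<inter> N y) + card {y}"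
    by (subst card_Un_disjoint, simp, simp, force)+ simp
  finally show ?thesis using a\<^sub>1[OF y] valency[of x] by simp
qed

text \<open>Cosine 1 would give vertices at distance 2 the same vector. Without triangles all
  neighbours of a vertex then share one vector, which forces
  \<open>\<omega>\<^sub>1\<^sup>2 = 1\<close>; with triangles, non-adjacency becomes transitive in
  each neighbourhood and the graph complete multipartite.\<close>

lemma omega_2: "\<omega>\<^sub>2 \<noteq> 1"
proof
  assume "\<omega>\<^sub>2 = 1"
  then have eq: "u y = u z" if "d y z = 2" for y z
    using inner_2[OF that] unit \<open>\<omega>\<^sub>2 = 1\<close> by (auto intro!: unit_vectors_eqI[of "u y" "u z"])
  have "a\<^sub>1 \<noteq> 0"
  proof
    assume "a\<^sub>1 = 0"
    fix x
    obtain y where y: "y \<in> N x" using N_nonempty by blast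
    have "u z = u y" if "z \<in> N x" for z
      using eq[of z y] dist_2_in_N[OF that y] a\<^sub>1[OF that] \<open>a\<^sub>1 = 0\<close> y by (cases "z = y") auto
    then have "(\<Sum>z\<in>N x. u z) = k *\<^sub>R u y" using sum_constant_scaleR[of "u y" "N x"] by (simp add: valency)
    then have "k *\<^sub>R u y \<bullet> u y = \<theta> *\<^sub>R u x \<bullet> u y" by (simp add: sum_u)
    then show False
      using k_ge_3 omega_1 by (simp add: unit inner_1[OF y] theta_eq power2_eq_square)
  qed
  have "complete_multipartite G"
  proof (rule complete_multipartite_if_locally)
    show "\<exists>z\<in>N x. z \<in> N y" if "y \<in> N x" for x y
      using common_neighbour[OF that \<open>a\<^sub>1 \<noteq> 0\<close>] by blast
    show "z \<notin> N x" if "x \<in> N p" "y \<in> N p" "z \<in> N p" "y \<notin> N x" "z \<notin> N y" for p x y z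
    proof
      assume "z \<in> N x"
      have "u x = u y" "u y = u z" using eq dist_2_in_N that by metis+
      then show False using inner_1[OF \<open>z \<in> N x\<close>] unit[of x] omega_1 by simp
    qed
  qed
  then show False using not_multipartite by simp
qed

lemma inj_on_u: "inj_on u (N x)"
proof (rule inj_onI, rule ccontr)
  fix y z assume yz: "y \<in> N x" "z \<in> N x" "u y = u z" "y \<noteq> z"
  show False
  proof (cases "z \<in> N y")
    case True
    then show ?thesis using inner_1[of z y] unit[of y] omega_1 yz by simp
  next
    case False
    then show ?thesis using inner_2[of y z] dist_2_in_N unit[of y] omega_2 yz by simp
  qed
qed

text \<open>The vectors of \<open>S\<close> have prescribed inner products with \<open>u x\<close>
  and \<open>u y\<close>. With \<open>\<beta>\<close> equal to \<open>\<omega>\<^sub>1\<close> this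
  bounds the neighbours of \<open>y\<close> inside \<open>N x\<close>, with
  \<open>\<omega>\<^sub>2\<close> the non-neighbours.\<close>

lemma card_in_N_le_2:
  assumes "y \<in> N x" "S \<subseteq> N x" "\<And>z. z \<in> S \<Longrightarrow> u y \<bullet> u z = \<beta>"
  shows "card S \<le> 2"
proof -
  have "card (u ` S) \<le> 2"
    using assms unit inner_1
    by (intro card_sphere_line_le_2[OF cross3_adjacent[OF assms(1)], of _ "\<omega>\<^sub>1" \<beta>])
      (auto simp: inner_commute)
  then show ?thesis using inj_on_subset[OF inj_on_u assms(2)] by (simp add: card_image)
qed

lemma ex_adjacent: obtains x y where "y \<in> N x"
  using N_nonempty by blast

lemma a\<^sub>1_le_2: "a\<^sub>1 \<le> 2"
proof -
  obtain x y where "y \<in> N x" by (rule ex_adjacent)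
  then show ?thesis using card_in_N_le_2[of y x "N x \<inter> N y" \<omega>\<^sub>1] a\<^sub>1 inner_1 by simp
qed

lemma k_le: "k \<le> a\<^sub>1 + 3"
proof -
  obtain x y where xy: "y \<in> N x" by (rule ex_adjacent)
  have "card (N x - N y - {y}) \<le> 2"
    by (rule card_in_N_le_2[OF xy, of _ \<omega>\<^sub>2]) (auto intro!: inner_2 dist_2_in_N[OF xy])
  then show ?thesis using card_nonadjacent[OF xy] by simp
qed

text \<open>Otherwise each vertex of \<open>N x\<close> misses at most one other vertex of
  \<open>N x\<close>, so non-adjacency is transitive there. If \<open>a\<^sub>1\<close> is 0, the
  bound is just \<open>k_ge_3\<close>.\<close>

lemma k_gt: "k > a\<^sub>1 + 2"
proof (rule ccontr)
  assume *: "\<not> ?thesis"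
  have one: "z = w" if "y \<in> N x" "z \<in> N x - N y - {y}" "w \<in> N x - N y - {y}" for x y z w
  proof -
    have "card (N x - N y - {y}) \<le> 1" using card_nonadjacent[OF that(1)] * by simp
    then show ?thesis using that(2,3) card_le_Suc0_iff_eq[of "N x - N y - {y}"] by auto
  qed
  have trans: "z \<notin> N x" if "x \<in> N p" "y \<in> N p" "z \<in> N p" "y \<notin> N x" "z \<notin> N y" for p x y z
  proof (cases "y = x \<or> y = z")
    case True
    then show ?thesis using that by auto
  next
    case False
    then have "x = z" using one[OF that(2), of x z] that N_sym by auto
    then show ?thesis by simp
  qed
  show False
  proof (cases "a\<^sub>1 = 0")
    case True
    then show ?thesis using * k_ge_3 by simp
  next
    case False
    then have "\<exists>z\<in>N x. z \<in> N y" if "y \<in> N x" for x y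
      using common_neighbour[OF that False] by blast
    then have "complete_multipartite G" using trans by (rule complete_multipartite_if_locally)
    then show False using not_multipartite by simp
  qed
qed

lemma k_eq: "k = a\<^sub>1 + 3"
  using k_le k_gt by simp

section \<open>Excluding \<open>a\<^sub>1 = 1\<close>\<close>

text \<open>Each of the four neighbours of \<open>x\<close> has exactly one neighbour among them, so
  they are perfectly matched.\<close>

lemma two_edges_local:
  assumes "a\<^sub>1 = 1" and y: "y \<in> N x"
  obtains y' z z' where "N x = {y, y', z, z'}" "distinct [y, y', z, z']"
    "N x \<inter> N y = {y'}" "N x \<inter> N y' = {y}" "N x \<inter> N z = {z'}" "N x \<inter> N z' = {z}"
proof -
  have one: "\<exists>w. N x \<inter> N v = {w}" if "v \<in> N x" for v
    using a\<^sub>1[OF that] assms(1) by (simp add: card_1_singleton_iff)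
  obtain y' where y': "N x \<inter> N y = {y'}" using one[OF y] by blast
  then have "y' \<in> N x" "y' \<in> N y" by auto
  then have "y' \<noteq> y" "y \<in> N x \<inter> N y'" using y N_sym by auto
  with one[OF \<open>y' \<in> N x\<close>] have yy: "N x \<inter> N y' = {y}" by (metis singletonD)
  have "card (N x - {y, y'}) = 2"
    using \<open>y' \<noteq> y\<close> \<open>y' \<in> N x\<close> y valency[of x] k_eq assms(1) by (simp add: card_Diff_subset)
  then obtain z z' where z: "N x - {y, y'} = {z, z'}" "z \<noteq> z'" by (auto simp: card_2_iff)
  have other: "N x \<inter> N v = {w}" if vw: "N x - {y, y'} = {v, w}" for v w
  proof -
    have v: "v \<in> N x" "v \<noteq> y" "v \<noteq> y'" using vw by auto
    obtain t where t: "N x \<inter> N v = {t}" using one[OF v(1)] by blast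
    then have "t \<in> N x" "t \<noteq> v" by auto
    moreover have "v \<in> N x \<inter> N t" using t v(1) N_sym by blast
    then have "t \<noteq> y" "t \<noteq> y'" using y' yy v(2,3) by auto
    ultimately have "t \<in> {v, w}" using vw by blast
    with \<open>t \<noteq> v\<close> t show ?thesis by auto
  qed
  show thesis
  proof (rule that)
    show "N x = {y, y', z, z'}" using z y \<open>y' \<in> N x\<close> by auto
    show "distinct [y, y', z, z']" using z \<open>y' \<noteq> y\<close> by auto
    show "N x \<inter> N z = {z'}" using other z by blast
    show "N x \<inter> N z' = {z}" using other z by (metis insert_commute)
  qed (use y' yy in auto)
qed

lemma triangle_sum:
  assumes "a\<^sub>1 = 1" "y \<in> N x" "N x \<inter> N y = {y'}"
  shows "u y + u y' = - u x" "\<omega>\<^sub>1 = - 1 / 2"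
proof -
  obtain y'' z z' where *: "N x = {y, y'', z, z'}" "distinct [y, y'', z, z']"
    "N x \<inter> N y = {y''}" "N x \<inter> N y'' = {y}" "N x \<inter> N z = {z'}" "N x \<inter> N z' = {z}"
    using two_edges_local[OF assms(1,2)] by blast
  have "y'' = y'" using * assms(3) by auto
  have N: "y \<in> N x" "y' \<in> N x" "z \<in> N x" "z' \<in> N x" using * \<open>y'' = y'\<close> by auto
  have "y' \<in> N y" "z' \<in> N z" using *(3,5) \<open>y'' = y'\<close> by auto
  moreover have "z \<notin> N y" "z' \<notin> N y" "z \<notin> N y'" "z' \<notin> N y'"
    using *(2,3,4) N \<open>y'' = y'\<close> by auto
  then have "d y z = 2" "d y z' = 2" "d y' z = 2" "d y' z' = 2"
    using *(2) N \<open>y'' = y'\<close> dist_2_in_N by auto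
  moreover have "u y + u y' + u z + u z' = (4 * \<omega>\<^sub>1) *\<^sub>R u x"
    using sum_u[of x] *(1,2) \<open>y'' = y'\<close> theta_eq k_eq assms(1) by (simp add: add.assoc)
  ultimately show "u y + u y' = - u x" "\<omega>\<^sub>1 = - 1 / 2"
    using opposite_pairs_on_sphere[of "u x" "u y" "u y'" "u z" "u z'" \<omega>\<^sub>1 \<omega>\<^sub>2] N
    by (simp_all add: unit inner_1 inner_2 omega_1)
qed

text \<open>With \<open>z'\<close> and \<open>w'\<close> completing the triangles on
  \<open>x z\<close> and \<open>y w\<close>, the differences \<open>g\<close> and \<open>h\<close>
  are orthogonal to \<open>u x\<close> and \<open>u y\<close> and have squared length 3. Being
  parallel, they satisfy \<open>g \<bullet> h\<close> = 3 or -3, so \<open>u w \<bullet> u z\<close>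
  is 5/8 or -7/8: neither 1, as for equal vertices, nor -1/2, as for adjacent ones.\<close>

lemma across_edge:
  assumes "a\<^sub>1 = 1" "y \<in> N x" "z \<in> N x" "z \<notin> N y" "z \<noteq> y" "w \<in> N y" "w \<notin> N x" "w \<noteq> x"
  shows "z \<noteq> w" "w \<notin> N z"
proof -
  obtain y' where y': "N x \<inter> N y = {y'}" using a\<^sub>1[OF assms(2)] assms(1) by (auto simp: card_1_singleton_iff)
  \<comment> \<open>Stated for an arbitrary edge because it is used a second time with
    \<open>x\<close> and \<open>y\<close> exchanged.\<close>
  have other: "\<exists>z'. u z + u z' = - u x \<and> (u z - u z') \<bullet> u y = 0"
    if yx: "y \<in> N x" "N x \<inter> N y = {y'}" and z: "z \<in> N x" "z \<notin> N y" "z \<noteq> y" for x y y' z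
  proof -
    obtain z' where z': "N x \<inter> N z = {z'}" using a\<^sub>1[OF z(1)] assms(1) by (auto simp: card_1_singleton_iff)
    have "z' \<in> N x" "z' \<in> N z" using z' by auto
    moreover have "z' \<noteq> y" using z z' N_sym by auto
    moreover have "z' \<notin> N y"
    proof
      assume "z' \<in> N y"
      then have "y \<in> N x \<inter> N z'" "z \<in> N x \<inter> N z'" using yx z \<open>z' \<in> N z\<close> N_sym by auto
      then show False
        using common_neighbour_unique[OF assms(1) \<open>z' \<in> N x\<close>, of y z] \<open>z \<noteq> y\<close> by auto
    qed
    ultimately have "d y z = 2" "d y z' = 2"
      using dist_2_in_N[OF yx(1)] z(1,2) z(3)[symmetric] by auto
    then have "(u z - u z') \<bullet> u y = 0"
      using inner_2[of y z] inner_2[of y z'] by (simp add: inner_diff_right inner_commute[of _ "u y"])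
    then show ?thesis
      using triangle_sum(1)[OF assms(1) z(1) z'] by (intro exI[of _ z'] conjI)
  qed
  obtain z' where z': "u z + u z' = - u x" "(u z - u z') \<bullet> u y = 0"
    using other[OF assms(2) y' assms(3-5)] by blast
  have x: "x \<in> N y" "N y \<inter> N x = {y'}" using assms(2) y' N_sym by auto
  obtain w' where w': "u w + u w' = - u y" "(u w - u w') \<bullet> u x = 0"
    using other[OF x assms(6-8)] by blast
  define g where "g = u w - u w'"
  define h where "h = u z - u z'"
  have uz': "u z' = - u x - u z" and uw': "u w' = - u y - u w"
    using z'(1) w'(1) by (auto simp: algebra_simps eq_neg_iff_add_eq_0)
  have inner: "u x \<bullet> u y = - 1 / 2" "u x \<bullet> u z = - 1 / 2" "u y \<bullet> u w = - 1 / 2"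
    using inner_1 assms(2,3,6) triangle_sum(2)[OF assms(1,2) y'] by auto
  have h2: "h = 2 *\<^sub>R u z + u x" and g2: "g = 2 *\<^sub>R u w + u y"
    by (simp_all add: h_def g_def uz' uw' scaleR_2)
  have h: "h \<bullet> u x = 0" "h \<bullet> u y = 0" "h \<bullet> h = 3"
    and g: "g \<bullet> u x = 0" "g \<bullet> u y = 0" "g \<bullet> g = 3"
    using z'(2) w'(2) inner unit
    by (simp_all add: h_def[symmetric] g_def[symmetric])
      (simp_all add: h2 g2 inner_add_left inner_add_right inner_commute)
  obtain s t where st: "g = s *\<^sub>R cross3 (u x) (u y)" "h = t *\<^sub>R cross3 (u x) (u y)"
    using orthogonal_to_two_imp_cross3_multiple[OF cross3_adjacent[OF assms(2)]] g h by metis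
  have gh: "(g \<bullet> h)\<^sup>2 = 9"
  proof -
    have "(g \<bullet> h)\<^sup>2 = (g \<bullet> g) * (h \<bullet> h)" by (simp add: st power2_eq_square)
    then show ?thesis by (simp add: g h)
  qed
  have "2 *\<^sub>R u w = g - u y" "2 *\<^sub>R u z = h - u x"
    by (simp_all add: g2 h2)
  then have "(2 *\<^sub>R u w) \<bullet> (2 *\<^sub>R u z) = (g - u y) \<bullet> (h - u x)" by simp
  also have "\<dots> = g \<bullet> h + u x \<bullet> u y"
    using g h by (simp add: inner_diff_left inner_diff_right inner_commute)
  also have "u x \<bullet> u y = - 1 / 2" by (rule inner)
  finally have eq: "g \<bullet> h = 4 * (u w \<bullet> u z) + 1 / 2" by simp
  have ne: "u w \<bullet> u z \<noteq> 1" "u w \<bullet> u z \<noteq> - 1 / 2"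
    using gh unfolding eq by (auto simp: power2_eq_square)
  show "z \<noteq> w" using ne unit by auto
  show "w \<notin> N z"
    using ne inner_1[of w z] triangle_sum(2)[OF assms(1,2) y'] by (auto simp: inner_commute)
qed

text \<open>The four neighbours of \<open>x\<close> have two further neighbours each. These pairs
  are disjoint: for adjacent \<open>y\<close>, \<open>z\<close> since an edge lies in one triangle
  only, otherwise by \<open>across_edge\<close>.\<close>

lemma card_vertices_ge:
  assumes "a\<^sub>1 = 1"
  shows "CARD('v) \<ge> 12"
proof -
  fix x
  define S where "S y = N y - N x - {x}" for y
  have card_S: "card (S y) = 2" if "y \<in> N x" for y
    using card_nonadjacent[of x y] that N_sym k_eq assms by (simp add: S_def)
  have disj: "S y \<inter> S z = {}" if "y \<in> N x" "z \<in> N x" "y \<noteq> z" for y z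
  proof (rule ccontr)
    assume "S y \<inter> S z \<noteq> {}"
    then obtain w where w: "w \<in> N y" "w \<in> N z" "w \<notin> N x" "w \<noteq> x" by (auto simp: S_def)
    show False
    proof (cases "z \<in> N y")
      case True
      have "x \<in> N y" "x \<in> N z" using that N_sym by auto
      then show False using common_neighbour_unique[OF assms True, of x w] w by auto
    next
      case False
      then show False using across_edge[OF assms that(1,2)] that w by auto
    qed
  qed
  have "card (\<Union>y\<in>N x. S y) = (\<Sum>y\<in>N x. card (S y))"
    by (rule card_UN_disjoint) (use disj in auto)
  also have "\<dots> = 8" using card_S valency k_eq assms by simp
  finally have "card ((\<Union>y\<in>N x. S y) \<union> N x) = 12"
    using valency[of x] k_eq assms by (subst card_Un_disjoint) (auto simp: S_def)
  then show ?thesis by (metis card_mono finite subset_UNIV)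
qed

text \<open>\<open>A + 2 I\<close> is the Gram matrix of the incidence vectors of the triangles, of which there are
  \<open>2 n / 3\<close>; so its kernel has dimension at least \<open>n / 3\<close>.\<close>

lemma card_vertices_le:
  assumes "a\<^sub>1 = 1"
  shows "CARD('v) \<le> 9"
proof -
  define \<T> where "\<T> = {t. card t = 3 \<and> (\<forall>a\<in>t. \<forall>b\<in>t. a \<noteq> b \<longrightarrow> b \<in> N a)}"
  define e :: "'v set \<Rightarrow> real ^ 'v" where "e t = (\<chi> x. if x \<in> t then 1 else 0)" for t
  have e_inner: "e t \<bullet> v = (\<Sum>x\<in>t. v $ x)" for t v
    by (simp add: e_def inner_vec_def if_distrib[of "\<lambda>c. c * _"] sum.If_cases cong: if_cong)
  \<comment> \<open>Each vertex lies in exactly two triangles, which meet only there and cover its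
    neighbourhood.\<close>
  have at: "\<exists>y y' z z'. N x = {y, y', z, z'} \<and> distinct [x, y, y', z, z'] \<and>
    {t \<in> \<T>. x \<in> t} = {{x, y, y'}, {x, z, z'}}" for x
  proof -
    obtain y where y: "y \<in> N x" using N_nonempty by blast
    obtain y' z z' where *: "N x = {y, y', z, z'}" "distinct [y, y', z, z']"
      "N x \<inter> N y = {y'}" "N x \<inter> N y' = {y}" "N x \<inter> N z = {z'}" "N x \<inter> N z' = {z}"
      using two_edges_local[OF assms y] by blast
    have adj: "y' \<in> N y" "z' \<in> N z" "y \<in> N x" "y' \<in> N x" "z \<in> N x" "z' \<in> N x" using * by auto
    then have ne: "x \<notin> {y, y', z, z'}" by auto
    have "{t \<in> \<T>. x \<in> t} \<subseteq> {{x, y, y'}, {x, z, z'}}"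
    proof
      fix t assume "t \<in> {t \<in> \<T>. x \<in> t}"
      then have t: "card t = 3" "x \<in> t" "\<And>a b. a \<in> t \<Longrightarrow> b \<in> t \<Longrightarrow> a \<noteq> b \<Longrightarrow> b \<in> N a"
        by (auto simp: \<T>_def)
      then have "card (t - {x}) = 2" by simp
      then obtain b c where bc: "t - {x} = {b, c}" "b \<noteq> c" by (auto simp: card_2_iff)
      then have "b \<in> t" "c \<in> t" "b \<noteq> x" "c \<noteq> x" by auto
      then have "b \<in> N x" "c \<in> N x \<inter> N b" using t(2,3) bc(2) by auto
      moreover from this have "b = y \<or> b = y' \<or> b = z \<or> b = z'" using *(1) by blast
      ultimately have "{b, c} = {y, y'} \<or> {b, c} = {z, z'}"
        by (elim disjE) (use *(3-6) in auto)
      moreover have "t = {x} \<union> {b, c}" using bc t(2) by blast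
      ultimately show "t \<in> {{x, y, y'}, {x, z, z'}}" by auto
    qed
    moreover have "x \<in> N y" "x \<in> N y'" "x \<in> N z" "x \<in> N z'" "y \<in> N y'" "z \<in> N z'"
      using adj N_sym by blast+
    then have "{x, y, y'} \<in> \<T>" "{x, z, z'} \<in> \<T>"
      using adj ne *(2) by (auto simp: \<T>_def)
    ultimately have "{t \<in> \<T>. x \<in> t} = {{x, y, y'}, {x, z, z'}}" by auto
    then show ?thesis using * ne by (intro exI[of _ y] exI[of _ y'] exI[of _ z] exI[of _ z']) simp
  qed
  \<comment> \<open>Incidences of vertices and triangles are counted in two ways.\<close>
  have "(\<Sum>x\<in>UNIV. card {t \<in> \<T>. x \<in> t}) = 3 * card \<T>"
    by (rule sum_multicount) (auto simp: \<T>_def)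
  moreover have "card {t \<in> \<T>. x \<in> t} = 2" for x
  proof -
    obtain y y' z z' where "distinct [x, y, y', z, z']" "{t \<in> \<T>. x \<in> t} = {{x, y, y'}, {x, z, z'}}"
      using at[of x] by (elim exE conjE)
    moreover from this(1) have "y \<notin> {x, z, z'}" by auto
    then have "{x, y, y'} \<noteq> {x, z, z'}" by blast
    ultimately show ?thesis by simp
  qed
  ultimately have count: "2 * CARD('v) = 3 * card \<T>" by simp
  define K where "K = {v \<in> UNIV. \<forall>b\<in>span (e ` \<T>). orthogonal b v}"
  have "dim K + dim (span (e ` \<T>)) = DIM(real ^ 'v)"
    unfolding K_def by (subst dim_subspace_orthogonal_to_vectors) auto
  moreover have "dim (span (e ` \<T>)) \<le> card \<T>"
    by (metis card_image_le dim_le_card' dim_span finite finite_imageI le_trans)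
  ultimately have "CARD('v) \<le> dim K + card \<T>" by simp
  \<comment> \<open>A vector in \<open>K\<close> sums to 0 over every triangle. Adding the equations
    of the two triangles at \<open>x\<close> gives eigenvalue -2, and \<open>\<theta>\<close> is 4
    times -1/2.\<close>
  moreover have "K \<subseteq> {v. adjacency_matrix G *v v = \<theta> *\<^sub>R v}"
  proof
    fix v assume "v \<in> K"
    then have *: "(\<Sum>x\<in>t. v $ x) = 0" if "t \<in> \<T>" for t
      using span_base[of "e t" "e ` \<T>"] that by (auto simp: K_def orthogonal_def e_inner)
    have "adj_op v $ x = \<theta> * v $ x" for x
    proof -
      obtain y y' z z' where "N x = {y, y', z, z'}" "distinct [x, y, y', z, z']"
        "{t \<in> \<T>. x \<in> t} = {{x, y, y'}, {x, z, z'}}"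
        using at[of x] by (elim exE conjE)
      moreover from this have "{x, y, y'} \<in> \<T>" "{x, z, z'} \<in> \<T>" by blast+
      ultimately have "v $ x + v $ y + v $ y' = 0" "v $ x + v $ z + v $ z' = 0"
        "adj_op v $ x = v $ y + v $ y' + v $ z + v $ z'"
        using *[of "{x, y, y'}"] *[of "{x, z, z'}"] by (auto simp: adj_op_nth)
      moreover have "\<theta> = - 2"
      proof -
        obtain y where "y \<in> N x" using N_nonempty by blast
        moreover from a\<^sub>1[OF this] obtain y' where "N x \<inter> N y = {y'}"
          using assms by (auto simp: card_1_singleton_iff)
        ultimately show ?thesis using triangle_sum(2)[OF assms] theta_eq k_eq assms by simp
      qed
      ultimately show ?thesis by simp
    qed
    then show "v \<in> {v. adjacency_matrix G *v v = \<theta> *\<^sub>R v}"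
      by (simp add: adj_op_def vec_eq_iff)
  qed
  then have "dim K \<le> 3"
    using dim_subset theta(3) unfolding eigenvalue_multiplicity_def by metis
  ultimately show ?thesis using count by simp
qed

lemma a\<^sub>1_ne_1: "a\<^sub>1 \<noteq> 1"
  using card_vertices_ge card_vertices_le by fastforce

end

section \<open>Coverings by a graph with an equitable level function\<close>

text \<open>The condition on \<open>S\<close> says that the levels form an equitable partition; with the others it makes
  the graph distance-regular around the base vertex \<open>b\<close>.\<close>

definition level_graph ::
    "'a list \<Rightarrow> ('a \<Rightarrow> 'a list) \<Rightarrow> 'a \<Rightarrow> ('a \<Rightarrow> nat) \<Rightarrow> (nat \<Rightarrow> nat list) \<Rightarrow> nat \<Rightarrow> bool" where
  "level_graph vs nl b L S k \<longleftrightarrow> b \<in> set vs \<and> distinct vs \<and>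
     (\<forall>p\<in>set vs. (L p = 0 \<longleftrightarrow> p = b) \<and> length (nl p) = k \<and> distinct (nl p) \<and>
        (\<forall>q\<in>set (nl p). q \<in> set vs \<and> p \<in> set (nl q) \<and> L q \<le> Suc (L p)) \<and>
        (L p = 0 \<or> (\<exists>q\<in>set (nl p). Suc (L q) = L p)) \<and> sort (map L (nl p)) = S (L p))"

context connected_graph begin

text \<open>A map that is bijective on neighbourhoods is onto by connectedness, and all its fibres
  have the same size. With fewer than twice as many vertices upstairs, the fibres are
  singletons.\<close>

lemma covering_bij_betw:
  assumes fin: "finite (pverts H)" and p0: "p0 \<in> pverts H"
    and sym: "\<And>p q. q \<in> nbrs H p \<Longrightarrow> q \<in> pverts H \<and> p \<in> nbrs H q"
    and local: "\<And>p. p \<in> pverts H \<Longrightarrow> bij_betw f (nbrs H p) (N (f p))"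
    and card: "card (pverts H) < 2 * CARD('v)"
  shows "bij_betw f (pverts H) UNIV"
proof -
  have surj: "\<exists>p\<in>pverts H. f p = y" for y
  proof (induction y rule: connected_induct[where x = "f p0"])
    case (step y z)
    then obtain p where "p \<in> pverts H" "f p = y" by blast
    then have "z \<in> f ` nbrs H p" using local[of p] step(2) by (simp add: bij_betw_def)
    then show ?case using sym by blast
  qed (use p0 in blast)
  define F where "F y = {p \<in> pverts H. f p = y}" for y
  have fin_F: "finite (F y)" for y using fin by (simp add: F_def)
  have le: "card (F y) \<le> card (F z)" if "z \<in> N y" for y z
  proof -
    have "\<exists>q\<in>nbrs H p. f q = z" if "p \<in> F y" for p
    proof -
      have "z \<in> f ` nbrs H p"
        using local[of p] that \<open>z \<in> N y\<close> by (simp add: bij_betw_def F_def)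
      then show ?thesis by blast
    qed
    \<comment> \<open>\<open>g\<close> lifts the edge from \<open>y\<close> to \<open>z\<close> to
      every point of the fibre. It is injective because two points with the same lift are neighbours
      of that lift with the same image.\<close>
    then obtain g where g: "\<And>p. p \<in> F y \<Longrightarrow> g p \<in> nbrs H p \<and> f (g p) = z" by metis
    have "inj_on g (F y)"
    proof (rule inj_onI)
      fix p q assume pq: "p \<in> F y" "q \<in> F y" "g p = g q"
      then have "p \<in> nbrs H (g p)" "q \<in> nbrs H (g p)" "g p \<in> pverts H" "f p = f q"
        using sym g[OF pq(1)] g[OF pq(2)] by (auto simp: F_def)
      then show "p = q" using local[of "g p"] by (auto simp: bij_betw_def inj_on_def)
    qed
    moreover have "g ` F y \<subseteq> F z" using g sym by (auto simp: F_def)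
    ultimately show ?thesis using card_inj_on_le fin_F by blast
  qed
  have eq: "card (F y) = card (F z)" for y z
  proof (induction y rule: connected_induct[where x = z])
    case (step y w)
    have "y \<in> N w" using step(2) N_sym by blast
    then show ?case using le[of w y] le[of y w] step by simp
  qed simp
  have "inj_on f (pverts H)"
  proof (rule inj_onI, rule ccontr)
    fix p q assume pq: "p \<in> pverts H" "q \<in> pverts H" "f p = f q" "p \<noteq> q"
    then have "card {p, q} \<le> card (F (f p))" by (intro card_mono fin_F) (auto simp: F_def)
    then have "2 \<le> card (F y)" for y using eq[of "f p" y] pq(4) by simp
    then have "(\<Sum>y\<in>(UNIV :: 'v set). 2) \<le> (\<Sum>y\<in>UNIV. card (F y))" by (intro sum_mono)
    also have "\<dots> = card (\<Union>y\<in>UNIV. F y)"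
      by (rule card_UN_disjoint[symmetric]) (auto simp: F_def fin)
    also have "(\<Union>y\<in>UNIV. F y) = pverts H" by (auto simp: F_def)
    finally show False using card by simp
  qed
  then show ?thesis unfolding bij_betw_def
    by (intro conjI) (use surj in \<open>auto simp: set_eq_iff image_iff eq_commute\<close>)
qed

text \<open>\<open>f\<close> maps the model to the graph, whereas the isomorphism has to lead from
  the graph to the model; hence the inverse \<open>g\<close>.\<close>

lemma digraph_isoI:
  fixes H :: "'b pair_pre_digraph"
  assumes bij: "bij_betw f (pverts H) UNIV"
    and wf: "parcs H \<subseteq> pverts H \<times> pverts H"
    and nbrs: "\<And>p. p \<in> pverts H \<Longrightarrow> f ` nbrs H p = N (f p)"
  shows "digraph_iso (with_proj G) (with_proj H)"
proof -
  define g where "g = inv_into (pverts H) f"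
  have g: "bij_betw g UNIV (pverts H)" "\<And>p. p \<in> pverts H \<Longrightarrow> g (f p) = p" "\<And>y. f (g y) = y"
    using bij bij_betw_inv_into[OF bij] f_inv_into_f[of _ f "pverts H"]
    by (auto simp: g_def bij_betw_def)
  have inj: "inj g" using g(3) by (metis injI)
  define h :: "('v, 'v \<times> 'v, 'b, 'b \<times> 'b) digraph_isomorphism" where
    "h = \<lparr>iso_verts = g, iso_arcs = map_prod g g, iso_head = snd, iso_tail = fst\<rparr>"
  have "map_prod g g ` parcs G = parcs H"
  proof (intro equalityI subsetI)
    fix e assume "e \<in> map_prod g g ` parcs G"
    then obtain x y where xy: "e = (g x, g y)" "y \<in> N x" by (auto simp: nbrs_def)
    have "g x \<in> pverts H" using g(1) by (auto simp: bij_betw_def)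
    then have "y \<in> f ` nbrs H (g x)" using nbrs[of "g x"] g(3) xy by simp
    then obtain q where "(g x, q) \<in> parcs H" "f q = y" by (auto simp: nbrs_def)
    then show "e \<in> parcs H" using g(2) wf xy by auto
  next
    fix e assume e: "e \<in> parcs H"
    obtain p q where pq: "e = (p, q)" by (cases e)
    have *: "p \<in> pverts H" "q \<in> pverts H" using e pq wf by auto
    have "f q \<in> N (f p)" using nbrs[OF *(1)] e pq by (auto simp: nbrs_def)
    then show "e \<in> map_prod g g ` parcs G"
      using g(2) * pq by (auto simp: nbrs_def intro!: image_eqI[of _ _ "(f p, f q)"])
  qed
  then have "with_proj H = app_iso h (with_proj G)"
    using g(1) by (simp add: app_iso_def with_proj_def h_def bij_betw_def)
  moreover have "digraph_isomorphism h"
    using wf_digraph_axioms inj inj_on_subset[OF prod.inj_map[OF inj inj] subset_UNIV]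
    by (auto simp: digraph_isomorphism_def h_def)
  ultimately show ?thesis unfolding digraph_iso_def by blast
qed

text \<open>Mapping \<open>k\<close> neighbours onto \<open>k\<close> neighbours is a bijection, so
  \<open>covering_bij_betw\<close> applies. As the base vertex can be sent to any \<open>x\<close>,
  the distances from every \<open>x\<close> are the levels of the model, and the equitable levels
  yield distance-regularity.\<close>

lemma level_graph_covering:
  assumes H: "pverts H = set vs" "\<And>p. p \<in> set vs \<Longrightarrow> nbrs H p = set (nl p)"
    and wf: "parcs H \<subseteq> pverts H \<times> pverts H" and level: "level_graph vs nl b L S k"
    and k: "\<And>x. card (N x) = k" and large: "length vs < 2 * CARD('v)"
    and cover: "\<And>x. \<exists>f. f b = x \<and> (\<forall>p\<in>set vs. f ` set (nl p) = N (f p))"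
  shows "distance_regular G \<and> digraph_iso (with_proj G) (with_proj H)"
proof -
  note level' = level[unfolded level_graph_def]
  have nl: "set (nl p) = nbrs H p" if "p \<in> pverts H" for p using H that by simp
  have b: "b \<in> pverts H" and dist: "distinct vs" using level' H(1) by auto
  have sym: "q \<in> pverts H \<and> p \<in> nbrs H q" if q: "q \<in> nbrs H p" for p q
  proof -
    have p: "p \<in> pverts H" using wf q by (auto simp: nbrs_def)
    then have "p \<in> set vs" "q \<in> set (nl p)" using nl[OF p] q H(1) by auto
    then have "q \<in> set vs \<and> p \<in> set (nl q)" using level' by blast
    then show ?thesis using H by simp
  qed
  have L: "L p = 0 \<longleftrightarrow> p = b" "length (nl p) = k" "distinct (nl p)"
    "\<And>q. q \<in> nbrs H p \<Longrightarrow> L q \<le> Suc (L p)" "L p > 0 \<Longrightarrow> \<exists>q\<in>nbrs H p. Suc (L q) = L p"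
    "sort (map L (nl p)) = S (L p)"
    if "p \<in> pverts H" for p
    using bspec[OF conjunct2[OF conjunct2[OF level']], of p] that nl[OF that] H(1) by auto
  have card_H: "card (nbrs H p) = k" if "p \<in> pverts H" for p
    using distinct_card[OF L(3)[OF that]] L(2)[OF that] nl[OF that] by simp
  have equitable: "card {r \<in> nbrs H p. L r = i} = card {r \<in> nbrs H q. L r = i}"
    if "p \<in> pverts H" "q \<in> pverts H" "L p = L q" for p q i
  proof -
    have count: "card {r \<in> nbrs H p. L r = i} = count (mset (map L (nl p))) i"
      if "p \<in> pverts H" for p
    proof -
      have "{r \<in> nbrs H p. L r = i} = set (filter (\<lambda>r. L r = i) (nl p))"
        using nl[OF that] by auto
      then have "card {r \<in> nbrs H p. L r = i} = length (filter (\<lambda>r. L r = i) (nl p))"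
        using distinct_card[OF distinct_filter[OF L(3)[OF that]]] by simp
      moreover have "length (filter (\<lambda>r. L r = i) xs) = count (mset (map L xs)) i" for xs
        by (induction xs) auto
      ultimately show ?thesis by simp
    qed
    have "sort (map L (nl p)) = sort (map L (nl q))"
      using L(6) that by simp
    then have "mset (map L (nl p)) = mset (map L (nl q))"
      by (metis mset_sort)
    then show ?thesis by (simp add: count that)
  qed
  have cov: "\<exists>f. f b = x \<and> bij_betw f (pverts H) UNIV \<and> (\<forall>p\<in>pverts H. f ` nbrs H p = N (f p)) \<and>
    (\<forall>p\<in>pverts H. d x (f p) = L p)" for x
  proof -
    obtain f where f: "f b = x" "\<And>p. p \<in> pverts H \<Longrightarrow> f ` nbrs H p = N (f p)"
      using cover[of x] H by auto
    have loc: "bij_betw f (nbrs H p) (N (f p))" if "p \<in> pverts H" for p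
    proof -
      have "finite (nbrs H p)" using nl[OF that] by (metis List.finite_set)
      then have "inj_on f (nbrs H p)"
        by (rule eq_card_imp_inj_on) (simp add: f(2) card_H k that)
      then show ?thesis using f(2)[OF that] by (simp add: bij_betw_def)
    qed
    have bij: "bij_betw f (pverts H) UNIV"
    proof (rule covering_bij_betw[OF _ b sym loc])
      show "card (pverts H) < 2 * CARD('v)" using dist large by (simp add: H distinct_card)
    qed (auto simp: H)
    define g where "g = inv_into (pverts H) f"
    have g: "g y \<in> pverts H" "f (g y) = y" for y
      using bij inv_into_into[of y f "pverts H"] f_inv_into_f[of y f "pverts H"]
      by (auto simp: g_def bij_betw_def)
    have gf: "g (f p) = p" if "p \<in> pverts H" for p
      using bij that by (auto simp: g_def bij_betw_def)
    have N_g: "g z \<in> nbrs H (g y)" if zy: "z \<in> N y" for y z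
    proof -
      have "z \<in> f ` nbrs H (g y)" unfolding f(2)[OF g(1)] g(2) by (rule zy)
      then obtain q where q: "q \<in> nbrs H (g y)" "z = f q" by blast
      then have "g z = q" using gf sym by simp
      then show ?thesis using q by simp
    qed
    have d_L: "d x y = L (g y)" for y
    proof (rule d_eq_levelI)
      show "L (g y) = 0 \<longleftrightarrow> y = x" for y
        using L(1)[OF g(1)] g(2) f(1) gf[OF b] by metis
      show "L (g z) \<le> Suc (L (g y))" if "z \<in> N y" for y z
        using L(4)[OF g(1) N_g[OF that]] .
      show "\<exists>z\<in>N y. Suc (L (g z)) = L (g y)" if pos: "L (g y) > 0" for y
      proof -
        obtain q where q: "q \<in> nbrs H (g y)" "Suc (L q) = L (g y)" using L(5)[OF g(1) pos] by blast
        then have "f q \<in> f ` nbrs H (g y)" by blast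
        then have "f q \<in> N y" unfolding f(2)[OF g(1)] g(2) .
        moreover have "g (f q) = q" using q(1) gf sym by blast
        ultimately show ?thesis using q(2) by (intro bexI[of _ "f q"]) simp_all
      qed
    qed
    have "\<forall>p\<in>pverts H. d x (f p) = L p" unfolding d_L using gf by simp
    with f bij show ?thesis by (intro exI[of _ f]) blast
  qed
  have dr: "card (nbrs_at G i x y) = card (nbrs_at G i x' y')" if "d x y = d x' y'" for i x y x' y'
  proof -
    have model: "\<exists>p\<in>pverts H. L p = d x y \<and>
      card (nbrs_at G i x y) = card {r \<in> nbrs H p. L r = i}" for x y
    proof -
      obtain f where f: "bij_betw f (pverts H) UNIV" "\<forall>p\<in>pverts H. f ` nbrs H p = N (f p)"
        "\<forall>p\<in>pverts H. d x (f p) = L p" using cov[of x] by blast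
      have "y \<in> f ` pverts H" using f(1) by (simp add: bij_betw_def)
      then obtain p where p: "p \<in> pverts H" "f p = y" by blast
      have "nbrs_at G i x y = f ` {r \<in> nbrs H p. L r = i}"
      proof -
        have "nbrs_at G i x y = {z \<in> f ` nbrs H p. d x z = i}" using f(2) p by (simp add: nbrs_at_def)
        also have "\<dots> = f ` {r \<in> nbrs H p. L r = i}" using f(3) sym by auto
        finally show ?thesis .
      qed
      moreover have "inj_on f {r \<in> nbrs H p. L r = i}"
        using f(1) sym by (auto simp: bij_betw_def intro: inj_on_subset)
      moreover have "L p = d x y" using bspec[OF f(3) p(1)] p(2) by simp
      ultimately show ?thesis using p by (intro bexI[of _ p]) (simp_all add: card_image)
    qed
    obtain p where p: "p \<in> pverts H" "L p = d x y"
      "card (nbrs_at G i x y) = card {r \<in> nbrs H p. L r = i}" using model[of x y] by blast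
    obtain q where q: "q \<in> pverts H" "L q = d x' y'"
      "card (nbrs_at G i x' y') = card {r \<in> nbrs H q. L r = i}" using model[of x' y'] by blast
    show ?thesis using equitable[OF p(1) q(1)] p q that by simp
  qed
  have "distance_regular G"
    unfolding distance_regular_def
  proof (intro allI impI)
    fix j i
    show "\<exists>c. \<forall>x\<in>pverts G. \<forall>y\<in>pverts G. d x y = j \<longrightarrow> card (nbrs_at G i x y) = c"
    proof (cases "\<exists>x y. d x y = j")
      case True
      then obtain x y where "d x y = j" by blast
      then show ?thesis using dr by (intro exI[of _ "card (nbrs_at G i x y)"]) auto
    qed auto
  qed
  moreover have "digraph_iso (with_proj G) (with_proj H)"
  proof -
    obtain f where "bij_betw f (pverts H) UNIV" "\<forall>p\<in>pverts H. f ` nbrs H p = N (f p)"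
      using cov by blast
    with wf show ?thesis by (intro digraph_isoI) auto
  qed
  ultimately show ?thesis by blast
qed

end

section \<open>The cube, the dodecahedron and the icosahedron\<close>

definition "dodecahedron_verts = List.product [0, 1 :: nat] [0 ..< 10]"

text \<open>Adding 9 or 8 modulo 10 stands for subtracting 1 or 2. Lists instead of sets let the
  finite checks run by rewriting.\<close>

fun dodecahedron_nbrs :: "nat \<times> nat \<Rightarrow> (nat \<times> nat) list" where
  "dodecahedron_nbrs (a, i) =
     (if a = 0 then [(0, (i + 1) mod 10), (0, (i + 9) mod 10), (1, i)]
      else [(0, i), (1, (i + 2) mod 10), (1, (i + 8) mod 10)])"

text \<open>The distances from \<open>(1, 0)\<close>, a vertex of an inner 5-cycle.\<close>

fun dodecahedron_level :: "nat \<times> nat \<Rightarrow> nat" where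
  "dodecahedron_level (a, i) =
     (if a = 0 then [1, 2, 2, 3, 3, 4, 3, 3, 2, 2] else [0, 3, 1, 4, 2, 5, 2, 4, 1, 3]) ! i"

definition "icosahedron_verts = [(0, 0), (3, 0)] @ List.product [1, 2 :: nat] [0 ..< 5]"

fun icosahedron_nbrs :: "nat \<times> nat \<Rightarrow> (nat \<times> nat) list" where
  "icosahedron_nbrs (a, i) =
     (if a = 0 then map (Pair 1) [0 ..< 5] else if a = 3 then map (Pair 2) [0 ..< 5]
      else if a = 1 then
        [(0, 0), (1, (i + 1) mod 5), (1, (i + 4) mod 5), (2, i), (2, (i + 1) mod 5)]
      else [(3, 0), (2, (i + 1) mod 5), (2, (i + 4) mod 5), (1, i), (1, (i + 4) mod 5)])"

definition "cube_verts = [{}, {0}, {1}, {2}, {0, 1}, {0, 2}, {1, 2}, {0, 1, 2 :: nat}]"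

definition cube_nbrs :: "nat set \<Rightarrow> nat set list" where
  "cube_nbrs A = map (\<lambda>i. if i \<in> A then A - {i} else insert i A) [0 ..< 3]"

text \<open>The inverse of a cyclic shift by \<open>c\<close> is the shift by \<open>n - c\<close>;
  this finds the second neighbour along a cycle, where the edge is traversed backwards.\<close>

lemma eq_mod_shift_iff:
  fixes i j c n :: nat
  assumes "i < n" "0 < c" "c < n"
  shows "i = (j + c) mod n \<and> j < n \<longleftrightarrow> j = (i + (n - c)) mod n"
proof (cases "j < n")
  case True
  have "(j + c) mod n = (if j + c < n then j + c else j + c - n)"
    using True assms by (simp add: mod_if)
  moreover have "(i + (n - c)) mod n = (if i < c then i + (n - c) else i - c)"
    using assms by (simp add: mod_if)
  ultimately show ?thesis using True assms by (cases "j + c < n"; cases "i < c") auto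
next
  case False
  have "(i + (n - c)) mod n < n" using assms by simp
  with False show ?thesis by auto
qed

lemma pverts_dodecahedron: "pverts dodecahedron_graph = set dodecahedron_verts"
  unfolding dodecahedron_graph_def dodecahedron_verts_def
  by (simp only: pair_pre_digraph.simps set_product set_upt atLeast0LessThan list.set)

lemma wf_dodecahedron:
  "parcs dodecahedron_graph \<subseteq> pverts dodecahedron_graph \<times> pverts dodecahedron_graph"
  by (auto simp: dodecahedron_graph_def dodecahedron_edges_def)

lemma nbrs_dodecahedron:
  assumes "p \<in> set dodecahedron_verts"
  shows "nbrs dodecahedron_graph p = set (dodecahedron_nbrs p)"
proof -
  obtain a i where p: "p = (a, i)" "a = 0 \<or> a = 1" "i < 10"
    using assms by (auto simp: dodecahedron_verts_def)
  have *: "i = Suc j mod 10 \<and> j < 10 \<longleftrightarrow> j = (i + 9) mod 10"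
    "i = (j + 2) mod 10 \<and> j < 10 \<longleftrightarrow> j = (i + 8) mod 10" for j
    using eq_mod_shift_iff[OF p(3), of 1 j] eq_mod_shift_iff[OF p(3), of 2 j] by simp_all
  have "(b, j) \<in> nbrs dodecahedron_graph p \<longleftrightarrow> (b, j) \<in> set (dodecahedron_nbrs p)" for b j
    using p(2,3) *[of j]
    by (auto simp: p(1) nbrs_def dodecahedron_graph_def dodecahedron_edges_def)
  then show ?thesis by auto
qed

lemma pverts_icosahedron: "pverts icosahedron_graph = set icosahedron_verts"
  unfolding icosahedron_graph_def icosahedron_verts_def
  by (simp only: pair_pre_digraph.simps set_append set_product set_upt atLeast0LessThan list.set)

lemma wf_icosahedron:
  "parcs icosahedron_graph \<subseteq> pverts icosahedron_graph \<times> pverts icosahedron_graph"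
proof -
  have "icosahedron_edges \<subseteq> pverts icosahedron_graph \<times> pverts icosahedron_graph"
    unfolding icosahedron_edges_def icosahedron_graph_def 
    by (intro Un_least subsetI; elim CollectE exE conjE; simp)
  moreover have "parcs icosahedron_graph = icosahedron_edges \<union> icosahedron_edges\<inverse>"
    by (simp add: icosahedron_graph_def)
  ultimately show ?thesis by blast
qed

lemma nbrs_icosahedron:
  assumes "p \<in> set icosahedron_verts"
  shows "nbrs icosahedron_graph p = set (icosahedron_nbrs p)"
proof -
  obtain a i where p: "p = (a, i)" "a = 0 \<and> i = 0 \<or> a = 1 \<or> a = 2 \<or> a = 3 \<and> i = 0" "i < 5"
    using assms by (auto simp: icosahedron_verts_def)
  have *: "i = Suc j mod 5 \<and> j < 5 \<longleftrightarrow> j = (i + 4) mod 5" for j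
    using eq_mod_shift_iff[OF p(3), of 1 j] by simp
  have "(b, j) \<in> nbrs icosahedron_graph p \<longleftrightarrow> (b, j) \<in> set (icosahedron_nbrs p)" for b j
    using p(2,3) *[of j]
    by (auto simp: p(1) nbrs_def icosahedron_graph_def icosahedron_edges_def)
  then show ?thesis by auto
qed

lemma upt_5: "[0 ..< 5] = [0, 1, 2, 3, 4]" and upt_10: "[0 ..< 10] = [0, 1, 2, 3, 4, 5, 6, 7, 8, 9]"
  and upt_3: "[0 ..< 3] = [0, 1, 2]"
  by (simp_all add: upt_conv_Cons)

text \<open>Entry \<open>j\<close> repeats the levels \<open>j - 1\<close>, \<open>j\<close>,
  \<open>j + 1\<close> as often as the intersection numbers prescribe.\<close>

lemma level_dodecahedron:
  "level_graph dodecahedron_verts dodecahedron_nbrs (1, 0) dodecahedron_level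
     (\<lambda>j. [[1, 1, 1], [0, 2, 2], [1, 2, 3], [2, 3, 4], [3, 3, 5], [4, 4, 4]] ! j) 3"
  unfolding level_graph_def dodecahedron_verts_def upt_10 by simp

lemma level_icosahedron:
  "level_graph icosahedron_verts icosahedron_nbrs (0, 0) fst
     (\<lambda>j. [[1, 1, 1, 1, 1], [0, 1, 1, 2, 2], [1, 1, 2, 2, 3], [2, 2, 2, 2, 2]] ! j) 5"
  unfolding level_graph_def icosahedron_verts_def upt_5 by (simp add: upt_5)

lemma cube_verts: "set cube_verts = Pow {0, 1, 2}"
  unfolding cube_verts_def by code_simp

lemma pverts_cube: "pverts cube_graph = set cube_verts"
  by (simp add: cube_graph_def cube_verts)

lemma wf_cube: "parcs cube_graph \<subseteq> pverts cube_graph \<times> pverts cube_graph"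
  by (auto simp: cube_graph_def)

lemma nbrs_cube:
  assumes "A \<in> set cube_verts"
  shows "nbrs cube_graph A = set (cube_nbrs A)"
proof -
  have "nbrs cube_graph A = {B \<in> set cube_verts. card ((A - B) \<union> (B - A)) = 1}"
    using assms unfolding cube_verts by (simp add: nbrs_def cube_graph_def)
  also have "\<dots> = set (filter (\<lambda>B. card ((A - B) \<union> (B - A)) = 1) cube_verts)"
    by simp
  also have "\<forall>A\<in>set cube_verts.
      set (filter (\<lambda>B. card ((A - B) \<union> (B - A)) = 1) cube_verts) = set (cube_nbrs A)"
    unfolding cube_verts_def cube_nbrs_def by code_simp
  then have "set (filter (\<lambda>B. card ((A - B) \<union> (B - A)) = 1) cube_verts) = set (cube_nbrs A)"
    using assms by blast
  finally show ?thesis .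
qed

lemma cube_nbrs_simps:
  "cube_nbrs {} = [{0}, {1}, {2}]"
  "cube_nbrs {0} = [{}, {0, 1}, {0, 2}]"
  "cube_nbrs {1} = [{0, 1}, {}, {1, 2}]"
  "cube_nbrs {2} = [{0, 2}, {1, 2}, {}]"
  "cube_nbrs {0, 1} = [{1}, {0}, {0, 1, 2}]"
  "cube_nbrs {0, 2} = [{2}, {0, 1, 2}, {0}]"
  "cube_nbrs {1, 2} = [{0, 1, 2}, {2}, {1}]"
  "cube_nbrs {0, 1, 2} = [{1, 2}, {0, 2}, {0, 1}]"
  by (auto simp: cube_nbrs_def upt_3)

lemma level_cube:
  "level_graph cube_verts cube_nbrs {} card
     (\<lambda>j. [[1, 1, 1], [0, 2, 2], [1, 1, 3], [2, 2, 2]] ! j) 3"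
  unfolding level_graph_def cube_verts_def cube_nbrs_def by code_simp

section \<open>Locally pentagonal graphs\<close>

context represented_graph begin

text \<open>Counts \<open>x\<close> or \<open>y\<close> with all neighbours of one end of an edge
  and the two remaining neighbours of the other. It suffices for the size condition on coverings by
  the icosahedron and the cube.\<close>

lemma card_vertices_gt: "CARD('v) \<ge> k + 3"
proof -
  obtain x y where y: "y \<in> N x" by (rule ex_adjacent)
  then have x: "x \<in> N y" using N_sym by blast
  have "card (N y - N x - {x}) = 2" using card_nonadjacent[OF x] k_eq by simp
  then have "card ((N y - N x - {x}) \<union> insert x (N x)) = k + 3"
    using valency[of x] by (subst card_Un_disjoint) auto
  then show ?thesis by (metis card_mono finite subset_UNIV)
qed

text \<open>The neighbourhood induces a 2-regular graph on five vertices. A cycle closing too early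
  would leave too few vertices for another one, so it is a single 5-cycle, in the order
  \<open>y\<close>, \<open>s\<close>, \<open>v\<close>, \<open>w\<close>, \<open>t\<close>.\<close>

lemma local_pentagon:
  assumes "a\<^sub>1 = 2" and y: "y \<in> N x" "N x \<inter> N y = {s, t}" "s \<noteq> t"
  obtains v w where "N x = {y, s, t, v, w}" "distinct [y, s, t, v, w]"
    "N x \<inter> N s = {y, v}" "N x \<inter> N t = {y, w}" "N x \<inter> N v = {s, w}" "N x \<inter> N w = {t, v}"
proof -
  have two: "\<exists>q. q \<noteq> p \<and> N x \<inter> N z = {p, q}" if "z \<in> N x" "p \<in> N x" "p \<in> N z" for z p
  proof -
    have "card (N x \<inter> N z) = 2" using a\<^sub>1[OF that(1)] assms(1) by simp
    then obtain q q' where "N x \<inter> N z = {q, q'}" "q \<noteq> q'" by (auto simp: card_2_iff)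
    moreover have "p \<in> N x \<inter> N z" using that by simp
    ultimately show ?thesis by auto
  qed
  have st: "s \<in> N x" "t \<in> N x" "s \<in> N y" "t \<in> N y" using y(2) by auto
  then have sy: "y \<in> N s" "y \<in> N t" "s \<noteq> y" "t \<noteq> y" using N_sym by auto
  obtain v where v: "v \<noteq> y" "N x \<inter> N s = {y, v}" using two[OF st(1) y(1) sy(1)] by blast
  obtain w where w: "w \<noteq> y" "N x \<inter> N t = {y, w}" using two[OF st(2) y(1) sy(2)] by blast
  have vw: "v \<in> N x" "w \<in> N x" "v \<in> N s" "w \<in> N t" using v w by auto
  then have "v \<noteq> s" "w \<noteq> t" "s \<in> N v" "t \<in> N w" using N_sym by auto
  \<comment> \<open>\<open>S\<close> is a union of components missing at most two vertices; a missed
    vertex \<open>z\<close> would find at most one neighbour.\<close>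
  have stuck: False if z: "z \<in> N x" "z \<notin> S" and S: "card (N x - S) \<le> 2"
    and closed: "\<And>p. p \<in> S \<Longrightarrow> N x \<inter> N p \<subseteq> S" for S z
  proof -
    have "N x \<inter> N z \<subseteq> N x - S - {z}"
    proof
      fix p assume p: "p \<in> N x \<inter> N z"
      then have "z \<in> N p" "p \<noteq> z" using N_sym by auto
      then show "p \<in> N x - S - {z}" using closed[of p] z p by blast
    qed
    then have "card (N x \<inter> N z) \<le> card (N x - S - {z})" by (intro card_mono) auto
    moreover have "card (N x - S - {z}) = card (N x - S) - 1" using z by (simp add: card_Diff_singleton)
    ultimately show False using a\<^sub>1[OF z(1)] assms(1) S by simp
  qed
  \<comment> \<open>Equality would close the triangle \<open>y\<close>, \<open>s\<close>,
    \<open>t\<close>.\<close>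
  have "v \<noteq> t"
  proof
    assume "v = t"
    then have "s \<in> N t" using \<open>s \<in> N v\<close> by simp
    then have "N x \<inter> N t = {y, s}" using w sy st by auto
    then have closed: "N x \<inter> N z \<subseteq> {y, s, t}" if "z \<in> {y, s, t}" for z
      using that y(2) v(2) \<open>v = t\<close> by (elim insertE emptyE) simp_all
    have card: "card (N x - {y, s, t}) = 2"
      using sy y st valency[of x] k_eq assms(1) by (simp add: card_Diff_subset)
    then obtain z where "z \<in> N x" "z \<notin> {y, s, t}"
      by (metis Diff_iff card.empty ex_in_conv zero_neq_numeral)
    then show False using stuck[of z "{y, s, t}"] closed card by simp
  qed
  have "w \<noteq> s"
  proof
    assume "w = s"
    then have "t \<in> N x \<inter> N s" using \<open>t \<in> N w\<close> st by simp
    then show False using v sy \<open>v \<noteq> t\<close> by auto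
  qed
  \<comment> \<open>Equality would close the 4-cycle \<open>y\<close>, \<open>s\<close>,
    \<open>v\<close>, \<open>t\<close>.\<close>
  have "w \<noteq> v"
  proof
    assume "w = v"
    then have "{s, t} \<subseteq> N x \<inter> N v" using \<open>s \<in> N v\<close> \<open>t \<in> N w\<close> st by simp
    moreover have "card (N x \<inter> N v) = 2" using a\<^sub>1[OF vw(1)] assms(1) by simp
    ultimately have "N x \<inter> N v = {s, t}"
      using y(3) card_subset_eq[of "N x \<inter> N v" "{s, t}"] by simp
    then have closed: "N x \<inter> N z \<subseteq> {y, s, t, v}" if "z \<in> {y, s, t, v}" for z
      using that y(2) v(2) w(2) \<open>w = v\<close> by (elim insertE emptyE) simp_all
    have "card {y, s, t, v} = 4" "{y, s, t, v} \<subseteq> N x"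
      using sy y(1,3) v(1) st vw \<open>v \<noteq> t\<close> \<open>v \<noteq> s\<close> by auto
    then have card: "card (N x - {y, s, t, v}) = 1"
      using valency[of x] k_eq assms(1) by (simp add: card_Diff_subset)
    then obtain z where "z \<in> N x" "z \<notin> {y, s, t, v}"
      by (metis Diff_iff card.empty ex_in_conv zero_neq_one)
    then show False using stuck[of z "{y, s, t, v}"] closed card by simp
  qed
  have dist: "distinct [y, s, t, v, w]"
    using sy y(3) v(1) w(1) \<open>v \<noteq> t\<close> \<open>v \<noteq> s\<close> \<open>w \<noteq> t\<close> \<open>w \<noteq> s\<close> \<open>w \<noteq> v\<close> by simp
  have N_x: "N x = {y, s, t, v, w}"
  proof (rule card_subset_eq[symmetric])
    show "card {y, s, t, v, w} = card (N x)"
      using dist valency[of x] k_eq assms(1) by simp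
  qed (use y st vw in auto)
  have "N x \<inter> N v = {s, w}"
  proof -
    obtain q where q: "q \<noteq> s" "N x \<inter> N v = {s, q}" using two[OF vw(1) st(1) \<open>s \<in> N v\<close>] by blast
    then have "q \<in> N x" "v \<in> N q" using N_sym by auto
    have "v \<notin> N x \<inter> N y" "v \<notin> N x \<inter> N t" unfolding y(2) w(2) using dist by auto
    then have "q \<noteq> y" "q \<noteq> t" "q \<noteq> v" using vw(1) \<open>v \<in> N q\<close> by auto
    then have "q = w" using \<open>q \<in> N x\<close> \<open>q \<noteq> s\<close> unfolding N_x by simp
    then show ?thesis using q by simp
  qed
  moreover have "N x \<inter> N w = {t, v}"
  proof -
    obtain q where q: "q \<noteq> t" "N x \<inter> N w = {t, q}" using two[OF vw(2) st(2) \<open>t \<in> N w\<close>] by blast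
    then have "q \<in> N x" "w \<in> N q" using N_sym by auto
    have "w \<notin> N x \<inter> N y" "w \<notin> N x \<inter> N s" unfolding y(2) v(2) using dist by auto
    then have "q \<noteq> y" "q \<noteq> s" "q \<noteq> w" using vw(2) \<open>w \<in> N q\<close> by auto
    then have "q = v" using \<open>q \<in> N x\<close> \<open>q \<noteq> t\<close> unfolding N_x by simp
    then show ?thesis using q by simp
  qed
  ultimately show thesis using that[OF N_x dist] v(2) w(2) by simp
qed

text \<open>\<open>p\<close> runs around the pentagon at \<open>x\<close>, \<open>e i\<close> is the
  other common neighbour of \<open>p i\<close> and \<open>p (i + 1)\<close>, and \<open>r\<close> is
  the antipode of \<open>x\<close>. Indices are periodic modulo 5, so that \<open>i + 4\<close>
  means \<open>i - 1\<close>.\<close>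

lemma icosahedron_labelling:
  assumes "a\<^sub>1 = 2"
  obtains p e :: "nat \<Rightarrow> 'v" and r
  where "\<And>i. p (i + 5) = p i" "\<And>i. e (i + 5) = e i"
    and "N x = {p 0, p 1, p 2, p 3, p 4}"
    and "\<And>i. N (p i) = {x, p (i + 1), p (i + 4), e i, e (i + 4)}"
    and "\<And>i. N (e i) = {r, e (i + 1), e (i + 4), p i, p (i + 1)}"
    and "N r = {e 0, e 1, e 2, e 3, e 4}"
proof -
  obtain y where y: "y \<in> N x" using N_nonempty by blast
  have "card (N x \<inter> N y) = 2" using a\<^sub>1[OF y] assms by simp
  then obtain s t where st: "N x \<inter> N y = {s, t}" "s \<noteq> t" by (auto simp: card_2_iff)
  obtain v w where pent: "N x = {y, s, t, v, w}" "distinct [y, s, t, v, w]"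
    "N x \<inter> N s = {y, v}" "N x \<inter> N t = {y, w}" "N x \<inter> N v = {s, w}" "N x \<inter> N w = {t, v}"
    using local_pentagon[OF assms y st] by blast
  define p where "p i = [y, s, v, w, t] ! (i mod 5)" for i
  have p_per: "p (i + 5) = p i" for i by (simp add: p_def)
  have p_mod: "p (i mod 5) = p i" for i by (simp add: p_def)
  have p_vals: "p 0 = y" "p 1 = s" "p 2 = v" "p 3 = w" "p 4 = t"
    by (simp_all add: p_def)
  have mem: "y \<in> N x" "s \<in> N x" "t \<in> N x" "v \<in> N x" "w \<in> N x" using pent(1) by simp_all
  have cyc_lt: "N x \<inter> N (p j) = {p (j + 1), p (j + 4)} \<and> p j \<in> N x \<and> p (j + 1) \<noteq> p (j + 4)"
    if "j \<in> {0, 1, 2, 3, 4}" for j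
    using that pent(2) pent(2)[THEN distinct_rev[THEN iffD2]] unfolding distinct.simps rev.simps append.simps
    by (elim insertE emptyE) (simp_all add: p_def st(1) pent(3-6) mem insert_commute)
  have cyc: "N x \<inter> N (p i) = {p (i + 1), p (i + 4)}" "p i \<in> N x" "p (i + 1) \<noteq> p (i + 4)" for i
  proof -
    have "p (i mod 5 + 1) = p (i + 1)" "p (i mod 5 + 4) = p (i + 4)"
      by (simp_all add: p_def mod_simps)
    moreover have "i mod 5 \<in> {0, 1, 2, 3, 4}" by auto
    ultimately show "N x \<inter> N (p i) = {p (i + 1), p (i + 4)}" "p i \<in> N x" "p (i + 1) \<noteq> p (i + 4)"
      using cyc_lt[of "i mod 5"] p_mod[of i] by simp_all
  qed
  have adj: "p i \<in> N x" "x \<in> N (p i)" "p (i + 1) \<in> N (p i)" "p i \<in> N (p (i + 1))" for i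
  proof -
    show "p i \<in> N x" "x \<in> N (p i)" using cyc(2) N_sym by blast+
    have "p (i + 1) \<in> N x \<inter> N (p i)" unfolding cyc(1) by simp
    then show "p (i + 1) \<in> N (p i)" "p i \<in> N (p (i + 1))" using N_sym by blast+
  qed
  have "\<exists>e. e \<noteq> x \<and> N (p i) \<inter> N (p (i + 1)) = {x, e}" for i
  proof -
    have "card (N (p i) \<inter> N (p (i + 1))) = 2" using a\<^sub>1[OF adj(3)] assms by simp
    then obtain q q' where "N (p i) \<inter> N (p (i + 1)) = {q, q'}" "q \<noteq> q'" by (auto simp: card_2_iff)
    moreover have "x \<in> N (p i) \<inter> N (p (i + 1))" using adj by simp
    ultimately show ?thesis by (metis doubleton_eq_iff insertE singletonD)
  qed
  then obtain e where e: "\<And>i. e i \<noteq> x" "\<And>i. N (p i) \<inter> N (p (i + 1)) = {x, e i}" by metis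
  have e_per: "e (i + 5) = e i" for i
  proof -
    have "{x, e (i + 5)} = {x, e i}"
      using e(2)[of "i + 5"] e(2)[of i] p_per[of i] p_per[of "i + 1"] by (simp add: algebra_simps)
    then show ?thesis using e(1)[of i] e(1)[of "i + 5"] by (simp add: doubleton_eq_iff)
  qed
  \<comment> \<open>The pentagon around \<open>p i\<close> is \<open>x\<close>,
    \<open>p (i + 1)\<close>, \<open>e i\<close>, \<open>e (i + 4)\<close>,
    \<open>p (i + 4)\<close>.\<close>
  have at: "N (p i) = {x, p (i + 1), p (i + 4), e i, e (i + 4)}"
    "distinct [x, p (i + 1), p (i + 4), e i, e (i + 4)]"
    "N (p i) \<inter> N (e i) = {p (i + 1), e (i + 4)}" "N (p i) \<inter> N (e (i + 4)) = {p (i + 4), e i}" for i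
  proof -
    have "N (p i) \<inter> N x = {p (i + 1), p (i + 4)}" using cyc(1) by (simp add: Int_commute)
    then obtain v w where *: "N (p i) = {x, p (i + 1), p (i + 4), v, w}"
      "distinct [x, p (i + 1), p (i + 4), v, w]"
      "N (p i) \<inter> N (p (i + 1)) = {x, v}" "N (p i) \<inter> N (p (i + 4)) = {x, w}"
      "N (p i) \<inter> N v = {p (i + 1), w}" "N (p i) \<inter> N w = {p (i + 4), v}"
      using local_pentagon[OF assms adj(2) _ cyc(3)] by blast
    have "{x, v} = {x, e i}" using *(3) e(2)[of i] by simp
    then have "v = e i" using e(1)[of i] by (simp add: doubleton_eq_iff)
    moreover have "N (p i) \<inter> N (p (i + 4)) = {x, e (i + 4)}"
      using e(2)[of "i + 4"] p_per[of i] by (simp add: algebra_simps Int_commute)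
    then have "{x, w} = {x, e (i + 4)}" using *(4) by simp
    then have "w = e (i + 4)" using e(1)[of "i + 4"] by (simp add: doubleton_eq_iff)
    ultimately show "N (p i) = {x, p (i + 1), p (i + 4), e i, e (i + 4)}"
      "distinct [x, p (i + 1), p (i + 4), e i, e (i + 4)]"
      "N (p i) \<inter> N (e i) = {p (i + 1), e (i + 4)}"
      "N (p i) \<inter> N (e (i + 4)) = {p (i + 4), e i}"
      using *(1,2,5,6) by simp_all
  qed
  \<comment> \<open>The pentagon around \<open>e i\<close>, started at \<open>p i\<close>, leaves
    one unnamed vertex, which at first may depend on \<open>i\<close>.\<close>
  have "\<exists>r. N (e i) = {p i, p (i + 1), e (i + 4), e (i + 1), r} \<and>
      distinct [p i, p (i + 1), e (i + 4), e (i + 1), r] \<and>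
      N (e i) \<inter> N (e (i + 4)) = {p i, r} \<and> N (e i) \<inter> N (e (i + 1)) = {p (i + 1), r}" for i
  proof -
    have "e i \<in> N (p i)" unfolding at(1) by simp
    then have p_i: "p i \<in> N (e i)" using N_sym by blast
    have local: "N (e i) \<inter> N (p i) = {p (i + 1), e (i + 4)}" "p (i + 1) \<noteq> e (i + 4)"
      using at(3)[of i] at(2)[of i] by (simp_all add: Int_commute)
    obtain v w where *: "N (e i) = {p i, p (i + 1), e (i + 4), v, w}"
      "distinct [p i, p (i + 1), e (i + 4), v, w]"
      "N (e i) \<inter> N (p (i + 1)) = {p i, v}" "N (e i) \<inter> N (e (i + 4)) = {p i, w}"
      "N (e i) \<inter> N v = {p (i + 1), w}" "N (e i) \<inter> N w = {e (i + 4), v}"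
      by (rule local_pentagon[OF assms p_i local])
    have "N (p (i + 1)) \<inter> N (e (i + 5)) = {p (i + 5), e (i + 1)}"
      using at(4)[of "i + 1"] by (simp only: add.assoc) simp
    then have "N (e i) \<inter> N (p (i + 1)) = {p i, e (i + 1)}"
      unfolding e_per p_per by (simp add: Int_commute)
    then have "{p i, v} = {p i, e (i + 1)}" using *(3) by simp
    then have "v = e (i + 1)" using *(2) by (auto simp: doubleton_eq_iff)
    with * show ?thesis by (intro exI[of _ w]) simp
  qed
  then have "\<exists>r. \<forall>i. N (e i) = {p i, p (i + 1), e (i + 4), e (i + 1), r i} \<and>
      distinct [p i, p (i + 1), e (i + 4), e (i + 1), r i] \<and>
      N (e i) \<inter> N (e (i + 4)) = {p i, r i} \<and> N (e i) \<inter> N (e (i + 1)) = {p (i + 1), r i}"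
    by (intro choice allI)
  then obtain r where "\<forall>i. N (e i) = {p i, p (i + 1), e (i + 4), e (i + 1), r i} \<and>
      distinct [p i, p (i + 1), e (i + 4), e (i + 1), r i] \<and>
      N (e i) \<inter> N (e (i + 4)) = {p i, r i} \<and> N (e i) \<inter> N (e (i + 1)) = {p (i + 1), r i}"
    by (elim exE)
  note r = this[THEN spec, THEN conjunct1] this[THEN spec, THEN conjunct2, THEN conjunct1]
    this[THEN spec, THEN conjunct2, THEN conjunct2, THEN conjunct1]
    this[THEN spec, THEN conjunct2, THEN conjunct2, THEN conjunct2]
  \<comment> \<open>Both are the common neighbour of \<open>e i\<close> and \<open>e (i + 1)\<close>
    other than \<open>p (i + 1)\<close>.\<close>
  have r_Suc: "r (i + 1) = r i" for i
  proof -
    have "N (e (i + 1)) \<inter> N (e (i + 5)) = {p (i + 1), r (i + 1)}"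
      using r(3)[of "i + 1"] by (simp add: add.commute)
    then have "{p (i + 1), r (i + 1)} = {p (i + 1), r i}"
      using r(4)[of i] unfolding e_per by (simp add: Int_commute)
    then show ?thesis using r(2)[of i] by (auto simp: doubleton_eq_iff)
  qed
  have r_eq: "r i = r 0" for i
    by (induction i) (use r_Suc in auto)
  have e_ne: "e i \<noteq> e (i + 1)" "e i \<noteq> e (i + 2)" for i
  proof -
    have "e (i + 1) \<noteq> e (i + 5)" using at(2)[of "i + 1"] by (simp add: add.commute)
    then show "e i \<noteq> e (i + 1)" unfolding e_per by simp
    have "e (i + 5) \<noteq> e (i + 2)" using r(2)[of "i + 1"] by (simp add: add.commute)
    then show "e i \<noteq> e (i + 2)" unfolding e_per by simp
  qed
  have dist: "distinct [e 0, e 1, e 2, e 3, e 4]"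
    using e_ne(1)[of 0] e_ne(1)[of 1] e_ne(1)[of 2] e_ne(1)[of 3] e_ne(1)[of 4]
      e_ne(2)[of 0] e_ne(2)[of 1] e_ne(2)[of 2] e_ne(2)[of 3] e_ne(2)[of 4]
      e_per[of 0] e_per[of 1] by (auto simp: eval_nat_numeral)
  have e_r: "e i \<in> N (r 0)" for i
    using r(1)[of i] r_eq[of i] N_sym[of "r 0" "e i"] by simp
  have "N (r 0) = {e 0, e 1, e 2, e 3, e 4}"
  proof (rule card_subset_eq[symmetric])
    show "card {e 0, e 1, e 2, e 3, e 4} = card (N (r 0))"
      using dist valency k_eq assms by simp
  qed (use e_r in auto)
  moreover have "N (e i) = {r 0, e (i + 1), e (i + 4), p i, p (i + 1)}" for i
    using r(1)[of i] r_eq[of i] by (simp add: insert_commute)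
  moreover have "N x = {p 0, p 1, p 2, p 3, p 4}"
    unfolding p_vals pent(1) by (simp add: insert_commute)
  moreover have "N (p i) = {x, p (i + 1), p (i + 4), e i, e (i + 4)}" for i by (rule at(1))
  ultimately show thesis using that[of p e "r 0"] p_per e_per by blast
qed

lemma icosahedron:
  assumes "a\<^sub>1 = 2"
  shows "distance_regular G \<and> digraph_iso (with_proj G) (with_proj icosahedron_graph)"
proof (rule level_graph_covering[OF pverts_icosahedron nbrs_icosahedron wf_icosahedron level_icosahedron])
  show "card (N x) = 5" for x using valency k_eq assms by simp
  show "length icosahedron_verts < 2 * CARD('v)"
    using card_vertices_gt k_eq assms by (simp add: icosahedron_verts_def)
  show "\<exists>f. f (0, 0) = x \<and> (\<forall>p\<in>set icosahedron_verts. f ` set (icosahedron_nbrs p) = N (f p))" for x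
  proof -
    obtain p e :: "nat \<Rightarrow> 'v" and r where per: "\<And>i. p (i + 5) = p i" "\<And>i. e (i + 5) = e i"
      and N: "N x = {p 0, p 1, p 2, p 3, p 4}"
        "\<And>i. N (p i) = {x, p (i + 1), p (i + 4), e i, e (i + 4)}"
        "\<And>i. N (e i) = {r, e (i + 1), e (i + 4), p i, p (i + 1)}"
        "N r = {e 0, e 1, e 2, e 3, e 4}"
      using icosahedron_labelling[OF assms, of x] by blast
    have per': "p 5 = p 0" "p 6 = p 1" "p 7 = p 2" "p 8 = p 3"
      "e 5 = e 0" "e 6 = e 1" "e 7 = e 2" "e 8 = e 3"
      using per(1)[of 0] per(1)[of 1] per(1)[of 2] per(1)[of 3]
        per(2)[of 0] per(2)[of 1] per(2)[of 2] per(2)[of 3] by simp_all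
    \<comment> \<open>\<open>(2, i)\<close> is adjacent to \<open>(1, i)\<close> and
      \<open>(1, i - 1)\<close> in the model, while \<open>e i\<close> is adjacent to
      \<open>p i\<close> and \<open>p (i + 1)\<close>; this explains the shift by 4.\<close>
    define f where "f v = (if fst v = 0 then x else if fst v = 3 then r
      else if fst v = 1 then p (snd v) else e (snd v + 4))" for v :: "nat \<times> nat"
    have "f ` set (icosahedron_nbrs v) = N (f v)" if "v \<in> set icosahedron_verts" for v
      using that unfolding icosahedron_verts_def upt_5
      by (simp, elim disjE)
        (simp_all add: f_def upt_5 N(1,4) N(2)[of 0] N(2)[of 1] N(2)[of 2] N(2)[of 3] N(2)[of 4]
          N(3)[of 0] N(3)[of 1] N(3)[of 2] N(3)[of 3] N(3)[of 4] per' insert_commute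
          One_nat_def[symmetric] del: One_nat_def)
    then show ?thesis by (intro exI[of _ f]) (simp add: f_def)
  qed
qed

end

section \<open>Cubic graphs\<close>

locale triangle_free_represented_graph = represented_graph G u k a\<^sub>1 c\<^sub>2 \<theta> \<omega>\<^sub>1 \<omega>\<^sub>2
  for G :: "'v::finite pair_pre_digraph" and u k a\<^sub>1 c\<^sub>2 \<theta> \<omega>\<^sub>1 \<omega>\<^sub>2 +
  assumes a\<^sub>1_eq_0: "a\<^sub>1 = 0"
begin

lemma cubic: "k = 3" "card (N x) = 3"
  using k_eq a\<^sub>1_eq_0 valency by simp_all

lemma N_symD: "y \<in> N x \<Longrightarrow> x \<in> N y"
  using N_sym by blast

lemma no_triangle: "y \<in> N x \<Longrightarrow> z \<in> N x \<Longrightarrow> z \<in> N y \<Longrightarrow> False"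
proof -
  assume yz: "y \<in> N x" "z \<in> N x" "z \<in> N y"
  have "N x \<inter> N y = {}" using a\<^sub>1[OF yz(1)] a\<^sub>1_eq_0 by simp
  with yz show False by blast
qed

lemma third_neighbour:
  assumes "v \<in> N y" "w \<in> N y" "v \<noteq> w"
  obtains t where "N y = {v, w, t}" "t \<noteq> v" "t \<noteq> w"
proof -
  have "card (N y - {v, w}) = 1" using assms cubic(2)[of y] by (simp add: card_Diff_subset)
  then obtain t where t: "N y - {v, w} = {t}" by (auto simp: card_1_singleton_iff)
  show thesis
  proof (rule that)
    show "N y = {v, w, t}" using t assms by blast
  qed (use t in auto)
qed

lemma N_eqI:
  assumes "t \<in> N y" "v \<in> N y" "w \<in> N y" "t \<noteq> v" "t \<noteq> w" "v \<noteq> w"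
  shows "N y = {t, v, w}"
proof (rule card_subset_eq[symmetric])
  show "card {t, v, w} = card (N y)" using assms cubic(2) by simp
qed (use assms in auto)

lemma dist_2: "v \<in> N y \<Longrightarrow> w \<in> N y \<Longrightarrow> v \<noteq> w \<Longrightarrow> d v w = 2"
  using dist_2_in_N no_triangle by blast

lemma c\<^sub>2_cases: "c\<^sub>2 = 1 \<or> c\<^sub>2 = 2 \<or> c\<^sub>2 = 3"
proof -
  fix y
  have "card (N y) = 3" by (rule cubic)
  then obtain v w t where N_y: "N y = {v, w, t}" "v \<noteq> w" by (auto simp: card_3_iff)
  then have vw: "v \<in> N y" "w \<in> N y" by simp_all
  then have "d v w = 2" using dist_2 N_y(2) by blast
  then have c: "card (N v \<inter> N w) = c\<^sub>2" by (rule c\<^sub>2)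
  have "y \<in> N v \<inter> N w" using vw N_symD by simp
  then have "c\<^sub>2 > 0" using c by (metis card_gt_0_iff empty_iff finite)
  moreover have "c\<^sub>2 \<le> card (N v)" using c by (metis Int_lower1 card_mono finite)
  ultimately show ?thesis using cubic(2)[of v] by auto
qed

text \<open>In a cubic graph three common neighbours mean equal neighbourhoods, so vertices at
  distance 2 would be twins.\<close>

lemma c\<^sub>2_ne_3: "c\<^sub>2 \<noteq> 3"
proof
  assume "c\<^sub>2 = 3"
  have "N x = N y" if "d x y = 2" for x y
  proof -
    have "card (N x \<inter> N y) = 3" using c\<^sub>2[OF that] \<open>c\<^sub>2 = 3\<close> by simp
    then have "N x \<inter> N y = N x" "N x \<inter> N y = N y"
      using card_subset_eq[of "N x" "N x \<inter> N y"] card_subset_eq[of "N y" "N x \<inter> N y"]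
      by (simp_all only: cubic(2)) auto
    then show ?thesis by simp
  qed
  then have "complete_multipartite G" by (rule complete_multipartite_if_twins)
  then show False using not_multipartite by simp
qed

text \<open>The differences \<open>u w - u w'\<close> and \<open>u z - u z'\<close>, where \<open>z'\<close> is the third neighbour of \<open>x\<close>, are
  both orthogonal to \<open>u x\<close> and \<open>u y\<close>, hence parallel.\<close>

lemma inner_across_edge:
  assumes "y \<in> N x" "z \<in> N x" "z \<noteq> y" "w \<in> N y" "w' \<in> N y" "w \<noteq> x" "w' \<noteq> x" "w \<noteq> w'"
  shows "u w \<bullet> u z \<noteq> u w' \<bullet> u z"
proof
  assume eq: "u w \<bullet> u z = u w' \<bullet> u z"
  obtain z' where z': "N x = {y, z, z'}" "z' \<noteq> y" "z' \<noteq> z"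
    using third_neighbour[OF assms(1,2)] assms(3) by metis
  have N: "z' \<in> N x" "x \<in> N y" using z'(1) assms(1) N_symD by simp_all
  define g where "g = u w - u w'"
  define h where "h = u z - u z'"
  have "u w \<bullet> u x = \<omega>\<^sub>2" "u w' \<bullet> u x = \<omega>\<^sub>2" "u z \<bullet> u y = \<omega>\<^sub>2" "u z' \<bullet> u y = \<omega>\<^sub>2"
    using inner_2 dist_2 assms N z'(2) by simp_all
  moreover have "u y \<bullet> u w = \<omega>\<^sub>1" "u y \<bullet> u w' = \<omega>\<^sub>1" "u x \<bullet> u z = \<omega>\<^sub>1" "u x \<bullet> u z' = \<omega>\<^sub>1"
    using inner_1 assms N by simp_all
  ultimately have gh: "g \<bullet> u x = 0" "g \<bullet> u y = 0" "h \<bullet> u x = 0" "h \<bullet> u y = 0"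
    by (simp_all add: g_def h_def inner_diff_left inner_commute[of "u x"] inner_commute[of "u y"])
  have "u y + u z + u z' = \<theta> *\<^sub>R u x"
    using sum_u[of x] z' assms(3) by (simp add: add.assoc)
  \<comment> \<open>Eliminating \<open>u z'\<close> turns \<open>g \<bullet> h\<close> into
    \<open>2 * (g \<bullet> u z)\<close>, which vanishes under the assumed equality, although
    \<open>g\<close> and \<open>h\<close> are parallel and nonzero.\<close>
  then have "u z' = \<theta> *\<^sub>R u x - u y - u z" by (simp add: algebra_simps)
  then have "g \<bullet> u z' = - (g \<bullet> u z)" using gh(1,2) by (simp add: inner_diff_right)
  then have "g \<bullet> h = 2 * (g \<bullet> u z)" by (simp add: h_def inner_diff_right)
  also have "\<dots> = 0" using eq by (simp add: g_def inner_diff_left)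
  finally have "g = 0 \<or> h = 0"
    using orthogonal_in_line[OF cross3_adjacent[OF assms(1)]] gh by blast
  moreover have "g \<noteq> 0" using inj_onD[OF inj_on_u, of w w' y] assms by (auto simp: g_def)
  moreover have "h \<noteq> 0" using inj_onD[OF inj_on_u, of z z' x] assms N z' by (auto simp: h_def)
  ultimately show False by blast
qed

text \<open>Distinctness need not be required: a closed walk of length 5 in a triangle-free graph is a
  5-cycle.\<close>

definition pentagon :: "'v \<Rightarrow> 'v \<Rightarrow> 'v \<Rightarrow> 'v \<Rightarrow> 'v \<Rightarrow> bool" where
  "pentagon s t v w z \<longleftrightarrow>
     t \<in> nbrs G s \<and> v \<in> nbrs G t \<and> w \<in> nbrs G v \<and> z \<in> nbrs G w \<and> s \<in> nbrs G z"

lemma pentagon_rotate: "pentagon s t v w z \<Longrightarrow> pentagon t v w z s"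
  by (simp add: pentagon_def)

lemma pentagon_reverse: "pentagon s t v w z \<Longrightarrow> pentagon z w v t s"
  by (simp add: pentagon_def N_symD)

lemma pentagonD:
  assumes "pentagon s t v w z"
  shows "t \<in> N s" "v \<in> N t" "w \<in> N v" "z \<in> N w" "s \<in> N z"
    "s \<in> N t" "t \<in> N v" "v \<in> N w" "w \<in> N z" "z \<in> N s"
  using assms pentagon_reverse[OF assms] unfolding pentagon_def by blast+

lemma pentagon_ne: "pentagon s t v w z \<Longrightarrow> s \<noteq> v"
proof
  assume "pentagon s t v w z" "s = v"
  then have "w \<in> N s" "z \<in> N s" "z \<in> N w" by (auto simp: pentagon_def intro: N_symD)
  then show False by (rule no_triangle)
qed

lemma pentagon_distinct:
  assumes "pentagon s t v w z"
  shows "distinct [s, t, v, w, z]"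
proof -
  note r = assms assms[THEN pentagon_rotate] assms[THEN pentagon_rotate, THEN pentagon_rotate]
    assms[THEN pentagon_rotate, THEN pentagon_rotate, THEN pentagon_rotate]
    assms[THEN pentagon_rotate, THEN pentagon_rotate, THEN pentagon_rotate, THEN pentagon_rotate]
  have "s \<noteq> t" "t \<noteq> v" "v \<noteq> w" "w \<noteq> z" "s \<noteq> z"
    using assms N_neq by (auto simp: pentagon_def)
  with r[THEN pentagon_ne] show ?thesis by auto
qed

section \<open>The case \<open>c\<^sub>2 = 2\<close>: the cube\<close>

context
  assumes c\<^sub>2_eq_2: "c\<^sub>2 = 2"
begin

lemma second_common_neighbour:
  assumes "v \<in> N x" "w \<in> N x" "v \<noteq> w"
  obtains z where "N v \<inter> N w = {x, z}" "z \<noteq> x"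
proof -
  have "card (N v \<inter> N w) = 2" using c\<^sub>2[OF dist_2[OF assms]] c\<^sub>2_eq_2 by simp
  moreover have "x \<in> N v \<inter> N w" using assms N_symD by blast
  ultimately have "card (N v \<inter> N w - {x}) = 1" by simp
  then obtain z where "N v \<inter> N w - {x} = {z}" by (auto simp: card_1_singleton_iff)
  with \<open>x \<in> N v \<inter> N w\<close> show thesis using that[of z] by blast
qed

lemma common_neighbours_2:
  assumes "p \<in> N v" "p \<in> N w" "q \<in> N v" "q \<in> N w" "r \<in> N v" "r \<in> N w" "v \<noteq> w" "p \<noteq> q"
  shows "r = p \<or> r = q"
proof (rule ccontr)
  assume *: "\<not> ?thesis"
  have "card {p, q, r} \<le> card (N v \<inter> N w)" using assms by (intro card_mono) auto
  moreover have "d v w = 2" using assms N_symD dist_2 by metis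
  ultimately show False using * assms(8) c\<^sub>2[of v w] c\<^sub>2_eq_2 by auto
qed

text \<open>Here \<open>z\<^sub>1\<close> and \<open>z\<^sub>2\<close> are two of the vertices at distance 2 from \<open>x\<close>, and \<open>w\<close> is the
  antipode of \<open>x\<close>.\<close>

lemma cube_antipode:
  assumes N_x: "N x = {y\<^sub>0, y\<^sub>1, y\<^sub>2}" "distinct [y\<^sub>0, y\<^sub>1, y\<^sub>2]"
    and z: "z\<^sub>1 \<in> N y\<^sub>0" "z\<^sub>1 \<in> N y\<^sub>1" "z\<^sub>1 \<noteq> x" "z\<^sub>2 \<in> N y\<^sub>0" "z\<^sub>2 \<in> N y\<^sub>2" "z\<^sub>2 \<noteq> x"
  obtains w where "z\<^sub>1 \<noteq> z\<^sub>2" "N z\<^sub>1 = {y\<^sub>0, y\<^sub>1, w}" "N z\<^sub>2 = {y\<^sub>0, y\<^sub>2, w}" "w \<noteq> y\<^sub>0" "w \<noteq> y\<^sub>1" "w \<noteq> y\<^sub>2"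
    "N y\<^sub>0 = {x, z\<^sub>1, z\<^sub>2}"
proof -
  have y: "y\<^sub>0 \<in> N x" "y\<^sub>1 \<in> N x" "y\<^sub>2 \<in> N x" "y\<^sub>0 \<noteq> y\<^sub>1" "y\<^sub>0 \<noteq> y\<^sub>2" "y\<^sub>1 \<noteq> y\<^sub>2" using N_x by simp_all
  have x: "x \<in> N y\<^sub>0" "x \<in> N y\<^sub>1" "x \<in> N y\<^sub>2" using y N_symD by blast+
  \<comment> \<open>Otherwise \<open>x\<close> and \<open>z\<close> would share three
    neighbours.\<close>
  have not_all: "\<not> (y\<^sub>0 \<in> N z \<and> y\<^sub>1 \<in> N z \<and> y\<^sub>2 \<in> N z)" if "z \<noteq> x" for z
    using common_neighbours_2[of y\<^sub>0 x z y\<^sub>1 y\<^sub>2] y that by blast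
  have zy: "y\<^sub>0 \<in> N z\<^sub>1" "y\<^sub>1 \<in> N z\<^sub>1" "y\<^sub>0 \<in> N z\<^sub>2" "y\<^sub>2 \<in> N z\<^sub>2" using z N_symD by blast+
  have not: "y\<^sub>2 \<notin> N z\<^sub>1" "y\<^sub>1 \<notin> N z\<^sub>2" using not_all[OF z(3)] not_all[OF z(6)] zy by blast+
  then have ne: "z\<^sub>1 \<noteq> z\<^sub>2" using zy by auto
  obtain w where w: "N z\<^sub>1 = {y\<^sub>0, y\<^sub>1, w}" "w \<noteq> y\<^sub>0" "w \<noteq> y\<^sub>1"
    using third_neighbour[OF zy(1,2) y(4)] by blast
  obtain w' where w': "N z\<^sub>2 = {y\<^sub>0, y\<^sub>2, w'}" "w' \<noteq> y\<^sub>0" "w' \<noteq> y\<^sub>2"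
    using third_neighbour[OF zy(3,4) y(5)] by blast
  \<comment> \<open>The second common neighbour of \<open>z\<^sub>1\<close> and
    \<open>z\<^sub>2\<close> must be the third neighbour of both, so the two third neighbours
    agree.\<close>
  obtain t where t: "N z\<^sub>1 \<inter> N z\<^sub>2 = {y\<^sub>0, t}" "t \<noteq> y\<^sub>0"
    using second_common_neighbour[OF z(1,4) ne] by blast
  then have "t \<in> N z\<^sub>1" "t \<in> N z\<^sub>2" by auto
  then have "t = w" "t = w'" using not t(2) unfolding w(1) w'(1) by auto
  then have "w' = w" by simp
  have "N y\<^sub>0 = {x, z\<^sub>1, z\<^sub>2}" using N_eqI[OF x(1) z(1,4)] z(3,6) ne by simp
  then show thesis using that[OF ne w(1) w'(1)[unfolded \<open>w' = w\<close>]] w w' \<open>w' = w\<close> by simp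
qed

text \<open>\<open>cube_antipode\<close> at each neighbour of \<open>x\<close> handles two of the
  three vertices at distance 2. The antipodes \<open>w\<close> and \<open>w'\<close> agree as the
  third neighbour of \<open>z\<^sub>0\<^sub>1\<close>.\<close>

lemma cube_labelling:
  obtains y\<^sub>0 y\<^sub>1 y\<^sub>2 z\<^sub>0\<^sub>1 z\<^sub>0\<^sub>2 z\<^sub>1\<^sub>2 w where "N x = {y\<^sub>0, y\<^sub>1, y\<^sub>2}" "N y\<^sub>0 = {x, z\<^sub>0\<^sub>1, z\<^sub>0\<^sub>2}" "N y\<^sub>1 = {x, z\<^sub>0\<^sub>1, z\<^sub>1\<^sub>2}"
    "N y\<^sub>2 = {x, z\<^sub>0\<^sub>2, z\<^sub>1\<^sub>2}" "N z\<^sub>0\<^sub>1 = {y\<^sub>0, y\<^sub>1, w}" "N z\<^sub>0\<^sub>2 = {y\<^sub>0, y\<^sub>2, w}" "N z\<^sub>1\<^sub>2 = {y\<^sub>1, y\<^sub>2, w}"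
    "N w = {z\<^sub>0\<^sub>1, z\<^sub>0\<^sub>2, z\<^sub>1\<^sub>2}"
proof -
  have "card (N x) = 3" by (rule cubic)
  then obtain y\<^sub>0 y\<^sub>1 y\<^sub>2 where N_x: "N x = {y\<^sub>0, y\<^sub>1, y\<^sub>2}" "distinct [y\<^sub>0, y\<^sub>1, y\<^sub>2]"
    by (auto simp: card_3_iff)
  then have y: "y\<^sub>0 \<in> N x" "y\<^sub>1 \<in> N x" "y\<^sub>2 \<in> N x" "y\<^sub>0 \<noteq> y\<^sub>1" "y\<^sub>0 \<noteq> y\<^sub>2" "y\<^sub>1 \<noteq> y\<^sub>2" by simp_all
  obtain z\<^sub>0\<^sub>1 where z01: "N y\<^sub>0 \<inter> N y\<^sub>1 = {x, z\<^sub>0\<^sub>1}" "z\<^sub>0\<^sub>1 \<noteq> x" using second_common_neighbour[OF y(1,2,4)] .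
  obtain z\<^sub>0\<^sub>2 where z02: "N y\<^sub>0 \<inter> N y\<^sub>2 = {x, z\<^sub>0\<^sub>2}" "z\<^sub>0\<^sub>2 \<noteq> x" using second_common_neighbour[OF y(1,3,5)] .
  obtain z\<^sub>1\<^sub>2 where z12: "N y\<^sub>1 \<inter> N y\<^sub>2 = {x, z\<^sub>1\<^sub>2}" "z\<^sub>1\<^sub>2 \<noteq> x" using second_common_neighbour[OF y(2,3,6)] .
  have z: "z\<^sub>0\<^sub>1 \<in> N y\<^sub>0" "z\<^sub>0\<^sub>1 \<in> N y\<^sub>1" "z\<^sub>0\<^sub>2 \<in> N y\<^sub>0" "z\<^sub>0\<^sub>2 \<in> N y\<^sub>2" "z\<^sub>1\<^sub>2 \<in> N y\<^sub>1" "z\<^sub>1\<^sub>2 \<in> N y\<^sub>2"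
    using z01(1) z02(1) z12(1) by blast+
  obtain w where w: "z\<^sub>0\<^sub>1 \<noteq> z\<^sub>0\<^sub>2" "N z\<^sub>0\<^sub>1 = {y\<^sub>0, y\<^sub>1, w}" "N z\<^sub>0\<^sub>2 = {y\<^sub>0, y\<^sub>2, w}"
    "w \<noteq> y\<^sub>0" "w \<noteq> y\<^sub>1" "w \<noteq> y\<^sub>2" "N y\<^sub>0 = {x, z\<^sub>0\<^sub>1, z\<^sub>0\<^sub>2}"
    by (rule cube_antipode[OF N_x z(1,2) z01(2) z(3,4) z02(2)])
  have N_x1: "N x = {y\<^sub>1, y\<^sub>0, y\<^sub>2}" "distinct [y\<^sub>1, y\<^sub>0, y\<^sub>2]" using N_x by (auto simp: insert_commute)
  obtain w' where w': "z\<^sub>0\<^sub>1 \<noteq> z\<^sub>1\<^sub>2" "N z\<^sub>0\<^sub>1 = {y\<^sub>1, y\<^sub>0, w'}" "N z\<^sub>1\<^sub>2 = {y\<^sub>1, y\<^sub>2, w'}"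
    "w' \<noteq> y\<^sub>1" "w' \<noteq> y\<^sub>0" "w' \<noteq> y\<^sub>2" "N y\<^sub>1 = {x, z\<^sub>0\<^sub>1, z\<^sub>1\<^sub>2}"
    by (rule cube_antipode[OF N_x1 z(2,1) z01(2) z(5,6) z12(2)])
  have N_x2: "N x = {y\<^sub>2, y\<^sub>0, y\<^sub>1}" "distinct [y\<^sub>2, y\<^sub>0, y\<^sub>1]" using N_x by (auto simp: insert_commute)
  obtain w'' where w'': "z\<^sub>0\<^sub>2 \<noteq> z\<^sub>1\<^sub>2" "N z\<^sub>0\<^sub>2 = {y\<^sub>2, y\<^sub>0, w''}" "N z\<^sub>1\<^sub>2 = {y\<^sub>2, y\<^sub>1, w''}"
    "w'' \<noteq> y\<^sub>2" "w'' \<noteq> y\<^sub>0" "w'' \<noteq> y\<^sub>1" "N y\<^sub>2 = {x, z\<^sub>0\<^sub>2, z\<^sub>1\<^sub>2}"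
    by (rule cube_antipode[OF N_x2 z(4,3) z02(2) z(6,5) z12(2)])
  have "w' \<in> N z\<^sub>0\<^sub>1" unfolding w'(2) by simp
  then have "w' = w" unfolding w(2) using w'(4,5) by simp
  have N_z12: "N z\<^sub>1\<^sub>2 = {y\<^sub>1, y\<^sub>2, w}" using w'(3) \<open>w' = w\<close> by simp
  have "w \<in> N z\<^sub>0\<^sub>1" "w \<in> N z\<^sub>0\<^sub>2" "w \<in> N z\<^sub>1\<^sub>2" unfolding w(2,3) N_z12 by simp_all
  then have "z\<^sub>0\<^sub>1 \<in> N w" "z\<^sub>0\<^sub>2 \<in> N w" "z\<^sub>1\<^sub>2 \<in> N w" by (simp_all add: N_symD)
  then have "N w = {z\<^sub>0\<^sub>1, z\<^sub>0\<^sub>2, z\<^sub>1\<^sub>2}" using N_eqI w(1) w'(1) w''(1) by simp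
  then show thesis by (rule that[OF N_x(1) w(7) w'(7) w''(7) w(2,3) N_z12])
qed

lemma cube: "distance_regular G \<and> digraph_iso (with_proj G) (with_proj cube_graph)"
proof (rule level_graph_covering[OF pverts_cube nbrs_cube wf_cube level_cube])
  show "card (N x) = 3" for x by (rule cubic)
  show "length cube_verts < 2 * CARD('v)"
    using card_vertices_gt cubic(1) by (simp add: cube_verts_def)
  show "\<exists>f. f {} = x \<and> (\<forall>p\<in>set cube_verts. f ` set (cube_nbrs p) = N (f p))" for x
  proof -
    obtain y\<^sub>0 y\<^sub>1 y\<^sub>2 z\<^sub>0\<^sub>1 z\<^sub>0\<^sub>2 z\<^sub>1\<^sub>2 w where N: "N x = {y\<^sub>0, y\<^sub>1, y\<^sub>2}" "N y\<^sub>0 = {x, z\<^sub>0\<^sub>1, z\<^sub>0\<^sub>2}"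
      "N y\<^sub>1 = {x, z\<^sub>0\<^sub>1, z\<^sub>1\<^sub>2}" "N y\<^sub>2 = {x, z\<^sub>0\<^sub>2, z\<^sub>1\<^sub>2}" "N z\<^sub>0\<^sub>1 = {y\<^sub>0, y\<^sub>1, w}" "N z\<^sub>0\<^sub>2 = {y\<^sub>0, y\<^sub>2, w}"
      "N z\<^sub>1\<^sub>2 = {y\<^sub>1, y\<^sub>2, w}" "N w = {z\<^sub>0\<^sub>1, z\<^sub>0\<^sub>2, z\<^sub>1\<^sub>2}"
      by (rule cube_labelling)
    define f where "f A = (if 0 \<in> A then if 1 \<in> A then if 2 \<in> A then w else z\<^sub>0\<^sub>1
        else if 2 \<in> A then z\<^sub>0\<^sub>2 else y\<^sub>0
      else if 1 \<in> A then if 2 \<in> A then z\<^sub>1\<^sub>2 else y\<^sub>1 else if 2 \<in> A then y\<^sub>2 else x)" for A :: "nat set"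
    have "f ` set (cube_nbrs p) = N (f p)" if "p \<in> set cube_verts" for p
      using that unfolding cube_verts_def
      by (simp, elim disjE)
        (simp_all add: f_def cube_nbrs_simps[unfolded One_nat_def] N insert_commute)
    then show ?thesis by (intro exI[of _ f]) (simp add: f_def)
  qed
qed

end

section \<open>The case \<open>c\<^sub>2 = 1\<close> with \<open>a\<^sub>2 = 1\<close>: the
  dodecahedron\<close>

context
  assumes c\<^sub>2_eq_1: "c\<^sub>2 = 1"
begin

lemma common_neighbour_eq:
  assumes "p \<in> N v" "p \<in> N w" "q \<in> N v" "q \<in> N w" "v \<noteq> w"
  shows "p = q"
proof -
  have "d v w = 2" using assms N_symD dist_2 by metis
  then have "card (N v \<inter> N w) = 1" using c\<^sub>2 c\<^sub>2_eq_1 by simp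
  then show ?thesis using assms card_le_Suc0_iff_eq[of "N v \<inter> N w"] by simp
qed

context
  assumes a\<^sub>2_eq_1: "\<And>x y. d x y = 2 \<Longrightarrow> card (nbrs_at G 2 x y) = 1"
begin

lemma pentagon_dist_2:
  assumes "pentagon s t v w z"
  shows "d s v = 2" "w \<in> nbrs_at G 2 s v"
proof -
  have "distinct [s, t, v, w, z]" by (rule pentagon_distinct[OF assms])
  then show "d s v = 2" "w \<in> nbrs_at G 2 s v"
    using dist_2[of s t v] dist_2[of s z w] pentagonD[OF assms] by (simp_all add: nbrs_at_def)
qed

text \<open>\<open>w\<close> is the only neighbour of \<open>v\<close> at distance 2 from
  \<open>s\<close>, and \<open>z\<close> the only common neighbour of \<open>s\<close> and
  \<open>w\<close>.\<close>

lemma pentagon_unique: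
  assumes "pentagon s t v w z" "pentagon s t v w' z'"
  shows "w = w'" "z = z'"
proof -
  have "card (nbrs_at G 2 s v) = 1" by (rule a\<^sub>2_eq_1[OF pentagon_dist_2(1)[OF assms(1)]])
  then obtain q where "nbrs_at G 2 s v = {q}" by (auto simp: card_1_singleton_iff)
  then show "w = w'" using pentagon_dist_2(2)[OF assms(1)] pentagon_dist_2(2)[OF assms(2)] by simp
  have "distinct [s, t, v, w, z]" by (rule pentagon_distinct[OF assms(1)])
  then show "z = z'"
    using common_neighbour_eq[of z s w z'] pentagonD[OF assms(1)] pentagonD[OF assms(2)] \<open>w = w'\<close>
    by simp
qed

lemma pentagon_exists:
  assumes "t \<in> N s" "v \<in> N t" "s \<noteq> v"
  obtains w z where "pentagon s t v w z"
proof -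
  have "d s v = 2" using dist_2[of s t v] assms N_symD by simp
  then have "card (nbrs_at G 2 s v) = 1" by (rule a\<^sub>2_eq_1)
  then obtain w where "nbrs_at G 2 s v = {w}" by (auto simp: card_1_singleton_iff)
  then have w: "w \<in> N v" "d s w = 2" by (auto simp: nbrs_at_def)
  then obtain z where "z \<in> N s" "z \<in> N w" using d_2_iff[of s w] by blast
  then have "pentagon s t v w z" using assms w N_symD by (simp add: pentagon_def)
  then show thesis by (rule that)
qed

text \<open>The ball of radius 2 has 1 + 3 + 6 vertices. A vertex at distance 2 has one neighbour at
  distance 1 and one at distance 2, so its third neighbour lies outside the ball. The strict bound
  is what a covering by 20 vertices requires.\<close>

lemma card_vertices_gt_10: "CARD('v) > 10"
proof -
  fix x
  define S where "S y = N y - {x}" for y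
  have card_S: "card (S y) = 2" if "y \<in> N x" for y
    using N_symD[OF that] cubic(2)[of y] by (simp add: S_def)
  have disj: "S y \<inter> S z = {}" if "y \<in> N x" "z \<in> N x" "y \<noteq> z" for y z
    using common_neighbour_eq[of x y z] that N_symD by (auto simp: S_def)
  have "card (\<Union>y\<in>N x. S y) = (\<Sum>y\<in>N x. card (S y))"
    by (rule card_UN_disjoint) (use disj in auto)
  also have "\<dots> = 6" using card_S cubic(2) by simp
  finally have "card ((\<Union>y\<in>N x. S y) \<union> insert x (N x)) = 10"
    using no_triangle cubic(2)[of x] by (subst card_Un_disjoint) (auto simp: S_def)
  moreover obtain v where "v \<notin> (\<Union>y\<in>N x. S y) \<union> insert x (N x)"
  proof -
    obtain y where y: "y \<in> N x" using N_nonempty by blast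
    then have "S y \<noteq> {}" using card_S[OF y] by (metis card.empty zero_neq_numeral)
    then obtain z where z: "z \<in> N y" "z \<noteq> x" by (auto simp: S_def)
    have d: "d x z = 2" using dist_2[of x y z] y z N_symD by simp
    have "card (nbrs_at G 2 x z) = 1" by (rule a\<^sub>2_eq_1[OF d])
    moreover have "card (N x \<inter> N z) = 1" using c\<^sub>2[OF d] c\<^sub>2_eq_1 by simp
    ultimately have "card (nbrs_at G 2 x z \<union> (N x \<inter> N z)) \<le> 2"
      using card_Un_le[of "nbrs_at G 2 x z" "N x \<inter> N z"] by simp
    then have "card (nbrs_at G 2 x z \<union> (N x \<inter> N z)) < card (N z)" using cubic(2)[of z] by simp
    then have "\<not> N z \<subseteq> nbrs_at G 2 x z \<union> (N x \<inter> N z)"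
      by (metis card_mono finite linorder_not_le)
    then obtain v where v: "v \<in> N z" "v \<notin> N x" "d x v \<noteq> 2" by (auto simp: nbrs_at_def)
    have "x \<notin> N z"
    proof
      assume "x \<in> N z"
      then have "d x z = 1" by (rule d_1[OF N_symD])
      then show False using d by simp
    qed
    then have "v \<noteq> x" using v by auto
    moreover have "v \<notin> (\<Union>y\<in>N x. S y)"
    proof
      assume "v \<in> (\<Union>y\<in>N x. S y)"
      then obtain y where "y \<in> N x" "v \<in> N y" by (auto simp: S_def)
      then show False using dist_2[OF N_symD, of y x v] \<open>v \<noteq> x\<close> v(3) by simp
    qed
    ultimately show thesis using that v(2) by blast
  qed
  ultimately have "card (insert v ((\<Union>y\<in>N x. S y) \<union> insert x (N x))) = 11" by simp
  then have "11 \<le> CARD('v)" by (metis card_mono finite subset_UNIV)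
  then show ?thesis by simp
qed

text \<open>Keeps vertices chosen index by index periodic modulo 5: the conditions at
  \<open>i\<close> and \<open>i + 5\<close> pin down the same vertex.\<close>

lemma periodic_choice:
  fixes P :: "nat \<Rightarrow> 'v \<Rightarrow> bool"
  assumes "\<And>i. \<exists>v. P i v" and "\<And>i v w. P i v \<Longrightarrow> P (i + 5) w \<Longrightarrow> w = v"
  obtains f where "\<And>i. P i (f i)" "\<And>i. f (i + 5) = f i"
proof (rule that[of "\<lambda>i. SOME v. P i v"])
  show *: "P i (SOME v. P i v)" for i using assms(1) by (rule someI_ex)
  show "(SOME v. P (i + 5) v) = (SOME v. P i v)" for i by (rule assms(2)[OF * *])
qed

text \<open>Four layers seen from a face: \<open>a\<close> is a pentagon through \<open>x\<close>,
  \<open>b i\<close> the third neighbour of \<open>a i\<close>, \<open>c i\<close> closes the face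
  on the edge from \<open>a i\<close> to \<open>a (i + 1)\<close>, and \<open>e i\<close> is the
  third neighbour of \<open>c i\<close>. All incidences follow since each 2-path lies in one
  pentagon.\<close>

lemma dodecahedron_labelling:
  obtains a b c e :: "nat \<Rightarrow> 'v"
  where "a 0 = x" "\<And>i. a (i + 5) = a i" "\<And>i. b (i + 5) = b i" "\<And>i. c (i + 5) = c i"
    and "\<And>i. e (i + 5) = e i" "\<And>i. N (a i) = {a (i + 1), a (i + 4), b i}"
    and "\<And>i. N (b i) = {a i, c i, c (i + 4)}" "\<And>i. N (c i) = {b i, b (i + 1), e i}"
    and "\<And>i. N (e i) = {c i, e (i + 1), e (i + 4)}"
proof -
  have "card (N x) = 3" by (rule cubic)
  then obtain s t v where "N x = {s, t, v}" "s \<noteq> t" by (auto simp: card_3_iff)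
  then have st: "s \<in> N x" "t \<in> N x" "s \<noteq> t" by auto
  then obtain w z where pent: "pentagon s x t w z" using pentagon_exists N_symD by metis
  define a where "a i = [x, t, w, z, s] ! (i mod 5)" for i
  have a_per: "a (i + 5) = a i" for i by (simp add: a_def)
  have a: "pentagon (a i) (a (i + 1)) (a (i + 2)) (a (i + 3)) (a (i + 4))" for i
  proof -
    have *: "pentagon (a j) (a (j + 1)) (a (j + 2)) (a (j + 3)) (a (j + 4))"
      if "j \<in> {0, 1, 2, 3, 4}" for j
      using that pent by (elim insertE emptyE) (simp_all add: a_def pentagon_def)
    have "i mod 5 \<in> {0, 1, 2, 3, 4}" by auto
    from *[OF this] show ?thesis by (simp add: a_def mod_simps)
  qed
  have a_N: "a (i + 1) \<in> N (a i)" "a (i + 4) \<in> N (a i)" "a (i + 1) \<noteq> a (i + 4)" for i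
    using pentagonD[OF a[of i]] pentagon_distinct[OF a[of i]] by simp_all

  obtain b where b: "\<And>i. N (a i) = {a (i + 1), a (i + 4), b i} \<and> b i \<noteq> a (i + 1) \<and> b i \<noteq> a (i + 4)"
    and b_per: "\<And>i. b (i + 5) = b i"
  proof (rule periodic_choice[of "\<lambda>i v. N (a i) = {a (i + 1), a (i + 4), v} \<and>
      v \<noteq> a (i + 1) \<and> v \<noteq> a (i + 4)"])
    show "\<exists>v. N (a i) = {a (i + 1), a (i + 4), v} \<and> v \<noteq> a (i + 1) \<and> v \<noteq> a (i + 4)" for i
      using third_neighbour[OF a_N] by metis
    show "w = v" if v: "N (a i) = {a (i + 1), a (i + 4), v} \<and> v \<noteq> a (i + 1) \<and> v \<noteq> a (i + 4)"
      and w: "N (a (i + 5)) = {a (i + 5 + 1), a (i + 5 + 4), w} \<and> w \<noteq> a (i + 5 + 1) \<and> w \<noteq> a (i + 5 + 4)"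
      for i v w
    proof -
      have "a (i + 5 + 1) = a (i + 1)" "a (i + 5 + 4) = a (i + 4)"
        using a_per[of "i + 1"] a_per[of "i + 4"] by (simp_all add: add.commute)
      then have "{a (i + 1), a (i + 4), w} = {a (i + 1), a (i + 4), v}" "w \<noteq> a (i + 1)" "w \<noteq> a (i + 4)"
        using v w a_per[of i] by simp_all
      then show ?thesis by blast
    qed
  qed blast
  have N_a: "N (a i) = {a (i + 1), a (i + 4), b i}" for i using b by blast
  have b_N: "b i \<in> N (a i)" "a i \<in> N (b i)" for i
  proof -
    show "b i \<in> N (a i)" unfolding N_a by simp
    then show "a i \<in> N (b i)" by (rule N_symD)
  qed

  \<comment> \<open>The pentagon on \<open>b i\<close>, \<open>a i\<close>, \<open>a (i + 1)\<close>
    cannot go on to \<open>a (i + 2)\<close>, since the pentagon on that 2-path is the face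
    \<open>a\<close>; so it goes on to \<open>b (i + 1)\<close>.\<close>
  have Q: "\<exists>c. pentagon (b i) (a i) (a (i + 1)) (b (i + 1)) c" for i
  proof -
    obtain v w where vw: "pentagon (b i) (a i) (a (i + 1)) v w"
      using pentagon_exists[OF b_N(2) a_N(1)] b by blast
    have "v \<in> N (a (i + 1))" using vw by (simp add: pentagon_def)
    then have "v = a (i + 1 + 1) \<or> v = a (i + 1 + 4) \<or> v = b (i + 1)" unfolding N_a by blast
    moreover have "a (i + 1 + 4) = a i" using a_per[of i] by (simp add: add.commute)
    moreover have "v \<noteq> a i" using pentagon_distinct[OF vw] by auto
    moreover have "v \<noteq> a (i + 1 + 1)"
    proof
      assume "v = a (i + 1 + 1)"
      then have "pentagon (a i) (a (i + 1)) (a (i + 2)) w (b i)"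
        using pentagon_rotate[OF vw] by simp
      then have "b i = a (i + 4)" by (rule pentagon_unique(2)[OF _ a])
      then show False using b by blast
    qed
    ultimately show ?thesis using vw by auto
  qed
  obtain c where c: "\<And>i. pentagon (b i) (a i) (a (i + 1)) (b (i + 1)) (c i)"
    and c_per: "\<And>i. c (i + 5) = c i"
  proof (rule periodic_choice[of "\<lambda>i. pentagon (b i) (a i) (a (i + 1)) (b (i + 1))", OF Q])
    show "w = v" if v: "pentagon (b i) (a i) (a (i + 1)) (b (i + 1)) v"
      and w: "pentagon (b (i + 5)) (a (i + 5)) (a (i + 5 + 1)) (b (i + 5 + 1)) w" for i v w
    proof -
      have "a (i + 5 + 1) = a (i + 1)" "b (i + 5 + 1) = b (i + 1)"
        using a_per[of "i + 1"] b_per[of "i + 1"] by (simp_all add: add.commute)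
      then show ?thesis using pentagon_unique(2)[OF _ v] w a_per b_per by simp
    qed
  qed blast
  have c': "pentagon (b (i + 4)) (a (i + 4)) (a i) (b i) (c (i + 4))" for i
    using c[of "i + 4"] a_per[of i] b_per[of i] by (simp add: add.commute)
  have c_N: "c i \<in> N (b i)" "c i \<in> N (b (i + 1))" "c (i + 4) \<in> N (b i)" for i
    using pentagonD[OF c[of i]] pentagonD[OF c'[of i]] by simp_all
  \<comment> \<open>Otherwise the 2-path \<open>a i\<close>, \<open>b i\<close>, \<open>c i\<close>
    would lie in the faces over both edges of \<open>a\<close> at \<open>a i\<close>.\<close>
  have c_ne: "c i \<noteq> c (i + 4)" for i
  proof
    assume eq: "c i = c (i + 4)"
    have "pentagon (a i) (b i) (c i) (b (i + 1)) (a (i + 1))"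
      using pentagonD[OF c[of i]] by (simp add: pentagon_def)
    moreover have "pentagon (a i) (b i) (c i) (b (i + 4)) (a (i + 4))"
      using pentagonD[OF c'[of i]] eq by (simp add: pentagon_def)
    ultimately have "a (i + 1) = a (i + 4)" by (rule pentagon_unique(2))
    then show False using a_N by blast
  qed
  have N_b: "N (b i) = {a i, c i, c (i + 4)}" for i
    using N_eqI[OF b_N(2) c_N(1,3)] c_ne pentagon_distinct[OF c[of i]] pentagon_distinct[OF c'[of i]]
    by simp

  have b_c: "b i \<in> N (c i)" "b (i + 1) \<in> N (c i)" "b i \<noteq> b (i + 1)" for i
    using c_N[of i, THEN N_symD] pentagon_distinct[OF c[of i]] by simp_all
  obtain e where e: "\<And>i. N (c i) = {b i, b (i + 1), e i} \<and> e i \<noteq> b i \<and> e i \<noteq> b (i + 1)"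
    and e_per: "\<And>i. e (i + 5) = e i"
  proof (rule periodic_choice[of "\<lambda>i v. N (c i) = {b i, b (i + 1), v} \<and> v \<noteq> b i \<and> v \<noteq> b (i + 1)"])
    show "\<exists>v. N (c i) = {b i, b (i + 1), v} \<and> v \<noteq> b i \<and> v \<noteq> b (i + 1)" for i
      using third_neighbour[OF b_c] by metis
    show "w = v" if v: "N (c i) = {b i, b (i + 1), v} \<and> v \<noteq> b i \<and> v \<noteq> b (i + 1)"
      and w: "N (c (i + 5)) = {b (i + 5), b (i + 5 + 1), w} \<and> w \<noteq> b (i + 5) \<and> w \<noteq> b (i + 5 + 1)"
      for i v w
    proof -
      have "b (i + 5 + 1) = b (i + 1)" using b_per[of "i + 1"] by (simp add: add.commute)
      then have "{b i, b (i + 1), w} = {b i, b (i + 1), v}" "w \<noteq> b i" "w \<noteq> b (i + 1)"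
        using v w b_per[of i] c_per[of i] by simp_all
      then show ?thesis by blast
    qed
  qed blast
  have N_c: "N (c i) = {b i, b (i + 1), e i}" for i using e by blast
  have N_c': "N (c (i + 4)) = {b (i + 4), b i, e (i + 4)}" for i
    using N_c[of "i + 4"] b_per[of i] by (simp add: add.commute)
  have e_N: "c i \<in> N (e i)" for i
  proof -
    have "e i \<in> N (c i)" unfolding N_c by simp
    then show ?thesis by (rule N_symD)
  qed

  \<comment> \<open>Continuing this pentagon to \<open>b (i + 1)\<close> or \<open>b (i + 4)\<close>
    would share a 2-path with a face at \<open>a i\<close>; only the third neighbours
    \<open>e i\<close> and \<open>e (i + 4)\<close> remain.\<close>
  have R: "pentagon (c (i + 4)) (b i) (c i) (e i) (e (i + 4))" for i
  proof -
    obtain v w where vw: "pentagon (c (i + 4)) (b i) (c i) v w"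
      using pentagon_exists[OF N_symD[OF c_N(3)] c_N(1) c_ne[symmetric]] by blast
    have vw_N: "v \<in> N (c i)" "w \<in> N (c (i + 4))" using pentagonD[OF vw] by simp_all
    have dist: "distinct [c (i + 4), b i, c i, v, w]" by (rule pentagon_distinct[OF vw])
    have "v \<noteq> b (i + 1)"
    proof
      assume "v = b (i + 1)"
      then have "pentagon (b i) (c i) (b (i + 1)) w (c (i + 4))" using pentagon_rotate[OF vw] by simp
      moreover have "pentagon (b i) (c i) (b (i + 1)) (a (i + 1)) (a i)"
        using pentagonD[OF c[of i]] by (simp add: pentagon_def)
      ultimately have "c (i + 4) = a i" by (rule pentagon_unique(2))
      then show False using pentagon_distinct[OF c'[of i]] by simp
    qed
    then have v: "v = e i" using vw_N(1) dist unfolding N_c by auto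
    have "w \<noteq> b (i + 4)"
    proof
      assume "w = b (i + 4)"
      then have "pentagon (b i) (c (i + 4)) (b (i + 4)) v (c i)"
        using pentagonD[OF vw] by (simp add: pentagon_def)
      moreover have "pentagon (b i) (c (i + 4)) (b (i + 4)) (a (i + 4)) (a i)"
        using pentagonD[OF c'[of i]] by (simp add: pentagon_def)
      ultimately have "c i = a i" by (rule pentagon_unique(2))
      then show False using pentagon_distinct[OF c[of i]] by simp
    qed
    then have "w = e (i + 4)" using vw_N(2) dist unfolding N_c' by auto
    then show ?thesis using vw v by simp
  qed
  have R': "pentagon (c i) (b (i + 1)) (c (i + 1)) (e (i + 1)) (e i)" for i
    using R[of "i + 1"] c_per[of i] e_per[of i] by (simp add: add.commute)
  have e_e: "e (i + 1) \<in> N (e i)" "e (i + 4) \<in> N (e i)" for i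
    using pentagonD[OF R[of i]] pentagonD[OF R'[of i]] by simp_all
  \<comment> \<open>Equality would put the 2-path \<open>c i\<close>, \<open>e i\<close>,
    \<open>e (i + 1)\<close> into two pentagons, one through \<open>b i\<close> and one through
    \<open>b (i + 1)\<close>.\<close>
  have "e (i + 1) \<noteq> e (i + 4)" for i
  proof
    assume eq: "e (i + 1) = e (i + 4)"
    have "pentagon (c i) (e i) (e (i + 1)) (c (i + 4)) (b i)"
      using pentagonD[OF R[of i]] eq by (simp add: pentagon_def)
    moreover have "pentagon (c i) (e i) (e (i + 1)) (c (i + 1)) (b (i + 1))"
      using pentagonD[OF R'[of i]] by (simp add: pentagon_def)
    ultimately have "b i = b (i + 1)" by (rule pentagon_unique(2))
    then show False using b_c by blast
  qed
  then have N_e: "N (e i) = {c i, e (i + 1), e (i + 4)}" for i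
    using N_eqI[OF e_N e_e] pentagon_distinct[OF R[of i]] pentagon_distinct[OF R'[of i]] by simp
  have "a 0 = x" by (simp add: a_def)
  then show thesis by (rule that[OF _ a_per b_per c_per e_per N_a N_b N_c N_e])
qed

lemma dodecahedron:
  "distance_regular G \<and> digraph_iso (with_proj G) (with_proj dodecahedron_graph)"
proof (rule level_graph_covering[OF pverts_dodecahedron nbrs_dodecahedron wf_dodecahedron
      level_dodecahedron])
  show "card (N x) = 3" for x by (rule cubic)
  show "length dodecahedron_verts < 2 * CARD('v)"
    using card_vertices_gt_10 by (simp add: dodecahedron_verts_def)
  show "\<exists>f. f (1, 0) = x \<and> (\<forall>p\<in>set dodecahedron_verts. f ` set (dodecahedron_nbrs p) = N (f p))" for x
  proof -
    obtain a b c e :: "nat \<Rightarrow> 'v" where a0: "a 0 = x"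
      and per: "\<And>i. a (i + 5) = a i" "\<And>i. b (i + 5) = b i" "\<And>i. c (i + 5) = c i" "\<And>i. e (i + 5) = e i"
      and N: "\<And>i. N (a i) = {a (i + 1), a (i + 4), b i}" "\<And>i. N (b i) = {a i, c i, c (i + 4)}"
        "\<And>i. N (c i) = {b i, b (i + 1), e i}" "\<And>i. N (e i) = {c i, e (i + 1), e (i + 4)}"
      using dodecahedron_labelling[of x] by blast
    have per': "h 5 = h 0" "h 6 = h 1" "h 7 = h 2" "h 8 = h 3"
      if "\<And>i. h (i + 5) = h i" for h :: "nat \<Rightarrow> 'v"
      using that[of 0] that[of 1] that[of 2] that[of 3] by simp_all
    \<comment> \<open>The inner 5-cycles of the model consist of the even and of the odd indices and
      become \<open>a\<close> and \<open>e\<close>. The outer 10-cycle alternates between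
      \<open>b\<close> and \<open>c\<close>; halving turns inner steps by 2 into steps by 1.\<close>
    define f where "f v = (if fst v = 0
      then if even (snd v) then b (snd v div 2) else c (snd v div 2)
      else if even (snd v) then a (snd v div 2) else e (snd v div 2))" for v :: "nat \<times> nat"
    have "f ` set (dodecahedron_nbrs v) = N (f v)" if "v \<in> set dodecahedron_verts" for v
      using that unfolding dodecahedron_verts_def upt_10
      by (simp, elim disjE)
        (simp_all add: f_def N[of 0] N[of 1] N[of 2] N[of 3] N[of 4] per'[of a, OF per(1)] per'[of b, OF per(2)]
          per'[of c, OF per(3)] per'[of e, OF per(4)] insert_commute One_nat_def[symmetric] del: One_nat_def)
    then show ?thesis using a0 by (intro exI[of _ f]) (simp add: f_def)
  qed
qed

end

end

end

section \<open>The classification\<close>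

context connected_graph begin

lemma W_1: "W (Suc 0) x y = (if y \<in> N x then 1 else 0)"
  by (simp add: W_Suc W_0)

lemma W_2: "W 2 x y = card (N x \<inter> N y)"
proof -
  have "W 2 x y = (\<Sum>z\<in>N x. if y \<in> N z then 1 else 0)"
    by (simp only: numeral_2_eq_2 W_Suc[of "Suc 0"] W_1)
  also have "\<dots> = card {z \<in> N x. y \<in> N z}" by (simp add: sum.If_cases Int_def)
  also have "{z \<in> N x. y \<in> N z} = N x \<inter> N y" using N_sym[of y] by auto
  finally show ?thesis .
qed

text \<open>By induction on \<open>l\<close>: sorting the neighbours of \<open>y\<close> by their
  distance from \<open>x\<close> gives a recursion in which only \<open>d x y\<close>
  occurs.\<close>

lemma distance_regular_W_eq:
  assumes dr: "distance_regular G" and "d x y = d x' y'"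
  shows "W l x y = W l x' y'"
proof -
  define J where "J j = {i. j \<le> i + 1 \<and> i \<le> j + 1}" for j :: nat
  have fin_J: "finite (J j)" for j
    by (rule finite_subset[of _ "{..j + 1}"]) (auto simp: J_def)
  have "\<exists>c. \<forall>x y. d x y = j \<longrightarrow> card (nbrs_at G i x y) = c" if "i \<in> J j" for i j
  proof (cases "j \<le> graph_diameter G")
    case True
    then show ?thesis using dr that by (simp add: distance_regular_def J_def)
  next
    case False
    then show ?thesis using d_le_diameter by auto
  qed
  then obtain c where c: "\<And>i x y. i \<in> J (d x y) \<Longrightarrow> card (nbrs_at G i x y) = c i (d x y)"
    by metis
  have "\<exists>f. \<forall>x y. W l x y = f (d x y)"
  proof (induction l)
    case 0
    then show ?case by (intro exI[of _ "\<lambda>j. if j = 0 then 1 else 0"]) (simp add: W_0 d_0_iff)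
  next
    case (Suc l)
    then obtain f where f: "\<And>x y. W l x y = f (d x y)" by blast
    have "W (Suc l) x y = (\<Sum>i\<in>J (d x y). c i (d x y) * f i)" for x y
    proof -
      have N_y: "N y = (\<Union>i\<in>J (d x y). nbrs_at G i x y)"
      proof -
        have "d x z \<in> J (d x y)" if "z \<in> N y" for z
          using d_step[OF that, of x] d_step[of y z x] that N_sym by (auto simp: J_def)
        then show ?thesis by (auto simp: nbrs_at_def)
      qed
      have "W (Suc l) x y = (\<Sum>z\<in>N y. f (d x z))" by (simp only: W_Suc_right f)
      also have "\<dots> = (\<Sum>i\<in>J (d x y). \<Sum>z\<in>nbrs_at G i x y. f (d x z))"
        unfolding N_y by (rule sum.UNION_disjoint) (auto simp: fin_J nbrs_at_def)
      also have "\<dots> = (\<Sum>i\<in>J (d x y). \<Sum>z\<in>nbrs_at G i x y. f i)"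
        by (intro sum.cong refl) (simp add: nbrs_at_def)
      also have "\<dots> = (\<Sum>i\<in>J (d x y). c i (d x y) * f i)"
        by (intro sum.cong refl) (simp add: c)
      finally show ?thesis .
    qed
    then show ?case by (intro exI[of _ "\<lambda>j. \<Sum>i\<in>J j. c i j * f i"] allI)
  qed
  then obtain f where "\<forall>x y. W l x y = f (d x y)" by (elim exE)
  then show ?thesis using assms(2) by simp
qed

end

section \<open>Cubic graphs with \<open>c\<^sub>2 = 1\<close>, and the cubic case
  distinction\<close>

context triangle_free_represented_graph begin

context
  assumes c\<^sub>2_eq_1: "c\<^sub>2 = 1"
begin

text \<open>The 3-walks are counted by their last vertex \<open>z\<close> before \<open>y\<close>:
  there is one 2-walk from \<open>x\<close> to \<open>z\<close> if \<open>d x z = 2\<close>, and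
  none otherwise. Thus \<open>a\<^sub>2\<close> inherits its constancy from walk counts.\<close>

lemma card_nbrs_at_2:
  assumes "d x y = 2"
  shows "card (nbrs_at G 2 x y) = W 3 x y"
proof -
  have "W 2 x z = (if d x z = 2 then 1 else 0)" if "z \<in> N y" for z
  proof -
    have "z \<noteq> x" using that assms d_1_iff[of x y] N_sym by auto
    consider "d x z = 2" | "z \<in> N x" | "d x z \<noteq> 2" "z \<notin> N x" by blast
    then show ?thesis
    proof cases
      case 1
      then show ?thesis using c\<^sub>2 c\<^sub>2_eq_1 by (simp add: W_2)
    next
      case 2
      then have "d x z = 1" "card (N x \<inter> N z) = 0" using d_1 a\<^sub>1 a\<^sub>1_eq_0 c\<^sub>2_eq_1 by simp_all
      then show ?thesis by (simp add: W_2)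
    next
      case 3
      then have "N x \<inter> N z = {}" using \<open>z \<noteq> x\<close> d_2_iff[of x z] by blast
      then show ?thesis using 3 by (simp add: W_2)
    qed
  qed
  then have "W 3 x y = (\<Sum>z\<in>N y. if d x z = 2 then 1 else 0)"
    using W_Suc_right[of 2 x y] by simp
  also have "\<dots> = card (nbrs_at G 2 x y)"
    by (simp add: sum.If_cases Int_def nbrs_at_def)
  finally show ?thesis by simp
qed

text \<open>Supplies the configuration for \<open>inner_across_edge\<close>.\<close>

lemma distances_across_edge:
  obtains x y z w w' where "y \<in> N x" "z \<in> N x" "z \<noteq> y" "w \<in> N y" "w' \<in> N y" "w \<noteq> x" "w' \<noteq> x" "w \<noteq> w'"
    "d w x = 2" "d w' x = 2" "d w y = 1" "d w' y = 1"
proof -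
  obtain x y where y: "y \<in> N x" by (rule ex_adjacent)
  then have x: "x \<in> N y" by (rule N_symD)
  have "card (N x - {y}) = 2" "card (N y - {x}) = 2" using x y cubic(2) by simp_all
  then obtain z z' w w' where "N x - {y} = {z, z'}" "N y - {x} = {w, w'}" "w \<noteq> w'"
    by (auto simp: card_2_iff)
  then have zw: "z \<in> N x" "z \<noteq> y" "w \<in> N y" "w' \<in> N y" "w \<noteq> x" "w' \<noteq> x" "w \<noteq> w'" by blast+
  then have "d w x = 2" "d w' x = 2" "d w y = 1" "d w' y = 1"
    using dist_2 d_1 d_sym x by simp_all
  then show thesis using that y zw by blast
qed

lemma nbrs_at_2_subset:
  assumes "d w y = 1" shows "nbrs_at G 2 w x \<subseteq> N x - {y}"
  using assms by (auto simp: nbrs_at_def)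

text \<open>Otherwise \<open>w\<close> and \<open>w'\<close> are both at distance 2 from
  \<open>z\<close> and have the same inner product \<open>\<omega>\<^sub>2\<close> with it, against
  \<open>inner_across_edge\<close>.\<close>

lemma card_nbrs_at_2_lt_2:
  assumes a\<^sub>2: "\<And>x y. d x y = 2 \<Longrightarrow> card (nbrs_at G 2 x y) = a\<^sub>2"
  shows "a\<^sub>2 < 2"
proof (rule ccontr)
  assume *: "\<not> ?thesis"
  obtain x y z w w' where xy: "y \<in> N x" "z \<in> N x" "z \<noteq> y" "w \<in> N y" "w' \<in> N y" "w \<noteq> x" "w' \<noteq> x"
    "w \<noteq> w'" and dist: "d w x = 2" "d w' x = 2" "d w y = 1" "d w' y = 1"
    by (rule distances_across_edge)
  have "card (N x - {y}) = 2" using xy(1) cubic(2) by simp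
  moreover have "nbrs_at G 2 v x = N x - {y}" if "d v x = 2" "d v y = 1" "card (N x - {y}) = 2" for v
  proof (rule card_subset_eq)
    show sub: "nbrs_at G 2 v x \<subseteq> N x - {y}" by (rule nbrs_at_2_subset[OF that(2)])
    have "card (nbrs_at G 2 v x) \<le> card (N x - {y})" by (rule card_mono[OF _ sub]) simp
    then show "card (nbrs_at G 2 v x) = card (N x - {y})" using a\<^sub>2[OF that(1)] * that(3) by simp
  qed simp
  ultimately have "z \<in> nbrs_at G 2 w x" "z \<in> nbrs_at G 2 w' x" using dist xy by simp_all
  then have "d w z = 2" "d w' z = 2" by (simp_all add: nbrs_at_def)
  then show False using inner_across_edge[OF xy] inner_2 by simp
qed

text \<open>Here \<open>w\<close> and \<open>w'\<close> are both at distance 3 from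
  \<open>z\<close>. Distance-regularity would give them the same walk counts to \<open>z\<close>,
  hence the same inner product.\<close>

lemma not_distance_regular_if_no_pentagon:
  assumes a\<^sub>2: "\<And>x y. d x y = 2 \<Longrightarrow> card (nbrs_at G 2 x y) = 0"
    and u: "\<And>x y x' y'. (\<And>l. W l x y = W l x' y') \<Longrightarrow> u x \<bullet> u y = u x' \<bullet> u y'"
  shows "\<not> distance_regular G"
proof
  assume dr: "distance_regular G"
  obtain x y z w w' where xy: "y \<in> N x" "z \<in> N x" "z \<noteq> y" "w \<in> N y" "w' \<in> N y" "w \<noteq> x" "w' \<noteq> x"
    "w \<noteq> w'" and dist: "d w x = 2" "d w' x = 2" "d w y = 1" "d w' y = 1"
    by (rule distances_across_edge)
  have "d v z = 3" if v: "v \<in> N y" "v \<noteq> x" "d v x = 2" for v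
  proof -
    have "nbrs_at G 2 v x = {}" using a\<^sub>2[OF v(3)] by simp
    then have "d v z \<noteq> 2" using xy(2) by (auto simp: nbrs_at_def)
    moreover have "d v z \<noteq> 1"
    proof
      assume "d v z = 1"
      then have "v \<in> N z" using d_1_iff N_sym by blast
      then show False
        using common_neighbour_eq[OF c\<^sub>2_eq_1, of x y z v] v xy(1-3) N_symD by blast
    qed
    moreover have "d v z \<noteq> 0"
    proof
      assume "d v z = 0"
      then have "z \<in> N y" using v(1) by (simp add: d_0_iff)
      then show False by (rule no_triangle[OF xy(1,2)])
    qed
    moreover have "d v z \<le> 3" using d_step[OF xy(2), of v] v(3) by simp
    ultimately show ?thesis by linarith
  qed
  then have "d w z = d w' z" using xy dist by simp
  then have "W l w z = W l w' z" for l by (rule distance_regular_W_eq[OF dr])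
  then have "u w \<bullet> u z = u w' \<bullet> u z" by (rule u)
  then show False using inner_across_edge[OF xy] by simp
qed

end

lemma classification:
  assumes W_3: "\<And>x y x' y'. d x y = 2 \<Longrightarrow> d x' y' = 2 \<Longrightarrow> W 3 x y = W 3 x' y'"
    and u: "\<And>x y x' y'. (\<And>l. W l x y = W l x' y') \<Longrightarrow> u x \<bullet> u y = u x' \<bullet> u y'"
  shows "distance_regular G \<and> (digraph_iso (with_proj G) (with_proj cube_graph) \<or>
      digraph_iso (with_proj G) (with_proj dodecahedron_graph)) \<or>
    intersection_number_a G 1 0 \<and> intersection_number_a G 2 0 \<and> \<not> distance_regular G"
proof (cases "c\<^sub>2 = 2")
  case True
  then show ?thesis using cube by blast
next
  case False
  then have c: "c\<^sub>2 = 1" using c\<^sub>2_cases c\<^sub>2_ne_3 by blast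
  obtain x\<^sub>0 y\<^sub>0 where "d x\<^sub>0 y\<^sub>0 = 2" using distances_across_edge[OF c] by metis
  define a\<^sub>2 where "a\<^sub>2 = W 3 x\<^sub>0 y\<^sub>0"
  have a\<^sub>2: "card (nbrs_at G 2 x y) = a\<^sub>2" if "d x y = 2" for x y
    unfolding a\<^sub>2_def card_nbrs_at_2[OF c that] by (rule W_3) fact+
  have "a\<^sub>2 < 2" using a\<^sub>2 by (rule card_nbrs_at_2_lt_2[OF c])
  then consider "a\<^sub>2 = 1" | "a\<^sub>2 = 0" by linarith
  then show ?thesis
  proof cases
    case 1
    then show ?thesis using dodecahedron[OF c] a\<^sub>2 by simp
  next
    case 2
    have "intersection_number_a G 1 0"
      unfolding intersection_number_a_def
    proof (intro ballI impI)
      fix x y assume "d x y = 1"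
      then have "y \<in> N x" by (simp only: d_1_iff)
      then have "nbrs_at G 1 x y = {}"
        using no_triangle unfolding nbrs_at_def d_1_iff by blast
      then show "card (nbrs_at G 1 x y) = 0" by simp
    qed
    moreover have "intersection_number_a G 2 0"
      using a\<^sub>2 2 by (simp add: intersection_number_a_def)
    moreover have "\<not> distance_regular G"
    proof (rule not_distance_regular_if_no_pentagon[OF c])
      show "card (nbrs_at G 2 x y) = 0" if "d x y = 2" for x y using a\<^sub>2[OF that] 2 by simp
    qed (rule u)
    ultimately show ?thesis by blast
  qed
qed

end

section \<open>From 2-walk-regularity to the classification\<close>

context connected_graph begin

text \<open>The cubic alternative records the failure of distance-regularity, so both halves of the
  classification follow by propositional reasoning.\<close>

lemma two_walk_regular_multiplicity_3:
  assumes "two_walk_regular G" "\<not> complete_multipartite G" "has_valency G k" "k \<ge> 3"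
    and "\<theta> \<noteq> real k" "\<theta> \<noteq> - real k" "eigenvalue_multiplicity G \<theta> = 3"
  shows "distance_regular G \<and> (digraph_iso (with_proj G) (with_proj cube_graph) \<or>
      digraph_iso (with_proj G) (with_proj dodecahedron_graph) \<or>
      digraph_iso (with_proj G) (with_proj icosahedron_graph)) \<or>
    k = 3 \<and> intersection_number_a G 1 0 \<and> intersection_number_a G 2 0 \<and> \<not> distance_regular G"
proof -
  have diam: "graph_diameter G \<ge> 2" using assms(1) by (simp add: two_walk_regular_def)
  have W_eq: "W l x' y' = W l x y" if "d x y \<le> 2" "d x' y' = d x y" for l x y x' y'
  proof (rule assms(1)[unfolded two_walk_regular_def, THEN conjunct2, rule_format])
    show "d x y \<le> 2 \<and> d x' y' = d x y" using that by blast
  qed simp_all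
  have "W l x x = W l y y" for l x y by (rule W_eq) simp_all
  then obtain u :: "'v \<Rightarrow> real ^ 3" where u: "\<And>x. u x \<bullet> u x = 1" "\<And>x. (\<Sum>y\<in>N x. u y) = \<theta> *\<^sub>R u x"
    "\<And>x y x' y'. (\<And>l. W l x y = W l x' y') \<Longrightarrow> u x \<bullet> u y = u x' \<bullet> u y'"
    using representation[OF assms(7)] by blast
  have u_eq: "u x \<bullet> u y = u x' \<bullet> u y'" if "d x y = j" "d x' y' = j" "j \<le> 2" for x y x' y' j
    by (rule u(3), rule W_eq) (use that in simp_all)
  have common_eq: "card (N x \<inter> N y) = card (N x' \<inter> N y')"
    if "d x y = j" "d x' y' = j" "j \<le> 2" for x y x' y' j
    using W_eq[of x y x' y' 2] that by (simp add: W_2)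
  \<comment> \<open>One pair at distance 2 and one at distance 1 serve to define the constants of
    the locale.\<close>
  obtain x\<^sub>2 y\<^sub>2 where xy2: "d x\<^sub>2 y\<^sub>2 = 2" using ex_d_2[OF diam] by blast
  obtain z where z: "d x\<^sub>2 z = 1" by (rule d_pred[of x\<^sub>2 y\<^sub>2 1]) (use xy2 in simp_all)
  define a\<^sub>1 where "a\<^sub>1 = card (N x\<^sub>2 \<inter> N z)"
  define c\<^sub>2 where "c\<^sub>2 = card (N x\<^sub>2 \<inter> N y\<^sub>2)"
  have rep: "represented_graph G u k a\<^sub>1 c\<^sub>2 \<theta> (u x\<^sub>2 \<bullet> u z) (u x\<^sub>2 \<bullet> u y\<^sub>2)"
  proof (rule represented_graph.intro[OF connected_graph_axioms], rule represented_graph_axioms.intro)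
    show "card (N x) = k" for x using assms(3) by (simp add: has_valency_def)
    show "u x \<bullet> u y = u x\<^sub>2 \<bullet> u z" if "y \<in> N x" for x y
      using u_eq[OF that[folded d_1_iff] z] by simp
    show "card (N x \<inter> N y) = a\<^sub>1" if "y \<in> N x" for x y
      using common_eq[OF that[folded d_1_iff] z] by (simp add: a\<^sub>1_def)
    show "u x \<bullet> u y = u x\<^sub>2 \<bullet> u y\<^sub>2" if "d x y = 2" for x y
      using u_eq[OF that xy2] by simp
    show "card (N x \<inter> N y) = c\<^sub>2" if "d x y = 2" for x y
      using common_eq[OF that xy2] by (simp add: c\<^sub>2_def)
  qed (rule assms u)+
  consider "a\<^sub>1 = 0" | "a\<^sub>1 = 2"
    using represented_graph.a\<^sub>1_le_2[OF rep] represented_graph.a\<^sub>1_ne_1[OF rep] by linarith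
  then show ?thesis
  proof cases
    case 1
    then have rep0: "triangle_free_represented_graph G u k a\<^sub>1 c\<^sub>2 \<theta> (u x\<^sub>2 \<bullet> u z) (u x\<^sub>2 \<bullet> u y\<^sub>2)"
      by (intro triangle_free_represented_graph.intro[OF rep]
          triangle_free_represented_graph_axioms.intro)
    have "W 3 x y = W 3 x' y'" if "d x y = 2" "d x' y' = 2" for x y x' y'
      by (rule W_eq) (use that in simp_all)
    then show ?thesis
      using triangle_free_represented_graph.classification[OF rep0 _ u(3)]
        triangle_free_represented_graph.cubic(1)[OF rep0] by blast
  next
    case 2
    then show ?thesis using represented_graph.icosahedron[OF rep] by blast
  qed
qed

end

theorem theorem6p8:
  fixes \<Gamma> :: "'v::finite pair_pre_digraph" and k :: nat and \<theta> :: real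
  assumes "connected_simple_graph \<Gamma>"
    and "two_walk_regular \<Gamma>"
    and "\<not> complete_multipartite \<Gamma>"
    and "has_valency \<Gamma> k" and "k \<ge> 3"
    and "\<theta> \<noteq> real k" and "\<theta> \<noteq> - real k"
    and "eigenvalue_multiplicity \<Gamma> \<theta> = 3"
  shows "((k = 3 \<and> intersection_number_a \<Gamma> 1 0 \<and> intersection_number_a \<Gamma> 2 0)
            \<or> distance_regular \<Gamma>)
       \<and> (distance_regular \<Gamma> \<longrightarrow>
            digraph_iso (with_proj \<Gamma>) (with_proj cube_graph)
          \<or> digraph_iso (with_proj \<Gamma>) (with_proj dodecahedron_graph)
          \<or> digraph_iso (with_proj \<Gamma>) (with_proj icosahedron_graph))"
  using connected_graph.two_walk_regular_multiplicity_3[OF connected_graph.intro[OF assms(1)] assms(2-8)]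
  by blast

end
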